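(* Let $G$ be a finite soluble group. Then $\alpha(G)\leqslant \lambda(G)$. Moreover, if the derived subgroup $G'$ of $G$ is nilpotent, then $\alpha(G)\leqslant \delta(G)$.
   Context: For a finite group $G$, $\mathrm{Frat}(G)$ denotes the Frattini subgroup. The intersection number $\alpha(G)$ is the minimal number of maximal subgroups of $G$ whose intersection equals $\mathrm{Frat}(G)$. $\lambda(G)$ is the chief length of $G$ (number of factors in a chief series). A chief factor $H/K$ of $G$ is Frattini if $H/K\leqslant \mathrm{Frat}(G/K)$; $\delta(G)$ is the number of non-Frattini chief factors in a chief series of $G$ (independent of the chosen series). *)

theory Defs
  imports "HOL-Algebra.Algebra"
begin

definition maximal_subgroup :: "('a, 'b) monoid_scheme \<Rightarrow> 'a set \<Rightarrow> bool" where
  "maximal_subgroup G M \<longleftrightarrow> subgroup M G \<and> M \<noteq> carrier G \<and>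
     (\<forall>H. subgroup H G \<and> M \<subseteq> H \<longrightarrow> H = M \<or> H = carrier G)"

text \<open>Frattini subgroup: intersection of all maximal subgroups (the whole group if there are none).\<close>
definition frattini :: "('a, 'b) monoid_scheme \<Rightarrow> 'a set" where
  "frattini G = carrier G \<inter> \<Inter> {M. maximal_subgroup G M}"

text \<open>Intersection number: minimal number of maximal subgroups whose intersection is the
  Frattini subgroup (an empty family intersects to the whole group).\<close>
definition intersection_number :: "('a, 'b) monoid_scheme \<Rightarrow> nat" where
  "intersection_number G = (LEAST n. \<exists>\<M>. finite \<M> \<and> card \<M> = n \<and>
      (\<forall>M\<in>\<M>. maximal_subgroup G M) \<and> carrier G \<inter> \<Inter> \<M> = frattini G)"

definition chief_series :: "('a, 'b) monoid_scheme \<Rightarrow> (nat \<Rightarrow> 'a set) \<Rightarrow> nat \<Rightarrow> bool" where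
  "chief_series G N k \<longleftrightarrow>
     N 0 = {\<one>\<^bsub>G\<^esub>} \<and> N k = carrier G \<and>
     (\<forall>i\<le>k. N i \<lhd> G) \<and>
     (\<forall>i<k. N i \<subset> N (Suc i)) \<and>
     (\<forall>i<k. \<forall>H. H \<lhd> G \<and> N i \<subseteq> H \<and> H \<subseteq> N (Suc i) \<longrightarrow> H = N i \<or> H = N (Suc i))"

definition frattini_chief_factor :: "('a, 'b) monoid_scheme \<Rightarrow> 'a set \<Rightarrow> 'a set \<Rightarrow> bool" where
  "frattini_chief_factor G H K \<longleftrightarrow> (\<lambda>h. K #>\<^bsub>G\<^esub> h) ` H \<subseteq> frattini (G Mod K)"

definition non_frattini_count :: "('a, 'b) monoid_scheme \<Rightarrow> (nat \<Rightarrow> 'a set) \<Rightarrow> nat \<Rightarrow> nat" where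
  "non_frattini_count G N k = card {i. i < k \<and> \<not> frattini_chief_factor G (N (Suc i)) (N i)}"

fun lower_central :: "('a, 'b) monoid_scheme \<Rightarrow> nat \<Rightarrow> 'a set" where
  "lower_central G 0 = carrier G"
| "lower_central G (Suc n) = generate G
     (\<Union>x \<in> lower_central G n. \<Union>y \<in> carrier G.
        {x \<otimes>\<^bsub>G\<^esub> y \<otimes>\<^bsub>G\<^esub> inv\<^bsub>G\<^esub> x \<otimes>\<^bsub>G\<^esub> inv\<^bsub>G\<^esub> y})"

definition nilpotent :: "('a, 'b) monoid_scheme \<Rightarrow> bool" where
  "nilpotent G \<longleftrightarrow> (\<exists>n. lower_central G n = {\<one>\<^bsub>G\<^esub>})"

end

theory Submission
  imports Defs
begin

text \<open>We argue relative to a normal subgroup \<open>T\<close>, by induction on the index of \<open>T\<close>, with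
  \<open>frattini_over T\<close> the preimage of the Frattini subgroup of \<open>G/T\<close>. Assume that \<open>T = frattini_over T\<close>, let
  \<open>N/T\<close> be a minimal normal subgroup of \<open>G/T\<close> and let the maximal subgroup \<open>M\<close> be a complement of it modulo
  \<open>T\<close>. By induction few maximal subgroups intersect in \<open>Q = frattini_over N\<close>. A Frattini argument
  shows that the order of \<open>Q/N\<close> is coprime to the prime \<open>p\<close> dividing the order of \<open>N/T\<close>, and \<open>Q \<inter> M\<close> acts
  faithfully on \<open>N/T\<close>. Hence for every chief factor of \<open>G\<close> between \<open>N\<close> and \<open>Q\<close> a single conjugate
  of \<open>M\<close>, given by a vector in a regular orbit of a coprime abelian group, reduces the intersection
  by this factor. In total at most one maximal subgroup is used for each chief factor above \<open>T\<close>.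

  If \<open>G'\<close> is nilpotent, it centralises all chief factors. Modulo \<open>T\<close>, the Frattini subgroup of \<open>G\<close>, there is a
  normal subgroup \<open>F\<close> which is a product of complemented minimal normal subgroups, equals its own
  centraliser, and thus contains \<open>G'\<close>. A complement of \<open>F\<close> is an intersection of as many maximal subgroups
  as \<open>F/T\<close> has factors, and each further conjugate cuts it by the full centraliser of a chief factor.
  So it suffices to kill the socle of the abelian group \<open>G/F\<close>, whose length equals that of
  the quotient of \<open>G/F\<close> by its Frattini subgroup.\<close>

section \<open>Coprime actions and fixed points of \<open>p\<close>-groups\<close>

text \<open>Everything stays inside \<open>G\<close>: passing to \<open>G/T\<close> would change the
  type of the group at each step of an induction, so centralisers, chief factors and Frattini
  subgroups are taken modulo \<open>T\<close>, and \<open>G Mod T\<close> is formed only locally.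
  Lengths are measured from \<open>T\<close> up to \<open>G\<close>, so that counts compare by
  addition. The chains met in the proof are not the given chief series; a Jordan-Hoelder argument
  for weighted factors makes both lengths independent of the chain. Coprimeness is the crux of the
  first bound: an abelian group acting faithfully on an abelian group need not have a regular orbit,
  but a coprime one does. The subgroup to be cut is abelian at each step because, modulo
  \<open>T\<close>, it embeds in one chief factor of \<open>G\<close>. This count charges the chief
  factors between \<open>N\<close> and \<open>frattini_over N\<close>, all of which are Frattini, so
  it cannot give \<delta>. The second bound must charge non-Frattini factors only, and so it
  collects all complements of the factors of \<open>F/T\<close> before any conjugate is
  used.\<close>

lemma (in group) inv_mult_cancel [simp]:
  assumes "x \<in> carrier G" "y \<in> carrier G"
  shows "inv x \<otimes> (x \<otimes> y) = y" "x \<otimes> (inv x \<otimes> y) = y"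
  using assms by (simp_all flip: m_assoc)

lemma (in group) commute_inv:
  assumes "x \<in> carrier G" "y \<in> carrier G" "x \<otimes> y = y \<otimes> x"
  shows "x \<otimes> inv y = inv y \<otimes> x"
proof -
  have "inv y \<otimes> (x \<otimes> y) \<otimes> inv y = inv y \<otimes> (y \<otimes> x) \<otimes> inv y" using assms by simp
  then show ?thesis using assms(1,2) by (simp add: m_assoc)
qed

lemma (in group) commute_mult:
  assumes "x \<in> carrier G" "y \<in> carrier G" "z \<in> carrier G"
    and "x \<otimes> y = y \<otimes> x" "x \<otimes> z = z \<otimes> x"
  shows "x \<otimes> (y \<otimes> z) = (y \<otimes> z) \<otimes> x"
  using assms by (metis m_assoc)

section \<open>Actions of p-groups: fixed points, Sylow subgroups, fixed vectors\<close>

lemma group_actionI: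
  fixes G (structure)
  assumes "group G"
    and closed: "\<And>g x. g \<in> carrier G \<Longrightarrow> x \<in> E \<Longrightarrow> f g x \<in> E"
    and one: "\<And>x. x \<in> E \<Longrightarrow> f \<one> x = x"
    and mult: "\<And>g h x. g \<in> carrier G \<Longrightarrow> h \<in> carrier G \<Longrightarrow> x \<in> E \<Longrightarrow> f (g \<otimes> h) x = f g (f h x)"
  shows "group_action G E (\<lambda>g. restrict (f g) E)"
proof -
  interpret group G by fact
  have bij: "bij_betw (f g) E E" if g: "g \<in> carrier G" for g
  proof (rule bij_betw_byWitness[where f' = "f (inv g)"])
    show "\<forall>x\<in>E. f (inv g) (f g x) = x" "\<forall>x\<in>E. f g (f (inv g) x) = x"
      using g by (simp_all flip: mult add: one)
  qed (use g closed in auto)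
  have mem: "restrict (f g) E \<in> Bij E" if "g \<in> carrier G" for g
    using bij[OF that] by (simp add: Bij_def cong: bij_betw_cong)
  have "(\<lambda>g. restrict (f g) E) \<in> hom G (BijGroup E)"
  proof (rule homI)
    show "restrict (f g) E \<in> carrier (BijGroup E)" if "g \<in> carrier G" for g
      using mem[OF that] by (simp add: BijGroup_def)
    show "restrict (f (g \<otimes> h)) E = restrict (f g) E \<otimes>\<^bsub>BijGroup E\<^esub> restrict (f h) E"
      if "g \<in> carrier G" "h \<in> carrier G" for g h
      using that mem closed by (auto simp: BijGroup_def compose_def mult intro!: restrict_ext)
  qed
  then show ?thesis
    unfolding group_action_def group_hom_def group_hom_axioms_def
    using group_BijGroup is_group by blast
qed

text \<open>Orbits have p-power length, so each orbit that is not a fixed point contributes 0 modulo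
  \<open>p\<close>. The equivalence serves both ways: to find a fixed coset when the number of
  cosets is prime to \<open>p\<close>, and to find a second fixed vector.\<close>

lemma p_group_card_fixed_points:
  fixes G (structure)
  assumes grp: "group G" and ord: "order G = p ^ a" and p: "Factorial_Ring.prime p" and fin: "finite E"
    and closed: "\<And>g x. g \<in> carrier G \<Longrightarrow> x \<in> E \<Longrightarrow> f g x \<in> E"
    and one: "\<And>x. x \<in> E \<Longrightarrow> f \<one> x = x"
    and mult: "\<And>g h x. g \<in> carrier G \<Longrightarrow> h \<in> carrier G \<Longrightarrow> x \<in> E \<Longrightarrow> f (g \<otimes> h) x = f g (f h x)"
  shows "p dvd card {x \<in> E. \<forall>g\<in>carrier G. f g x = x} \<longleftrightarrow> p dvd card E"
proof -
  define \<phi> where "\<phi> = (\<lambda>g. restrict (f g) E)"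
  interpret A: group_action G E \<phi>
    unfolding \<phi>_def using group_actionI[OF grp closed one mult] .
  let ?F = "{x \<in> E. \<forall>g\<in>carrier G. f g x = x}"
  have self: "x \<in> orbit G \<phi> x" if "x \<in> E" for x
    using A.orbit_refl that .
  have orb: "orbit G \<phi> x = {f g x | g. g \<in> carrier G}" if "x \<in> E" for x
    using that by (auto simp: orbit_def \<phi>_def)
  have cases: "card orb = 1 \<and> orb \<subseteq> ?F \<or> p dvd card orb \<and> orb \<inter> ?F = {}" if orb_mem: "orb \<in> orbits G E \<phi>" for orb
  proof -
    obtain x where x: "x \<in> E" "orb = orbit G \<phi> x"
      using orb_mem unfolding orbits_def by blast
    have orbE: "orb \<subseteq> E"
      using x closed orb by auto
    have "card orb dvd p ^ a"
      using A.orbit_stabilizer_theorem[OF x(1)] ord x(2) by (metis dvd_triv_left)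
    then obtain k where k: "card orb = p ^ k"
      using divides_primepow_nat[OF p] by blast
    show ?thesis
    proof (cases "k = 0")
      case True
      then have "orb = {x}"
        using k self[OF x(1)] x(2) by (metis card_1_singletonE power_0 singletonD)
      then have "orb \<subseteq> ?F"
        using x orb[OF x(1)] by auto
      then show ?thesis using True k by simp
    next
      case False
      have "orb \<inter> ?F = {}"
      proof (rule ccontr)
        assume "orb \<inter> ?F \<noteq> {}"
        then obtain y where y: "y \<in> orb" "y \<in> ?F" by blast
        have "orbit G \<phi> y = {y}"
          using y orb[of y] one monoid.one_closed[OF group.is_monoid[OF grp]] by force
        moreover have "orbit G \<phi> y \<in> orbits G E \<phi>" "y \<in> orbit G \<phi> y"
          using y self by (auto simp: orbits_def)
        ultimately have "orb = {y}"
          using A.disjoint_union[OF orb_mem] y by (metis IntI empty_iff)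
        moreover have "1 < p ^ k"
          using False prime_gt_1_nat[OF p] one_less_power[of p k] by simp
        ultimately show False using k by simp
      qed
      then show ?thesis using k False by auto
    qed
  qed
  have "card E = (\<Sum>x\<in>E. 1)" by simp
  also have "\<dots> = (\<Sum>orb\<in>orbits G E \<phi>. \<Sum>x\<in>orb. 1)"
    using A.disjoint_sum[OF fin, of "\<lambda>_. 1::nat"] by simp
  finally have cE: "card E = (\<Sum>orb\<in>orbits G E \<phi>. card orb)" by simp
  have "card ?F = (\<Sum>x\<in>E. if x \<in> ?F then 1 else 0)"
    using fin by (simp add: sum.If_cases Int_def)
  also have "\<dots> = (\<Sum>orb\<in>orbits G E \<phi>. \<Sum>x\<in>orb. if x \<in> ?F then 1 else 0)"
    using A.disjoint_sum[OF fin, of "\<lambda>x. if x \<in> ?F then 1 else (0::nat)"] by simp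
  finally have cF: "card ?F = (\<Sum>orb\<in>orbits G E \<phi>. \<Sum>x\<in>orb. if x \<in> ?F then 1 else 0)" .
  have "(\<Sum>x\<in>orb. if x \<in> ?F then 1 else 0) mod p = card orb mod p" if "orb \<in> orbits G E \<phi>" for orb
    using cases[OF that]
  proof
    assume "card orb = 1 \<and> orb \<subseteq> ?F"
    then have "(\<Sum>x\<in>orb. if x \<in> ?F then 1 else 0) = (\<Sum>x\<in>orb. 1::nat)"
      by (intro sum.cong) auto
    then show ?thesis by simp
  next
    assume *: "p dvd card orb \<and> orb \<inter> ?F = {}"
    then have "(\<Sum>x\<in>orb. if x \<in> ?F then 1 else 0) = (\<Sum>x\<in>orb. 0::nat)"
      by (intro sum.cong) auto
    then show ?thesis using * by simp
  qed
  then have "card ?F mod p = card E mod p"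
    unfolding cE cF by (subst (1 2) mod_sum_eq[symmetric]) (simp cong: sum.cong)
  then show ?thesis by (simp add: dvd_eq_mod_eq_0)
qed

text \<open>\<open>R\<close> acts on the right cosets of \<open>P\<close>, whose number is prime to
  \<open>p\<close>, so it fixes some \<open>P #> a\<close>; this says that \<open>a\<close>
  conjugates \<open>R\<close> into \<open>P\<close>. The inverse in \<open>C #> inv g\<close> makes
  it a left action.\<close>

lemma (in group) p_subgroup_in_conjugate_of_sylow:
  assumes fin: "finite (carrier G)" and p: "Factorial_Ring.prime p"
    and P: "subgroup P G" "\<not> p dvd card (rcosets P)" and R: "subgroup R G" "card R = p ^ b"
  shows "\<exists>a\<in>carrier G. \<forall>g\<in>R. a \<otimes> g \<otimes> inv a \<in> P"
proof -
  let ?F = "{C. C \<in> rcosets P \<and> (\<forall>g\<in>R. C #> inv g = C)}"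
  have RG: "R \<subseteq> carrier G" and PG: "P \<subseteq> carrier G"
    using R P by (auto dest: subgroup.subset)
  interpret R: group "G\<lparr>carrier := R\<rparr>"
    using subgroup.subgroup_is_group[OF R(1)] is_group .
  have sub: "C \<subseteq> carrier G" if "C \<in> rcosets P" for C
    using subgroup.rcosets_carrier[OF P(1) is_group that] .
  have "p dvd card {C. C \<in> rcosets P \<and> (\<forall>g\<in>carrier (G\<lparr>carrier := R\<rparr>). C #> inv g = C)} \<longleftrightarrow> p dvd card (rcosets P)"
  proof (rule p_group_card_fixed_points[where a = b])
    show "finite (rcosets P)"
      using fin by (auto simp: RCOSETS_def)
    show "C #> inv g \<in> rcosets P" if "g \<in> carrier (G\<lparr>carrier := R\<rparr>)" "C \<in> rcosets P" for g C
      using that RG PG by (auto simp: RCOSETS_def coset_mult_assoc intro!: bexI[of _ "_ \<otimes> inv g"])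
    show "C #> inv \<one>\<^bsub>G\<lparr>carrier := R\<rparr>\<^esub> = C" if "C \<in> rcosets P" for C
      using sub[OF that] by simp
    show "C #> inv (g \<otimes>\<^bsub>G\<lparr>carrier := R\<rparr>\<^esub> h) = C #> inv h #> inv g"
      if "g \<in> carrier (G\<lparr>carrier := R\<rparr>)" "h \<in> carrier (G\<lparr>carrier := R\<rparr>)" "C \<in> rcosets P" for g h C
      using that RG sub[OF that(3)] by (simp add: coset_mult_assoc inv_mult_group subset_iff)
  qed (use R p R.is_group in \<open>simp_all add: order_def\<close>)
  then have "\<not> p dvd card ?F" using P by simp
  then have "?F \<noteq> {}" by (metis card.empty dvd_0_right)
  then obtain C where C: "C \<in> rcosets P" "\<And>g. g \<in> R \<Longrightarrow> C #> inv g = C" by blast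
  then obtain a where a: "a \<in> carrier G" "C = P #> a" by (auto simp: RCOSETS_def)
  have "a \<otimes> g \<otimes> inv a \<in> P" if g: "g \<in> R" for g
  proof -
    have "a \<otimes> g \<in> P #> a"
      using C(2)[of "inv g"] a g RG PG R(1) rcos_self[of "a \<otimes> g" P] P(1)
      by (auto simp: coset_mult_assoc subgroup.m_inv_closed)
    then show ?thesis
      using subgroup.rcos_module[OF P(1) is_group] a g RG by auto
  qed
  then show ?thesis using a by blast
qed

lemma (in group) pow_subgroup:
  assumes "subgroup A G" "a \<in> A" shows "a [^] (n::nat) \<in> A"
  using assms by (induct n) (auto simp: subgroup.one_closed subgroup.m_closed)

lemma (in group) ord_dvd_card_subgroup:
  assumes A: "subgroup A G" "finite A" "a \<in> A"
  shows "ord a dvd card A"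
proof -
  interpret A: group "G\<lparr>carrier := A\<rparr>"
    using subgroup.subgroup_is_group[OF A(1)] is_group .
  have "a [^] (card A) = \<one>"
    using A.pow_order_eq_1[of a] A by (simp add: order_def nat_pow_consistent flip: nat_pow_consistent)
  then show ?thesis
    using pow_eq_id subgroup.mem_carrier[OF A(1,3)] by blast
qed

text \<open>The unit is a fixed point and the number of fixed points is divisible by
  \<open>p\<close>, so there is another one. The homomorphism \<open>f\<close> allows a p-subgroup
  to act on a section of a quotient through the projection.\<close>

lemma (in group) p_group_fixes_vector:
  fixes R (structure)
  assumes R: "group R" "order R = p ^ a" and p: "Factorial_Ring.prime p" and f: "f \<in> hom R G"
    and A: "subgroup A G" "finite A" "p dvd card A"
    and inv: "\<And>g x. g \<in> carrier R \<Longrightarrow> x \<in> A \<Longrightarrow> f g \<otimes>\<^bsub>G\<^esub> x \<otimes>\<^bsub>G\<^esub> inv\<^bsub>G\<^esub> (f g) \<in> A"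
  shows "\<exists>x\<in>A. x \<noteq> \<one>\<^bsub>G\<^esub> \<and> (\<forall>g\<in>carrier R. f g \<otimes>\<^bsub>G\<^esub> x = x \<otimes>\<^bsub>G\<^esub> f g)"
proof -
  interpret F: group_hom R G f
    using R f by (simp add: group_hom_def group_hom_axioms_def is_group)
  have AG: "x \<in> carrier G" if "x \<in> A" for x
    using A that subgroup.mem_carrier by metis
  let ?F = "{x \<in> A. \<forall>g\<in>carrier R. f g \<otimes>\<^bsub>G\<^esub> x \<otimes>\<^bsub>G\<^esub> inv\<^bsub>G\<^esub> (f g) = x}"
  have "p dvd card ?F"
  proof (subst p_group_card_fixed_points[OF R p A(2)])
    show "f (g \<otimes>\<^bsub>R\<^esub> h) \<otimes>\<^bsub>G\<^esub> x \<otimes>\<^bsub>G\<^esub> inv\<^bsub>G\<^esub> f (g \<otimes>\<^bsub>R\<^esub> h) =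
          f g \<otimes>\<^bsub>G\<^esub> (f h \<otimes>\<^bsub>G\<^esub> x \<otimes>\<^bsub>G\<^esub> inv\<^bsub>G\<^esub> f h) \<otimes>\<^bsub>G\<^esub> inv\<^bsub>G\<^esub> f g"
      if "g \<in> carrier R" "h \<in> carrier R" "x \<in> A" for g h x
      using that AG by (simp add: m_assoc inv_mult_group)
  qed (use inv AG A in auto)
  moreover have one: "\<one>\<^bsub>G\<^esub> \<in> ?F"
    using A by (auto simp: subgroup.one_closed)
  ultimately have "card ?F \<noteq> 1" "card ?F \<noteq> 0"
    using p A by (auto simp: prime_nat_iff)
  then obtain x where "x \<in> ?F" "x \<noteq> \<one>\<^bsub>G\<^esub>"
    using one by (metis (no_types, lifting) card_1_singleton_iff is_singletonI' is_singleton_altdef empty_iff)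
  moreover have "f g \<otimes>\<^bsub>G\<^esub> x = x \<otimes>\<^bsub>G\<^esub> f g" if "g \<in> carrier R" for g
  proof -
    have "f g \<otimes>\<^bsub>G\<^esub> x \<otimes>\<^bsub>G\<^esub> inv\<^bsub>G\<^esub> (f g) = x" using \<open>x \<in> ?F\<close> that by blast
    then show ?thesis using that AG \<open>x \<in> ?F\<close>
      by (metis (no_types, lifting) inv_solve_right' F.hom_closed m_closed mem_Collect_eq)
  qed
  ultimately show ?thesis by blast
qed

section \<open>Regular vectors for coprime abelian actions\<close>

lemma (in group) nat_pow_comm_elem:
  assumes "x \<in> carrier G" "y \<in> carrier G" "x \<otimes> y = y \<otimes> x"
  shows "x [^] (n::nat) \<otimes> y = y \<otimes> x [^] n"
proof (induct n)
  case (Suc n)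
  have "x [^] Suc n \<otimes> y = x [^] n \<otimes> y \<otimes> x" using assms by (simp add: m_assoc)
  then show ?case using assms Suc by (simp add: m_assoc)
qed (use assms in simp)

text \<open>Here \<open>c\<close> is the commutator \<open>[y, e]\<close>. If \<open>y\<close>
  commutes with it, then conjugation by \<open>y^k\<close> multiplies \<open>e\<close> by
  \<open>c^k\<close>, and \<open>k = r\<close> gives \<open>c^r = 1\<close>.\<close>

lemma (in group) coprime_commutator_fixed:
  assumes A: "subgroup A G" and e: "e \<in> A" and c: "c \<in> A" and y: "y \<in> carrier G"
    and comm: "\<And>a b. a \<in> A \<Longrightarrow> b \<in> A \<Longrightarrow> a \<otimes> b = b \<otimes> a"
    and ce: "y \<otimes> e \<otimes> inv y = c \<otimes> e" and cy: "y \<otimes> c = c \<otimes> y"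
    and r: "y [^] (r::nat) = \<one>" and cop: "\<And>a. a \<in> A \<Longrightarrow> a [^] r = \<one> \<Longrightarrow> a = \<one>"
  shows "c = \<one>"
proof -
  have [simp]: "e \<in> carrier G" "c \<in> carrier G" "y \<in> carrier G"
    using A e c y by (auto intro: subgroup.mem_carrier)
  have ye: "y \<otimes> e = c \<otimes> e \<otimes> y"
    using ce by (metis \<open>c \<in> carrier G\<close> \<open>e \<in> carrier G\<close> inv_solve_right' m_closed y)
  have "y [^] k \<otimes> e = c [^] k \<otimes> e \<otimes> y [^] k" for k :: nat
  proof (induct k)
    case (Suc k)
    have "y [^] Suc k \<otimes> e = y [^] k \<otimes> (y \<otimes> e)" by (simp add: m_assoc)
    also have "\<dots> = (y [^] k \<otimes> c) \<otimes> (e \<otimes> y)" by (simp add: ye m_assoc)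
    also have "y [^] k \<otimes> c = c \<otimes> y [^] k" using cy by (intro nat_pow_comm_elem) simp_all
    also have "c \<otimes> y [^] k \<otimes> (e \<otimes> y) = c \<otimes> (y [^] k \<otimes> e) \<otimes> y" by (simp add: m_assoc)
    also have "\<dots> = (c \<otimes> c [^] k) \<otimes> e \<otimes> (y [^] k \<otimes> y)" by (simp add: Suc m_assoc)
    also have "\<dots> = c [^] Suc k \<otimes> e \<otimes> y [^] Suc k" by (simp add: nat_pow_Suc2 flip: nat_pow_Suc2)
    finally show ?case .
  qed simp
  from this[of r] have "c [^] r \<otimes> e = \<one> \<otimes> e" by (simp add: r)
  then have "c [^] r = \<one>" by (simp del: l_one)
  then show ?thesis using cop c by blast
qed


text \<open>If \<open>y\<close> stabilises \<open>v\<close> but moves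
  \<open>b\<close>, then adding the commutator \<open>[y, b]\<close> to \<open>v\<close> shrinks the stabiliser, because coprimeness forces
  \<open>C\<^sub>A(y) \<inter> [y, A] = 1\<close>.\<close>
lemma (in group) coprime_abelian_regular_vector:
  assumes A: "subgroup A G" and Y: "subgroup Y G" "finite Y"
    and Aab: "\<And>a b. a \<in> A \<Longrightarrow> b \<in> A \<Longrightarrow> a \<otimes> b = b \<otimes> a"
    and Yab: "\<And>a b. a \<in> Y \<Longrightarrow> b \<in> Y \<Longrightarrow> a \<otimes> b = b \<otimes> a"
    and norm: "\<And>y a. y \<in> Y \<Longrightarrow> a \<in> A \<Longrightarrow> y \<otimes> a \<otimes> inv y \<in> A"
    and r: "\<And>y. y \<in> Y \<Longrightarrow> y [^] (r::nat) = \<one>"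
    and cop: "\<And>a. a \<in> A \<Longrightarrow> a [^] r = \<one> \<Longrightarrow> a = \<one>"
  shows "\<exists>v\<in>A. \<forall>y\<in>Y. y \<otimes> v = v \<otimes> y \<longrightarrow> (\<forall>a\<in>A. y \<otimes> a = a \<otimes> y)"
proof -
  define S where "S = (\<lambda>v. {y \<in> Y. y \<otimes> v = v \<otimes> y})"
  have "\<exists>v. v \<in> A \<and> (\<forall>w. w \<in> A \<longrightarrow> card (S v) \<le> card (S w))"
    using ex_has_least_nat[of "\<lambda>v. v \<in> A" \<one> "\<lambda>v. card (S v)"] subgroup.one_closed[OF A] by blast
  then obtain v where v: "v \<in> A" "\<And>w. w \<in> A \<Longrightarrow> card (S v) \<le> card (S w)" by blast
  have AG [simp]: "a \<in> carrier G" if "a \<in> A" for a using A that by (rule subgroup.mem_carrier)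
  have YG [simp]: "a \<in> carrier G" if "a \<in> Y" for a using Y(1) that by (rule subgroup.mem_carrier)
  have [simp]: "a \<otimes> b \<in> A" "inv a \<in> A" if "a \<in> A" "b \<in> A" for a b
    using A that by (auto intro: subgroup.m_closed subgroup.m_inv_closed)
  have "y \<otimes> b = b \<otimes> y" if y: "y \<in> Y" "y \<otimes> v = v \<otimes> y" and b: "b \<in> A" for y b
  proof (rule ccontr)
    assume neq: "y \<otimes> b \<noteq> b \<otimes> y"
    \<comment> \<open>\<open>d a\<close> is the commutator \<open>[y, a]\<close>; it is
      multiplicative in \<open>a\<close> because \<open>A\<close> is abelian and normalised by
      \<open>y\<close>.\<close>
    define d where "d = (\<lambda>a. y \<otimes> a \<otimes> inv y \<otimes> inv a)"
    have dA [simp]: "d a \<in> A" if "a \<in> A" for a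
      using norm[OF y(1) that] that by (simp add: d_def)
    have ydA: "y \<otimes> a \<otimes> inv y = d a \<otimes> a" if "a \<in> A" for a
      using y(1) that by (simp add: d_def m_assoc)
    have dmult: "d (a \<otimes> c) = d a \<otimes> d c" if ac: "a \<in> A" "c \<in> A" for a c
    proof -
      have "y \<otimes> (a \<otimes> c) \<otimes> inv y = (y \<otimes> a \<otimes> inv y) \<otimes> (y \<otimes> c \<otimes> inv y)"
        using ac y(1) by (simp add: m_assoc inv_solve_left)
      also have "\<dots> = (d a \<otimes> a) \<otimes> (d c \<otimes> c)"
        using ydA ac by simp
      also have "\<dots> = d a \<otimes> (a \<otimes> d c) \<otimes> c" using ac dA by (simp add: m_assoc)
      also have "a \<otimes> d c = d c \<otimes> a" using Aab ac dA by blast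
      also have "d a \<otimes> (d c \<otimes> a) \<otimes> c = (d a \<otimes> d c) \<otimes> (a \<otimes> c)" using ac dA by (simp add: m_assoc)
      finally show ?thesis
        using ydA[of "a \<otimes> c"] ac y(1) by (metis AG dA r_cancel m_closed \<open>\<And>b a. \<lbrakk>a \<in> A; b \<in> A\<rbrakk> \<Longrightarrow> a \<otimes> b \<in> A\<close>)
    qed
    have fixed: "c = \<one>" if "e \<in> A" "c = d e" "y \<otimes> c = c \<otimes> y" for c e
      using coprime_commutator_fixed[OF A that(1) _ _ Aab, of c y r] that r cop y(1) ydA by auto
    define w where "w = d b"
    have w: "w \<in> A" "w \<noteq> \<one>"
    proof -
      show "w \<in> A" using b by (simp add: w_def)
      show "w \<noteq> \<one>" using neq ydA[OF b] b y(1) by (auto simp: w_def inv_solve_right')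
    qed
    have "S (v \<otimes> w) \<subset> S v"
    proof
      show "S (v \<otimes> w) \<subseteq> S v"
      proof
        fix z assume "z \<in> S (v \<otimes> w)"
        then have z: "z \<in> Y" "z \<otimes> (v \<otimes> w) = (v \<otimes> w) \<otimes> z" by (auto simp: S_def)
        define conj where "conj = (\<lambda>a. z \<otimes> a \<otimes> inv z)"
        have conjA [simp]: "conj a \<in> A" if "a \<in> A" for a using norm z(1) that by (simp add: conj_def)
        have cm: "conj (a \<otimes> c) = conj a \<otimes> conj c" if "a \<in> carrier G" "c \<in> carrier G" for a c
          using that z(1) by (simp add: conj_def m_assoc inv_solve_left)
        have ci: "conj (inv a) = inv (conj a)" if "a \<in> carrier G" for a
          using that z(1) by (simp add: conj_def inv_mult_group m_assoc)
        have cy: "conj y = y" using Yab[OF y(1) z(1)] y z by (simp add: conj_def inv_solve_right')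
        have vw: "conj v \<otimes> conj w = v \<otimes> w"
          using z v(1) w(1) by (simp flip: cm) (simp add: conj_def m_assoc)
        \<comment> \<open>\<open>c\<close> is \<open>[z, v]\<close>. As \<open>z\<close> fixes
          \<open>v \<otimes> w\<close>, also \<open>c = w \<otimes> inv (conj w)\<close>, which is a
          value of \<open>d\<close> because \<open>z\<close> commutes with \<open>y\<close>. On the
          other hand \<open>y\<close> commutes with \<open>v\<close> and with \<open>conj v\<close>,
          hence with \<open>c\<close>, so \<open>fixed\<close> yields
          \<open>c = \<one>\<close>.\<close>
        define c where "c = conj v \<otimes> inv v"
        have cA: "c \<in> A" using v(1) by (simp add: c_def)
        have c2: "c = w \<otimes> inv (conj w)"
        proof -
          have "conj v \<otimes> conj w = w \<otimes> v" using vw Aab v(1) w(1) by metis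
          then have "conj v = w \<otimes> v \<otimes> inv (conj w)" using v(1) w(1) by (simp add: inv_solve_right)
          also have "\<dots> = w \<otimes> (v \<otimes> inv (conj w))" using v(1) w(1) by (simp add: m_assoc)
          also have "v \<otimes> inv (conj w) = inv (conj w) \<otimes> v" using Aab v(1) w(1) by simp
          finally show ?thesis using v(1) w(1) by (simp add: c_def m_assoc)
        qed
        have "conj w = d (conj b)"
          using b y(1) cm[of "y \<otimes> b \<otimes> inv y" "inv b"] cm[of "y \<otimes> b" "inv y"] cm[of y b] ci[of b] ci[of y]
          by (simp add: w_def d_def cy)
        moreover have dinv: "d (inv a) = inv (d a)" if "a \<in> A" for a
        proof -
          have "d \<one> = \<one>" using y(1) by (simp add: d_def)
          then have "d (inv a) \<otimes> d a = \<one>" using dmult[of "inv a" a] that by simp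
          then show ?thesis using that inv_equality[of "d (inv a)" "d a"] by simp
        qed
        ultimately have "c = d (b \<otimes> inv (conj b))"
          using b by (simp add: c2 dmult w_def)
        moreover have "y \<otimes> c = c \<otimes> y"
        proof -
          have "y \<otimes> conj v = conj v \<otimes> y"
            using cm[of y v] cm[of v y] cy y v(1) by simp
          then show ?thesis
            using commute_mult[of y "conj v" "inv v"] commute_inv[of y v] y v(1) by (simp add: c_def)
        qed
        ultimately have "c = \<one>" using fixed[of "b \<otimes> inv (conj b)" c] b by simp
        then have "conj v = v" using v(1) by (simp add: c_def inv_solve_right')
        then have "z \<otimes> v = v \<otimes> z" using z(1) v(1) by (simp add: conj_def inv_solve_right')
        then show "z \<in> S v" using z(1) by (simp add: S_def)
      qed
      have "y \<in> S v" using y by (simp add: S_def)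
      \<comment> \<open>\<open>w\<close> is a nontrivial value of \<open>d\<close>, so
        \<open>fixed\<close> forbids \<open>y\<close> to commute with it.\<close>
      moreover have "y \<notin> S (v \<otimes> w)"
      proof
        assume "y \<in> S (v \<otimes> w)"
        then have "y \<otimes> v \<otimes> w = v \<otimes> w \<otimes> y" using v(1) w(1) y(1) by (simp add: S_def m_assoc)
        then have "v \<otimes> (y \<otimes> w) = v \<otimes> (w \<otimes> y)" using y v(1) w(1) by (simp add: m_assoc)
        then have "y \<otimes> w = w \<otimes> y" using v(1) w(1) y(1) by simp
        then show False using fixed[OF b w_def] w by blast
      qed
      ultimately show "S (v \<otimes> w) \<noteq> S v" by blast
    qed
    moreover have "finite (S v)" using Y(2) by (simp add: S_def)
    ultimately show False
      using v(2)[of "v \<otimes> w"] v(1) w(1) psubset_card_mono by (metis leD \<open>\<And>b a. \<lbrakk>a \<in> A; b \<in> A\<rbrakk> \<Longrightarrow> a \<otimes> b \<in> A\<close>)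
  qed
  then show ?thesis using v(1) by blast
qed

section \<open>Maximal subgroups and relative Frattini subgroups\<close>

context group
begin

definition frattini_over :: "'a set \<Rightarrow> 'a set" where
  "frattini_over T = carrier G \<inter> \<Inter> {M. maximal_subgroup G M \<and> T \<subseteq> M}"

definition chief_factor :: "'a set \<Rightarrow> 'a set \<Rightarrow> bool" where
  "chief_factor T N \<longleftrightarrow> T \<lhd> G \<and> N \<lhd> G \<and> T \<subset> N \<and>
     (\<forall>H. H \<lhd> G \<and> T \<subseteq> H \<and> H \<subseteq> N \<longrightarrow> H = T \<or> H = N)"

text \<open>This is \<open>v M v^-1\<close>, written so that membership unfolds without a
  witness.\<close>

definition conjugate :: "'a \<Rightarrow> 'a set \<Rightarrow> 'a set" where
  "conjugate v M = {x \<in> carrier G. inv v \<otimes> x \<otimes> v \<in> M}"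

lemma normal_subset: "N \<lhd> G \<Longrightarrow> N \<subseteq> carrier G"
  by (simp add: normal_imp_subgroup subgroup.subset)

lemma set_multI: "a \<in> A \<Longrightarrow> b \<in> B \<Longrightarrow> a \<otimes> b \<in> A <#> B"
  by (auto simp: set_mult_def)

lemma set_multE:
  assumes "x \<in> A <#> B" obtains a b where "a \<in> A" "b \<in> B" "x = a \<otimes> b"
  using assms by (auto simp: set_mult_def)

lemma subset_set_mult:
  assumes "subgroup A G" "subgroup B G" shows "A \<subseteq> A <#> B" "B \<subseteq> A <#> B"
proof -
  show "A \<subseteq> A <#> B"
    using set_multI[OF _ subgroup.one_closed[OF assms(2)]] assms(1)
    by (metis r_one subgroup.mem_carrier subsetI)
  show "B \<subseteq> A <#> B"
    using set_multI[OF subgroup.one_closed[OF assms(1)]] assms(2)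
    by (metis l_one subgroup.mem_carrier subsetI)
qed

lemma set_mult_least:
  assumes "subgroup H G" "A \<subseteq> H" "B \<subseteq> H" shows "A <#> B \<subseteq> H"
  using assms by (auto simp: set_mult_def intro: subgroup.m_closed)

lemma normal_set_mult:
  assumes N: "N \<lhd> G" and K: "K \<lhd> G" shows "N <#> K \<lhd> G"
proof (rule normal_invI)
  show "subgroup (N <#> K) G"
    using mult_norm_subgroup[OF N] K normal_imp_subgroup by blast
  fix x h assume x: "x \<in> carrier G" and "h \<in> N <#> K"
  then obtain n k where nk: "n \<in> N" "k \<in> K" "h = n \<otimes> k" by (auto elim: set_multE)
  moreover have "n \<in> carrier G" "k \<in> carrier G"
    using nk normal_subset[OF N] normal_subset[OF K] by auto
  ultimately have "x \<otimes> h \<otimes> inv x = (x \<otimes> n \<otimes> inv x) \<otimes> (x \<otimes> k \<otimes> inv x)"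
    using x by (simp add: m_assoc)
  then show "x \<otimes> h \<otimes> inv x \<in> N <#> K"
    using set_multI normal_invE(2)[OF N x nk(1)] normal_invE(2)[OF K x nk(2)] by simp
qed

text \<open>Dedekind's modular law for sets of products. Neither factor has to be normal, so it
  applies to factorisations of \<open>G\<close> by complements and to intersections of
  complements.\<close>

lemma dedekind:
  assumes A: "subgroup A G" and B: "subgroup B G" and C: "subgroup C G" and AC: "A \<subseteq> C"
  shows "(A <#> B) \<inter> C = A <#> (B \<inter> C)"
proof (intro equalityI subsetI)
  fix x assume x: "x \<in> (A <#> B) \<inter> C"
  then obtain a b where ab: "a \<in> A" "b \<in> B" "x = a \<otimes> b" by (auto elim: set_multE)
  have "inv a \<otimes> x = b" using ab A B by (simp add: subgroup.mem_carrier)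
  moreover have "inv a \<otimes> x \<in> C" using ab A AC C x by (auto intro!: subgroup.m_closed subgroup.m_inv_closed)
  ultimately show "x \<in> A <#> (B \<inter> C)" using ab by (auto intro: set_multI)
next
  fix x assume "x \<in> A <#> (B \<inter> C)"
  then obtain a b where "a \<in> A" "b \<in> B" "b \<in> C" "x = a \<otimes> b" by (auto elim: set_multE)
  then show "x \<in> (A <#> B) \<inter> C" using AC C by (auto intro: set_multI subgroup.m_closed)
qed

lemma set_mult_absorb:
  assumes "subgroup A G" "subgroup B G" "A \<subseteq> B" shows "A <#> B = B"
  using subset_set_mult[OF assms(1,2)] set_mult_least[OF assms(2,3)] by blast

lemma maximal_subgroupD:
  assumes "maximal_subgroup G M"
  shows "subgroup M G" "M \<noteq> carrier G" "\<And>H. subgroup H G \<Longrightarrow> M \<subseteq> H \<Longrightarrow> H = M \<or> H = carrier G"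
  using assms by (auto simp: maximal_subgroup_def)

lemma maximal_mult_normal:
  assumes M: "maximal_subgroup G M" and N: "N \<lhd> G" "\<not> N \<subseteq> M"
  shows "N <#> M = carrier G"
  using maximal_subgroupD(3)[OF M mult_norm_subgroup[OF N(1) maximal_subgroupD(1)[OF M]]]
    subset_set_mult[OF normal_imp_subgroup[OF N(1)] maximal_subgroupD(1)[OF M]] N(2) by auto

lemma conjugate_subgroup:
  assumes v: "v \<in> carrier G" and H: "subgroup H G" shows "subgroup (conjugate v H) G"
proof (rule subgroupI)
  show "conjugate v H \<subseteq> carrier G" by (auto simp: conjugate_def)
  show "conjugate v H \<noteq> {}"
    using v subgroup.one_closed[OF H] by (auto simp: conjugate_def intro!: exI[of _ \<one>])
  fix a assume a: "a \<in> conjugate v H"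
  then have ac: "a \<in> carrier G" by (simp add: conjugate_def)
  have "inv (inv v \<otimes> a \<otimes> v) \<in> H"
    using a H by (auto simp: conjugate_def intro: subgroup.m_inv_closed)
  then show "inv a \<in> conjugate v H"
    using v ac by (simp add: conjugate_def inv_mult_group m_assoc)
  fix b assume b: "b \<in> conjugate v H"
  then have bc: "b \<in> carrier G" by (simp add: conjugate_def)
  have "(inv v \<otimes> a \<otimes> v) \<otimes> (inv v \<otimes> b \<otimes> v) \<in> H"
    using a b H by (auto simp: conjugate_def intro: subgroup.m_closed)
  then show "a \<otimes> b \<in> conjugate v H"
    using v ac bc by (simp add: conjugate_def m_assoc)
qed

lemma conjugate_conjugate:
  assumes "v \<in> carrier G" "w \<in> carrier G"
  shows "conjugate v (conjugate w M) = conjugate (v \<otimes> w) M"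
  using assms by (auto simp: conjugate_def inv_mult_group m_assoc)

lemma conjugate_one: "M \<subseteq> carrier G \<Longrightarrow> conjugate \<one> M = M"
  by (auto simp: conjugate_def)

lemma conjugate_mono: "M \<subseteq> H \<Longrightarrow> conjugate v M \<subseteq> conjugate v H"
  by (auto simp: conjugate_def)

lemma conjugate_carrier: "v \<in> carrier G \<Longrightarrow> conjugate v (carrier G) = carrier G"
  by (auto simp: conjugate_def)

lemma normal_conjugate:
  assumes "N \<lhd> G" "v \<in> carrier G" shows "conjugate v N = N"
proof -
  have le: "N \<subseteq> conjugate w N" if "w \<in> carrier G" for w
    using normal.inv_op_closed1[OF assms(1) that] normal_subset[OF assms(1)] by (auto simp: conjugate_def)
  have "conjugate v N \<subseteq> conjugate v (conjugate (inv v) N)"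
    using le[of "inv v"] assms(2) by (intro conjugate_mono) simp
  then show ?thesis
    using le[OF assms(2)] assms by (simp add: conjugate_conjugate conjugate_one normal_subset)
qed

lemma maximal_conjugate:
  assumes M: "maximal_subgroup G M" and v: "v \<in> carrier G"
  shows "maximal_subgroup G (conjugate v M)"
  unfolding maximal_subgroup_def
proof (intro conjI allI impI)
  show "subgroup (conjugate v M) G"
    using conjugate_subgroup v maximal_subgroupD(1)[OF M] by blast
  have cancel: "conjugate (inv v) (conjugate v H) = H" "conjugate v (conjugate (inv v) H) = H" if "subgroup H G" for H
    using v subgroup.subset[OF that] by (simp_all add: conjugate_conjugate conjugate_one)
  show "conjugate v M \<noteq> carrier G"
    using cancel(1)[OF maximal_subgroupD(1)[OF M]] maximal_subgroupD(2)[OF M] v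
    by (metis conjugate_carrier inv_closed)
  fix H assume H: "subgroup H G \<and> conjugate v M \<subseteq> H"
  have "M \<subseteq> conjugate (inv v) H"
    using conjugate_mono[of "conjugate v M" H "inv v"] H cancel(1)[OF maximal_subgroupD(1)[OF M]] by simp
  then have "conjugate (inv v) H = M \<or> conjugate (inv v) H = carrier G"
    using maximal_subgroupD(3)[OF M] conjugate_subgroup[of "inv v" H] H v by simp
  then show "H = conjugate v M \<or> H = carrier G"
    using cancel(2)[of H] H conjugate_carrier[OF v] by metis
qed

lemma normal_if_maximal_family_invariant:
  assumes "\<And>M v. M \<in> \<M> \<Longrightarrow> v \<in> carrier G \<Longrightarrow> conjugate v M \<in> \<M>" and "\<And>M. M \<in> \<M> \<Longrightarrow> subgroup M G"
  shows "carrier G \<inter> \<Inter> \<M> \<lhd> G"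
proof (rule normal_invI)
  have "subgroup (\<Inter> (insert (carrier G) \<M>)) G"
    using assms(2) subgroup_self by (intro subgroups_Inter) auto
  then show "subgroup (carrier G \<inter> \<Inter> \<M>) G" by simp
  fix x h assume x: "x \<in> carrier G" and h: "h \<in> carrier G \<inter> \<Inter> \<M>"
  have "x \<otimes> h \<otimes> inv x \<in> K" if K: "K \<in> \<M>" for K
  proof -
    have "conjugate (inv x) K \<in> \<M>" using x by (intro assms(1) K) simp
    then have "h \<in> conjugate (inv x) K" using h by blast
    then show ?thesis using x by (simp add: conjugate_def)
  qed
  then show "x \<otimes> h \<otimes> inv x \<in> carrier G \<inter> \<Inter> \<M>" using x h by simp
qed

lemma frattini_over_normal:
  assumes T: "T \<lhd> G" shows "frattini_over T \<lhd> G"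
proof -
  let ?\<M> = "{M. maximal_subgroup G M \<and> T \<subseteq> M}"
  have "conjugate v M \<in> ?\<M>" if "M \<in> ?\<M>" "v \<in> carrier G" for M v
    using conjugate_mono[of T M v] normal_conjugate[OF T that(2)] maximal_conjugate that by simp
  then show ?thesis
    unfolding frattini_over_def
    by (intro normal_if_maximal_family_invariant) (auto dest: maximal_subgroupD)
qed

lemma subset_frattini_over: "T \<subseteq> carrier G \<Longrightarrow> T \<subseteq> frattini_over T"
  by (auto simp: frattini_over_def)

lemma frattini_over_mono: "T \<subseteq> T' \<Longrightarrow> frattini_over T \<subseteq> frattini_over T'"
  by (auto simp: frattini_over_def)

lemma frattini_over_subset: "maximal_subgroup G M \<Longrightarrow> T \<subseteq> M \<Longrightarrow> frattini_over T \<subseteq> M"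
  by (auto simp: frattini_over_def)

lemma frattini_over_eq:
  assumes "T \<subseteq> T'" "T' \<subseteq> frattini_over T" shows "frattini_over T' = frattini_over T"
  using assms by (fastforce simp: frattini_over_def)

lemma frattini_over_one: "frattini_over {\<one>} = frattini G"
  by (auto simp: frattini_over_def frattini_def dest: maximal_subgroupD subgroup.one_closed)

lemma supplement_exists:
  assumes "\<not> N \<subseteq> frattini_over T" "N \<subseteq> carrier G"
  obtains M where "maximal_subgroup G M" "T \<subseteq> M" "\<not> N \<subseteq> M"
  using assms by (auto simp: frattini_over_def)

lemma chief_factorD:
  assumes "chief_factor T N"
  shows "T \<lhd> G" "N \<lhd> G" "T \<subset> N" "\<And>H. H \<lhd> G \<Longrightarrow> T \<subseteq> H \<Longrightarrow> H \<subseteq> N \<Longrightarrow> H = T \<or> H = N"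
  using assms by (auto simp: chief_factor_def)

end

section \<open>Maximal subgroups and chief factors in finite groups\<close>

locale finite_group = group +
  assumes finite_carrier: "finite (carrier G)"
begin

lemma finite_subgroup: "subgroup H G \<Longrightarrow> finite H"
  using finite_carrier subgroup.subset finite_subset by metis

lemma finite_normal: "N \<lhd> G \<Longrightarrow> finite N"
  using finite_subgroup normal_imp_subgroup by blast

lemma maximal_subgroup_above:
  assumes H: "subgroup H G" "H \<noteq> carrier G"
  obtains M where "maximal_subgroup G M" "H \<subseteq> M"
proof -
  let ?S = "{K. subgroup K G \<and> K \<noteq> carrier G \<and> H \<subseteq> K}"
  have "?S \<subseteq> Pow (carrier G)" by (auto dest: subgroup.subset)
  then have "finite ?S" using finite_carrier by (meson finite_Pow_iff finite_subset)
  moreover have "H \<in> ?S" using H by auto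
  ultimately obtain M where "M \<in> ?S" "\<forall>K\<in>?S. M \<subseteq> K \<longrightarrow> M = K"
    using finite_has_maximal2[of ?S "H"] by (auto simp del: mem_Collect_eq)
  then show thesis using that[of M] by (auto simp: maximal_subgroup_def dest: subgroup.subset)
qed

lemma chief_factor_above:
  assumes T: "T \<lhd> G" and K: "K \<lhd> G" and less: "T \<subset> K"
  obtains N where "chief_factor T N" "N \<subseteq> K"
proof -
  let ?S = "{N. N \<lhd> G \<and> T \<subset> N \<and> N \<subseteq> K}"
  have "?S \<subseteq> Pow (carrier G)" by (auto dest: normal_subset)
  then have "finite ?S" using finite_carrier by (meson finite_Pow_iff finite_subset)
  moreover have "K \<in> ?S" using K less by auto
  ultimately obtain N where "N \<in> ?S" "\<forall>L\<in>?S. N \<supseteq> L \<longrightarrow> N = L"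
    using finite_has_minimal2[of ?S "K"] by (auto simp del: mem_Collect_eq)
  then have "chief_factor T N" "N \<subseteq> K"
    unfolding chief_factor_def using T by (simp_all add: psubset_eq) (metis subset_trans)
  then show thesis by (rule that)
qed

lemma chief_factor_below:
  assumes T: "T \<lhd> G" and K: "K \<lhd> G" and less: "T \<subset> K"
  obtains L where "chief_factor L K" "T \<subseteq> L"
proof -
  let ?S = "{L. L \<lhd> G \<and> T \<subseteq> L \<and> L \<subset> K}"
  have "?S \<subseteq> Pow (carrier G)" by (auto dest: normal_subset)
  then have "finite ?S" using finite_carrier by (meson finite_Pow_iff finite_subset)
  moreover have "T \<in> ?S" using T less by auto
  ultimately obtain L where "L \<in> ?S" "\<forall>N\<in>?S. L \<subseteq> N \<longrightarrow> L = N"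
    using finite_has_maximal2[of ?S "T"] by (auto simp del: mem_Collect_eq)
  then have "chief_factor L K" "T \<subseteq> L"
    unfolding chief_factor_def using K by (auto simp: psubset_eq)
  then show thesis by (rule that)
qed

end

section \<open>Centralisers of chief factors and lengths of chief series\<close>

context group
begin

text \<open>For normal \<open>T\<close>, the preimage of the centraliser of the image of
  \<open>S\<close> in \<open>G/T\<close>. Besides normal subgroups, \<open>S\<close> will be a
  singleton or a union of conjugates.\<close>

definition centralizer_mod :: "'a set \<Rightarrow> 'a set \<Rightarrow> 'a set" where
  "centralizer_mod T S = {g \<in> carrier G. \<forall>s\<in>S. g \<otimes> s \<otimes> inv g \<otimes> inv s \<in> T}"

lemma centralizer_modD: "g \<in> centralizer_mod T S \<Longrightarrow> s \<in> S \<Longrightarrow> g \<otimes> s \<otimes> inv g \<otimes> inv s \<in> T"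
  by (auto simp: centralizer_mod_def)

lemma conjugate_decompose:
  assumes "g \<in> carrier G" "s \<in> carrier G"
  shows "g \<otimes> s \<otimes> inv g = (g \<otimes> s \<otimes> inv g \<otimes> inv s) \<otimes> s"
  using assms by (simp add: m_assoc)

lemma centralizer_mod_subgroup:
  assumes T: "T \<lhd> G" and S: "S \<subseteq> carrier G"
  shows "subgroup (centralizer_mod T S) G"
proof (rule subgroupI)
  have TG: "subgroup T G" using T normal_imp_subgroup by blast
  show "centralizer_mod T S \<noteq> {}"
    using S subgroup.one_closed[OF TG] by (auto simp: centralizer_mod_def subset_iff intro!: exI[of _ \<one>])
  fix a assume a: "a \<in> centralizer_mod T S"
  then have ac: "a \<in> carrier G" by (simp add: centralizer_mod_def)
  have "inv a \<otimes> s \<otimes> inv (inv a) \<otimes> inv s \<in> T" if s: "s \<in> S" for s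
  proof -
    have "inv a \<otimes> inv (a \<otimes> s \<otimes> inv a \<otimes> inv s) \<otimes> inv (inv a) \<in> T"
      using centralizer_modD[OF a s] ac subgroup.m_inv_closed[OF TG] normal_invE(2)[OF T] by blast
    then show ?thesis using ac S s by (simp add: m_assoc inv_mult_group subset_iff)
  qed
  then show "inv a \<in> centralizer_mod T S" using ac by (simp add: centralizer_mod_def)
  fix b assume b: "b \<in> centralizer_mod T S"
  then have bc: "b \<in> carrier G" by (simp add: centralizer_mod_def)
  have "(a \<otimes> b) \<otimes> s \<otimes> inv (a \<otimes> b) \<otimes> inv s \<in> T" if s: "s \<in> S" for s
  proof -
    have "a \<otimes> (b \<otimes> s \<otimes> inv b \<otimes> inv s) \<otimes> inv a \<otimes> (a \<otimes> s \<otimes> inv a \<otimes> inv s) \<in> T"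
      using centralizer_modD[OF a s] centralizer_modD[OF b s] normal_invE(2)[OF T ac] subgroup.m_closed[OF TG] by blast
    then show ?thesis using ac bc S s by (simp add: m_assoc inv_mult_group subset_iff)
  qed
  then show "a \<otimes> b \<in> centralizer_mod T S" using ac bc by (simp add: centralizer_mod_def)
qed (auto simp: centralizer_mod_def)

lemma centralizer_mod_normal:
  assumes T: "T \<lhd> G" and S: "S \<subseteq> carrier G"
    and inv: "\<And>x s. x \<in> carrier G \<Longrightarrow> s \<in> S \<Longrightarrow> x \<otimes> s \<otimes> inv x \<in> S"
  shows "centralizer_mod T S \<lhd> G"
proof (rule normal_invI[OF centralizer_mod_subgroup[OF T S]])
  fix x h assume x: "x \<in> carrier G" and h: "h \<in> centralizer_mod T S"
  have hc: "h \<in> carrier G" using h by (simp add: centralizer_mod_def)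
  have "(x \<otimes> h \<otimes> inv x) \<otimes> s \<otimes> inv (x \<otimes> h \<otimes> inv x) \<otimes> inv s \<in> T" if s: "s \<in> S" for s
  proof -
    define s' where "s' = inv x \<otimes> s \<otimes> x"
    have s': "s' \<in> S" using inv[of "inv x" s] x s by (simp add: s'_def)
    have "x \<otimes> (h \<otimes> s' \<otimes> inv h \<otimes> inv s') \<otimes> inv x \<in> T"
      using centralizer_modD[OF h s'] normal_invE(2)[OF T x] by blast
    then show ?thesis using x hc S s by (simp add: s'_def m_assoc inv_mult_group subset_iff)
  qed
  then show "x \<otimes> h \<otimes> inv x \<in> centralizer_mod T S" using x hc by (simp add: centralizer_mod_def)
qed

lemma centralizer_mod_normal':
  assumes T: "T \<lhd> G" and N: "N \<lhd> G" shows "centralizer_mod T N \<lhd> G"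
  using centralizer_mod_normal[OF T normal_subset[OF N]] normal_invE(2)[OF N] by blast

text \<open>\<open>[a, b]\<close> and \<open>[b, a]\<close> are inverse to each other. The exchange
  of roles turns information on what centralises \<open>N\<close> into information on what
  \<open>N\<close> centralises.\<close>

lemma centralizer_mod_sym:
  assumes T: "subgroup T G" and AB: "A \<subseteq> carrier G" "B \<subseteq> carrier G" and le: "A \<subseteq> centralizer_mod T B"
  shows "B \<subseteq> centralizer_mod T A"
proof
  fix b assume b: "b \<in> B"
  have "b \<otimes> a \<otimes> inv b \<otimes> inv a \<in> T" if a: "a \<in> A" for a
  proof -
    have "inv (a \<otimes> b \<otimes> inv a \<otimes> inv b) \<in> T"
      using le a b centralizer_modD subgroup.m_inv_closed[OF T] by blast
    then show ?thesis using a b AB by (simp add: m_assoc inv_mult_group subset_iff)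
  qed
  then show "b \<in> centralizer_mod T A" using b AB by (auto simp: centralizer_mod_def)
qed

lemma normal_subset_centralizer_mod:
  assumes T: "T \<lhd> G" and S: "S \<subseteq> carrier G" shows "T \<subseteq> centralizer_mod T S"
proof (rule centralizer_mod_sym[OF normal_imp_subgroup[OF T] S normal_subset[OF T]], rule subsetI)
  fix s assume s: "s \<in> S"
  have "s \<otimes> t \<otimes> inv s \<otimes> inv t \<in> T" if "t \<in> T" for t
    using that s S normal_invE(2)[OF T] normal_imp_subgroup[OF T]
    by (meson subgroup.m_closed subgroup.m_inv_closed subsetD)
  then show "s \<in> centralizer_mod T T" using s S by (auto simp: centralizer_mod_def)
qed

text \<open>\<open>M\<close> normalises \<open>H\<close>, and \<open>N\<close> does too because it
  centralises \<open>H\<close> modulo \<open>T \<subseteq> H\<close>. This is how intersections with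
  complements are recognised as normal.\<close>

lemma normal_if_supplemented:
  assumes H: "subgroup H G" and G: "N <#> M = carrier G" and N: "N \<subseteq> centralizer_mod T H"
    and T: "T \<subseteq> H" and M: "M \<subseteq> carrier G" "\<And>m h. m \<in> M \<Longrightarrow> h \<in> H \<Longrightarrow> m \<otimes> h \<otimes> inv m \<in> H"
  shows "H \<lhd> G"
proof (rule normal_invI[OF H])
  fix x h assume "x \<in> carrier G" and h: "h \<in> H"
  then obtain n m where nm: "n \<in> N" "m \<in> M" "x = n \<otimes> m" using G by (metis set_multE)
  have c: "n \<in> carrier G" "m \<in> carrier G" "h \<in> carrier G"
    using nm N M H h by (auto simp: centralizer_mod_def dest: subgroup.mem_carrier)
  define h' where "h' = m \<otimes> h \<otimes> inv m"
  have h': "h' \<in> H" using M(2) nm h by (simp add: h'_def)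
  have "x \<otimes> h \<otimes> inv x = n \<otimes> h' \<otimes> inv n"
    using c by (simp add: nm h'_def m_assoc inv_mult_group)
  also have "\<dots> = (n \<otimes> h' \<otimes> inv n \<otimes> inv h') \<otimes> h'"
    using c by (intro conjugate_decompose) (simp_all add: h'_def)
  also have "\<dots> \<in> H"
    using centralizer_modD[of n T H h'] nm N T h' H by (blast intro: subgroup.m_closed)
  finally show "x \<otimes> h \<otimes> inv x \<in> H" .
qed

text \<open>As \<open>S\<close> is invariant, the elements of \<open>N\<close> centralising
  \<open>S\<close> modulo \<open>T\<close> form a normal subgroup of \<open>G\<close>. By minimality
  it is \<open>T\<close> or \<open>N\<close>, and one element \<open>u\<close> outside
  \<open>T\<close> decides.\<close>

lemma chief_centralizer_cases:
  assumes c: "chief_factor T N" and S: "S \<subseteq> carrier G"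
    and inv: "\<And>x s. x \<in> carrier G \<Longrightarrow> s \<in> S \<Longrightarrow> x \<otimes> s \<otimes> inv x \<in> S"
    and u: "u \<in> N" "u \<notin> T" "u \<in> centralizer_mod T S"
  shows "N \<subseteq> centralizer_mod T S"
proof -
  note cf = chief_factorD(1-3)[OF c]
  have "centralizer_mod T S \<inter> N \<lhd> G"
    using centralizer_mod_normal[OF cf(1) S inv] cf(2) by (rule normal_subgroup_intersect)
  then have "centralizer_mod T S \<inter> N = T \<or> centralizer_mod T S \<inter> N = N"
    using cf(3) normal_subset_centralizer_mod[OF cf(1) S] by (intro chief_factorD(4)[OF c]) auto
  then show ?thesis using u by blast
qed

lemma last_term_outside:
  assumes "\<not> A (0::nat) \<inter> N \<subseteq> T" "A n \<inter> N \<subseteq> T"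
  obtains m where "\<not> A m \<inter> N \<subseteq> T" "A (Suc m) \<inter> N \<subseteq> T"
  using assms by (induct n) blast+

lemma normal_commutator_mem:
  assumes N: "N \<lhd> G" and n: "n \<in> N" and x: "x \<in> carrier G"
  shows "n \<otimes> x \<otimes> inv n \<otimes> inv x \<in> N" "x \<otimes> n \<otimes> inv x \<otimes> inv n \<in> N"
proof -
  have sub: "subgroup N G" using N normal_imp_subgroup by blast
  have nc: "n \<in> carrier G" using N n normal_subset by blast
  have "n \<otimes> (x \<otimes> inv n \<otimes> inv x) \<in> N"
    using normal_invE(2)[OF N x] n sub by (blast intro: subgroup.m_closed subgroup.m_inv_closed)
  then show "n \<otimes> x \<otimes> inv n \<otimes> inv x \<in> N" using nc x by (simp add: m_assoc)
  show "x \<otimes> n \<otimes> inv x \<otimes> inv n \<in> N"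
    using normal_invE(2)[OF N x] n sub by (blast intro: subgroup.m_closed subgroup.m_inv_closed)
qed

lemma commutator_in_derived:
  assumes "x \<in> H" "y \<in> H" shows "x \<otimes> y \<otimes> inv x \<otimes> inv y \<in> derived G H"
  unfolding derived_def using assms by (intro generate.incl) blast

lemma exp_of_derived_normal: "(derived G ^^ n) (carrier G) \<lhd> G"
proof (induct n)
  case 0 then show ?case by (simp add: normal_self)
next
  case (Suc n)
  then show ?case by (simp add: derived_is_normal)
qed

text \<open>The last derived term that meets \<open>N\<close> outside \<open>T\<close> gives a
  normal \<open>A\<close>, abelian modulo \<open>T\<close>. Minimality of \<open>N/T\<close> is used
  twice: to pass from \<open>A\<close> centralising \<open>A\<close> to \<open>N\<close>
  centralising \<open>A\<close>, and, with roles exchanged, from \<open>A\<close> centralising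
  \<open>N\<close> to \<open>N\<close> centralising \<open>N\<close>.\<close>

lemma solvable_chief_factor_abelian:
  assumes sol: "solvable G" and c: "chief_factor T N"
  shows "N \<subseteq> centralizer_mod T N"
proof -
  note cf = chief_factorD(1-3)[OF c]
  let ?D = "\<lambda>n. (derived G ^^ n) (carrier G)"
  obtain n where "?D n = {\<one>}" using sol solvable_iff_trivial_derived_seq by blast
  then have n: "?D n \<inter> N \<subseteq> T"
    using normal_imp_subgroup[OF cf(1)] by (auto simp: subgroup.one_closed)
  have "\<not> ?D 0 \<inter> N \<subseteq> T" using cf(3) normal_subset[OF cf(2)] by auto
  then obtain m where m: "\<not> ?D m \<inter> N \<subseteq> T" "?D (Suc m) \<inter> N \<subseteq> T"
    using n by (rule last_term_outside[of ?D])
  define A where "A = ?D m \<inter> N"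
  have A: "A \<lhd> G" unfolding A_def using exp_of_derived_normal cf(2) by (rule normal_subgroup_intersect)
  obtain u where u: "u \<in> A" "u \<notin> T" using m(1) by (auto simp: A_def)
  have AN: "A \<subseteq> N" by (simp add: A_def)
  have "x \<otimes> y \<otimes> inv x \<otimes> inv y \<in> T" if xy: "x \<in> A" "y \<in> A" for x y
  proof -
    have "x \<otimes> y \<otimes> inv x \<otimes> inv y \<in> ?D (Suc m)"
      using commutator_in_derived[of x "?D m" y] xy by (simp add: A_def)
    moreover have "x \<otimes> y \<otimes> inv x \<otimes> inv y \<in> N"
      using normal_commutator_mem(1)[OF cf(2)] xy AN normal_subset[OF A] by blast
    ultimately show ?thesis using m(2) by blast
  qed
  then have "A \<subseteq> centralizer_mod T A"
    using normal_subset[OF A] by (auto simp: centralizer_mod_def)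
  then have "N \<subseteq> centralizer_mod T A"
    using u AN normal_subset[OF A] normal_invE(2)[OF A] by (intro chief_centralizer_cases[OF c, of A u]) auto
  then have "A \<subseteq> centralizer_mod T N"
    using cf A by (intro centralizer_mod_sym[of T N A]) (auto simp: normal_imp_subgroup dest: normal_subset)
  then show ?thesis
    using u AN normal_subset[OF cf(2)] normal_invE(2)[OF cf(2)] by (intro chief_centralizer_cases[OF c, of N u]) auto
qed

text \<open>An element of \<open>N\<close> outside \<open>T\<close> in the last possible lower
  central term of \<open>G'\<close> commutes with \<open>G'\<close> modulo \<open>T\<close>, since
  its commutators lie in \<open>N\<close> and in the next term. Minimality spreads this to
  \<open>N\<close>.\<close>

lemma nilpotent_derived_centralizes_chief_factor:
  assumes nil: "nilpotent (G\<lparr>carrier := derived G (carrier G)\<rparr>)" and c: "chief_factor T N"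
  shows "N \<subseteq> centralizer_mod T (derived G (carrier G))"
proof -
  note cf = chief_factorD(1-3)[OF c]
  let ?D = "derived G (carrier G)"
  have D: "?D \<lhd> G" using exp_of_derived_normal[of 1] by simp
  have DG: "subgroup ?D G" and DS: "?D \<subseteq> carrier G" using D normal_imp_subgroup normal_subset by blast+
  define L where "L = lower_central (G\<lparr>carrier := ?D\<rparr>)"
  interpret D: group "G\<lparr>carrier := ?D\<rparr>" using subgroup.subgroup_is_group[OF DG is_group] .
  have L0: "L 0 = ?D" by (simp add: L_def)
  have LS: "L n \<subseteq> ?D" for n
  proof (induct n)
    case (Suc n)
    have "(\<Union>x\<in>L n. \<Union>y\<in>?D. {x \<otimes> y \<otimes> inv\<^bsub>G\<lparr>carrier := ?D\<rparr>\<^esub> x \<otimes> inv\<^bsub>G\<lparr>carrier := ?D\<rparr>\<^esub> y}) \<subseteq> ?D"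
      using Suc D.inv_closed D.m_closed by auto
    then show ?case using D.generate_incl by (simp add: L_def)
  qed (simp add: L0)
  have Lcomm: "x \<otimes> y \<otimes> inv x \<otimes> inv y \<in> L (Suc n)" if "x \<in> L n" "y \<in> ?D" for x y n
  proof -
    have "x \<otimes> y \<otimes> inv\<^bsub>G\<lparr>carrier := ?D\<rparr>\<^esub> x \<otimes> inv\<^bsub>G\<lparr>carrier := ?D\<rparr>\<^esub> y \<in> L (Suc n)"
      using that unfolding L_def by (simp, intro generate.incl) auto
    then show ?thesis using that LS m_inv_consistent[OF DG] by (simp add: subset_iff)
  qed
  obtain u where u: "u \<in> N" "u \<notin> T" "u \<in> centralizer_mod T ?D"
  proof (cases "L 0 \<inter> N \<subseteq> T")
    \<comment> \<open>The descent needs an initial term that meets \<open>N\<close> outside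
      \<open>T\<close>. If there is none, \<open>[N, G']\<close> already lies in
      \<open>G' \<inter> N \<subseteq> T\<close>, and any \<open>u\<close> will do.\<close>
    case True
    obtain u where u: "u \<in> N" "u \<notin> T" using cf(3) by blast
    have uc: "u \<in> carrier G" using u normal_subset[OF cf(2)] by blast
    have "u \<otimes> y \<otimes> inv u \<otimes> inv y \<in> T" if y: "y \<in> ?D" for y
      using normal_commutator_mem(1)[OF cf(2) u(1)] normal_commutator_mem(2)[OF D y uc] y DS True L0 by blast
    then show thesis using that u uc by (auto simp: centralizer_mod_def)
  next
    case False
    obtain n where "L n = {\<one>}" using nil by (auto simp: nilpotent_def L_def)
    then have "L n \<inter> N \<subseteq> T" using normal_imp_subgroup[OF cf(1)] by (auto simp: subgroup.one_closed)
    with False obtain m where m: "\<not> L m \<inter> N \<subseteq> T" "L (Suc m) \<inter> N \<subseteq> T"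
      by (rule last_term_outside)
    then obtain u where u: "u \<in> L m" "u \<in> N" "u \<notin> T" by blast
    have "u \<otimes> y \<otimes> inv u \<otimes> inv y \<in> T" if y: "y \<in> ?D" for y
      using Lcomm[OF u(1) y] normal_commutator_mem(1)[OF cf(2) u(2)] y DS m(2) by blast
    then show thesis using that u normal_subset[OF cf(2)] by (auto simp: centralizer_mod_def)
  qed
  then show ?thesis
    using chief_centralizer_cases[OF c DS normal_invE(2)[OF D]] by blast
qed

text \<open>\<open>M \<inter> N\<close> is normalised by \<open>M\<close> and, as \<open>N/T\<close>
  is abelian, by \<open>N\<close>; so it is normal in \<open>G = N M\<close>, and minimality leaves
  only \<open>T\<close>. Maximal subgroups over \<open>T\<close> that miss \<open>N\<close> are
  therefore complements of \<open>N/T\<close>.\<close>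

lemma chief_inter_maximal:
  assumes c: "chief_factor T N" and ab: "N \<subseteq> centralizer_mod T N"
    and M: "maximal_subgroup G M" "T \<subseteq> M" "\<not> N \<subseteq> M"
  shows "M \<inter> N = T"
proof -
  note cf = chief_factorD(1-3)[OF c]
  have MG: "subgroup M G" using M maximal_subgroupD by blast
  have "M \<inter> N \<lhd> G"
  proof (rule normal_if_supplemented)
    show "subgroup (M \<inter> N) G" using MG normal_imp_subgroup[OF cf(2)] by (rule subgroups_Inter_pair)
    show "N <#> M = carrier G" using maximal_mult_normal M cf by blast
    show "N \<subseteq> centralizer_mod T (M \<inter> N)" using ab by (auto simp: centralizer_mod_def)
    show "T \<subseteq> M \<inter> N" using M cf by blast
    show "M \<subseteq> carrier G" using MG subgroup.subset by blast
    show "m \<otimes> h \<otimes> inv m \<in> M \<inter> N" if "m \<in> M" "h \<in> M \<inter> N" for m h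
      using that MG normal_invE(2)[OF cf(2)]
      by (auto intro: subgroup.m_closed subgroup.m_inv_closed dest: subgroup.mem_carrier)
  qed
  then show ?thesis using chief_factorD(4)[OF c, of "M \<inter> N"] M cf(3) by blast
qed

section \<open>Diamonds of chief factors and a weighted Jordan-Hoelder theorem\<close>

lemma normal_mult_commute: "N \<lhd> G \<Longrightarrow> K \<lhd> G \<Longrightarrow> N <#> K = K <#> N"
  using commut_normal normal_imp_subgroup by blast

text \<open>Lattice form of \<open>KN/K \<cong> N/T\<close>: by Dedekind, a normal subgroup between
  \<open>K\<close> and \<open>K <#> N\<close> is determined by its intersection with
  \<open>N\<close>.\<close>

lemma chief_factor_transfer:
  assumes c: "chief_factor T N" and K: "K \<lhd> G" "T \<subseteq> K" "K \<inter> N = T"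
  shows "chief_factor K (K <#> N)"
proof -
  note cf = chief_factorD(1-3)[OF c]
  note sub = normal_imp_subgroup[OF K(1)] normal_imp_subgroup[OF cf(2)]
  have le: "K \<subseteq> K <#> N" "N \<subseteq> K <#> N" using subset_set_mult[OF sub] by auto
  show ?thesis
    unfolding chief_factor_def
  proof (intro conjI allI impI)
    show "K <#> N \<lhd> G" using normal_set_mult K cf by blast
    show "K \<subset> K <#> N" using le K cf(3) by blast
    fix H assume H: "H \<lhd> G \<and> K \<subseteq> H \<and> H \<subseteq> K <#> N"
    have eq: "H = K <#> (N \<inter> H)"
      using dedekind[OF sub normal_imp_subgroup, of H] H by blast
    have "N \<inter> H \<lhd> G" using H cf normal_subgroup_intersect by blast
    then have "N \<inter> H = T \<or> N \<inter> H = N" using cf(3) K H by (intro chief_factorD(4)[OF c]) auto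
    then show "H = K \<or> H = K <#> N"
    proof
      assume "N \<inter> H = T"
      then have "H = K <#> T" using eq by simp
      also have "\<dots> = T <#> K" using normal_mult_commute K cf by blast
      also have "\<dots> = K" using set_mult_absorb[OF normal_imp_subgroup[OF cf(1)] sub(1) K(2)] .
      finally show ?thesis by simp
    qed (use eq in simp)
  qed (use K in simp)
qed

lemma chief_diamond:
  assumes c: "chief_factor T N" and c': "chief_factor T N'" and ne: "N \<noteq> N'"
  shows "N \<inter> N' = T" "chief_factor N (N <#> N')"
proof -
  note cf = chief_factorD(1-3)[OF c] and cf' = chief_factorD(1-3)[OF c']
  have n: "N \<inter> N' \<lhd> G" using cf cf' normal_subgroup_intersect by blast
  have "N \<inter> N' = T \<or> N \<inter> N' = N" "N \<inter> N' = T \<or> N \<inter> N' = N'"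
    using chief_factorD(4)[OF c n] chief_factorD(4)[OF c' n] cf(3) cf'(3) by (simp_all add: psubset_eq)
  then show "N \<inter> N' = T" using ne by blast
  then show "chief_factor N (N <#> N')" using chief_factor_transfer[OF c', of N] cf by blast
qed

text \<open>\<open>d\<close> is the total weight of some chief series from \<open>T\<close> up to
  \<open>G\<close>. It is a relation because the series is a matter of choice.\<close>

inductive chief_weight :: "('a set \<Rightarrow> 'a set \<Rightarrow> nat) \<Rightarrow> 'a set \<Rightarrow> nat \<Rightarrow> bool" for w where
  top: "chief_weight w (carrier G) 0"
| step: "chief_factor T N \<Longrightarrow> chief_weight w N d \<Longrightarrow> chief_weight w T (w T N + d)"

text \<open>The local condition that makes the total weight independent of the series. Keeping
  \<open>w\<close> abstract gives one Jordan-Hoelder proof for chief length and for the number of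
  non-Frattini factors.\<close>

definition diamond_weight :: "('a set \<Rightarrow> 'a set \<Rightarrow> nat) \<Rightarrow> bool" where
  "diamond_weight w \<longleftrightarrow> (\<forall>T N N'. chief_factor T N \<longrightarrow> chief_factor T N' \<longrightarrow> N \<noteq> N' \<longrightarrow>
     w T N + w N (N <#> N') = w T N' + w N' (N <#> N'))"

definition chief_length :: "('a set \<Rightarrow> 'a set \<Rightarrow> nat) \<Rightarrow> 'a set \<Rightarrow> nat" where
  "chief_length w T = (THE d. chief_weight w T d)"

end

context finite_group
begin

lemma card_normal_less:
  assumes "K \<lhd> G" "T \<subset> K" shows "card (carrier G) - card K < card (carrier G) - card T"
proof -
  have "card T < card K" using assms finite_normal psubset_card_mono by blast
  moreover have "card K \<le> card (carrier G)"
    using normal_subset[OF assms(1)] finite_carrier card_mono by blast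
  ultimately show ?thesis by linarith
qed

lemma chief_weight_exists: "T \<lhd> G \<Longrightarrow> \<exists>d. chief_weight w T d"
proof (induct "card (carrier G) - card T" arbitrary: T rule: less_induct)
  case less
  show ?case
  proof (cases "T = carrier G")
    case False
    then have "T \<subset> carrier G" using normal_subset less by blast
    then obtain N where N: "chief_factor T N"
      using chief_factor_above[OF less(2) normal_self] by blast
    then obtain d where "chief_weight w N d"
      using less(1)[of N] card_normal_less[OF chief_factorD(2,3)[OF N]] chief_factorD(2)[OF N] by blast
    then show ?thesis using chief_weight.step[OF N] by blast
  qed (use chief_weight.top in blast)
qed

text \<open>Two series that start with different \<open>N\<close> and \<open>N'\<close> are both
  compared, by induction, with a series through \<open>N <#> N'\<close>.\<close>

lemma chief_weight_unique:
  assumes w: "diamond_weight w"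
  shows "chief_weight w T d \<Longrightarrow> chief_weight w T d' \<Longrightarrow> d = d'"
proof (induct "card (carrier G) - card T" arbitrary: T d d' rule: less_induct)
  case less
  show ?case using less(2)
  proof (cases rule: chief_weight.cases)
    case top
    show ?thesis using less(3)
    proof (cases rule: chief_weight.cases)
      case (step N e)
      then show ?thesis using top chief_factorD(3)[of T N] normal_subset[OF chief_factorD(2)[of T N]] by blast
    qed (use top in simp)
  next
    case s: (step N e)
    note cf = chief_factorD(1-3)[OF s(2)]
    show ?thesis using less(3)
    proof (cases rule: chief_weight.cases)
      case top
      then show ?thesis using cf normal_subset by blast
    next
      case s': (step N' e')
      note cf' = chief_factorD(1-3)[OF s'(2)]
      show ?thesis
      proof (cases "N = N'")
        case True
        then show ?thesis
          using less(1)[of N e e'] s s' card_normal_less cf by auto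
      next
        case False
        let ?K = "N <#> N'"
        have K': "?K = N' <#> N" using normal_mult_commute cf cf' by blast
        have c: "chief_factor N ?K" "chief_factor N' ?K"
          using chief_diamond(2)[OF s(2) s'(2) False] chief_diamond(2)[OF s'(2) s(2)] False K' by auto
        obtain f where f: "chief_weight w ?K f"
          using chief_weight_exists chief_factorD(2)[OF c(1)] by blast
        have "e = w N ?K + f"
          using less(1)[of N e "w N ?K + f"] s(3) chief_weight.step[OF c(1) f] card_normal_less cf by blast
        moreover have "e' = w N' ?K + f"
          using less(1)[of N' e' "w N' ?K + f"] s'(3) chief_weight.step[OF c(2) f] card_normal_less cf' by blast
        moreover have "w T N + w N ?K = w T N' + w N' ?K"
          using w s(2) s'(2) False unfolding diamond_weight_def by blast
        ultimately show ?thesis using s(1) s'(1) by simp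
      qed
    qed
  qed
qed

lemma chief_length_eq:
  "diamond_weight w \<Longrightarrow> chief_weight w T d \<Longrightarrow> chief_length w T = d"
  unfolding chief_length_def using chief_weight_unique by blast

lemma chief_length_step:
  assumes "diamond_weight w" "chief_factor T N"
  shows "chief_length w T = w T N + chief_length w N"
proof -
  obtain d where "chief_weight w N d" using chief_weight_exists chief_factorD(2) assms by blast
  then show ?thesis using chief_length_eq[OF assms(1)] chief_weight.step[OF assms(2)] by metis
qed

definition unit_weight :: "'a set \<Rightarrow> 'a set \<Rightarrow> nat" where
  "unit_weight T N = 1"

definition non_frattini_weight :: "'a set \<Rightarrow> 'a set \<Rightarrow> nat" where
  "non_frattini_weight T N = (if N \<subseteq> frattini_over T then 0 else 1)"

lemma diamond_unit_weight: "diamond_weight unit_weight"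
  by (simp add: diamond_weight_def unit_weight_def)

text \<open>Take \<open>M\<close> maximal over \<open>N\<close> but not over \<open>N'\<close>, and
  \<open>L\<close> a maximal complement of \<open>N\<close>. Dedekind gives
  \<open>M = N (L \<inter> M)\<close>, and \<open>S = N' (L \<inter> M)\<close> is \<open>M\<close>
  with \<open>N\<close> traded for \<open>N'\<close>. If \<open>S\<close> were \<open>G\<close>,
  then \<open>M = (L \<inter> M) (N' \<inter> M) \<subseteq> L\<close>, which is impossible. A
  maximal subgroup above \<open>S\<close> that contained \<open>N\<close> would contain
  \<open>M\<close> and \<open>N'\<close>.\<close>

lemma diamond_non_frattini_half:
  assumes sol: "solvable G" and c: "chief_factor T N" and c': "chief_factor T N'" and ne: "N \<noteq> N'"
    and nf: "\<not> N \<subseteq> frattini_over T" "\<not> N' \<subseteq> frattini_over T" "\<not> N <#> N' \<subseteq> frattini_over N"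
  shows "\<not> N <#> N' \<subseteq> frattini_over N'"
proof -
  note cf = chief_factorD(1-3)[OF c] and cf' = chief_factorD(1-3)[OF c']
  note sub = normal_imp_subgroup[OF cf(2)] normal_imp_subgroup[OF cf'(2)]
  have le: "N \<subseteq> N <#> N'" "N' \<subseteq> N <#> N'" using subset_set_mult[OF sub] by auto
  have KG: "N <#> N' \<subseteq> carrier G" using normal_subset[OF normal_set_mult] cf cf' by blast
  obtain M where M: "maximal_subgroup G M" "N \<subseteq> M" "\<not> N <#> N' \<subseteq> M"
    using supplement_exists[OF nf(3) KG] by blast
  obtain L where L: "maximal_subgroup G L" "T \<subseteq> L" "\<not> N \<subseteq> L"
    using supplement_exists[OF nf(1) normal_subset[OF cf(2)]] by blast
  have MG: "subgroup M G" and LG: "subgroup L G" using M L maximal_subgroupD by blast+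
  have N'M: "\<not> N' \<subseteq> M" using M set_mult_least[OF MG M(2)] by blast
  have TM: "T \<subseteq> M" using M(2) cf by blast
  have MLG: "subgroup (L \<inter> M) G" using LG MG by (rule subgroups_Inter_pair)
  define S where "S = N' <#> (L \<inter> M)"
  have SG: "subgroup S G" using mult_norm_subgroup[OF cf'(2) MLG] by (simp add: S_def)
  have M_eq: "M = N <#> (L \<inter> M)"
    using dedekind[OF sub(1) LG MG M(2)] maximal_mult_normal[OF L(1) cf(2) L(3)] subgroup.subset[OF MG] by auto
  have "S \<noteq> carrier G"
  proof
    assume S: "S = carrier G"
    have "M = (L \<inter> M) <#> (N' \<inter> M)"
      using dedekind[OF MLG sub(2) MG] S commut_normal[OF MLG cf'(2)] subgroup.subset[OF MG] by (auto simp: S_def)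
    also have "N' \<inter> M = T"
      using chief_inter_maximal[OF c' solvable_chief_factor_abelian[OF sol c'] M(1) TM N'M] by blast
    also have "(L \<inter> M) <#> T \<subseteq> L" using L(2) set_mult_least[OF LG] by blast
    finally have "M = L" using maximal_subgroupD[OF M(1)] maximal_subgroupD[OF L(1)] by blast
    then show False using M L by blast
  qed
  then obtain R where R: "maximal_subgroup G R" "S \<subseteq> R" using maximal_subgroup_above[OF SG] by blast
  have RG: "subgroup R G" using R maximal_subgroupD by blast
  have N'R: "N' \<subseteq> R" and MLR: "L \<inter> M \<subseteq> R"
    using R(2) subset_set_mult[OF sub(2) MLG] by (auto simp: S_def)
  have "\<not> N \<subseteq> R"
  proof
    assume "N \<subseteq> R"
    then have "M \<subseteq> R" using M_eq MLR set_mult_least[OF RG, of N "L \<inter> M"] by auto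
    then show False using maximal_subgroupD(2,3)[OF M(1)] maximal_subgroupD(2)[OF R(1)] RG N'R N'M by blast
  qed
  then show ?thesis using frattini_over_subset[OF R(1) N'R] le by blast
qed

text \<open>If one lower factor is Frattini, \<open>low\<close> and \<open>high\<close> match the
  opposite sides of the diamond. If neither is, both lower weights are 1 and the preceding lemma,
  used in both directions, equates the upper ones.\<close>

lemma diamond_non_frattini_weight:
  assumes sol: "solvable G"
  shows "diamond_weight non_frattini_weight"
  unfolding diamond_weight_def
proof (intro allI impI)
  fix T N N' assume c: "chief_factor T N" and c': "chief_factor T N'" and ne: "N \<noteq> N'"
  note cf = chief_factorD(1-3)[OF c] and cf' = chief_factorD(1-3)[OF c']
  let ?K = "N <#> N'"
  have K': "?K = N' <#> N" using normal_mult_commute[OF cf(2) cf'(2)] .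
  have low: "N <#> N' \<subseteq> frattini_over N'"
    if cf: "chief_factor T N" "chief_factor T N'" "N \<subseteq> frattini_over T" for N N'
  proof (rule set_mult_least)
    show "subgroup (frattini_over N') G"
      using frattini_over_normal chief_factorD(2)[OF cf(2)] normal_imp_subgroup by blast
    show "N \<subseteq> frattini_over N'"
      using cf(3) frattini_over_mono[of T N'] chief_factorD(3)[OF cf(2)] by blast
    show "N' \<subseteq> frattini_over N'"
      using subset_frattini_over normal_subset chief_factorD(2)[OF cf(2)] by blast
  qed
  have high: "\<not> N <#> N' \<subseteq> frattini_over N"
    if cf: "chief_factor T N" "chief_factor T N'" "N \<subseteq> frattini_over T" "\<not> N' \<subseteq> frattini_over T" for N N'
  proof -
    have "N' \<subseteq> N <#> N'"
      using subset_set_mult(2) normal_imp_subgroup chief_factorD(2)[OF cf(1)] chief_factorD(2)[OF cf(2)] by blast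
    then show ?thesis
      using cf(4) frattini_over_eq[OF _ cf(3)] chief_factorD(3)[OF cf(1)] by auto
  qed
  show "non_frattini_weight T N + non_frattini_weight N ?K = non_frattini_weight T N' + non_frattini_weight N' ?K"
  proof (cases "N \<subseteq> frattini_over T")
    case True
    then show ?thesis
      using low[OF c c'] low[OF c' c] high[OF c c'] K' by (auto simp: non_frattini_weight_def)
  next
    case nN: False
    show ?thesis
    proof (cases "N' \<subseteq> frattini_over T")
      case True
      then show ?thesis
        using nN low[OF c' c] high[OF c' c] K' by (auto simp: non_frattini_weight_def)
    next
      case False
      then show ?thesis
        using nN diamond_non_frattini_half[OF sol c c' ne] diamond_non_frattini_half[OF sol c' c] ne K'
        by (auto simp: non_frattini_weight_def)
    qed
  qed
qed

end

section \<open>Cutting Frattini quotients by conjugate complements\<close>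

context group
begin

lemma rcoset_hom: "T \<lhd> G \<Longrightarrow> group_hom G (G Mod T) (\<lambda>x. T #> x)"
  using normal.factorgroup_is_group normal.r_coset_hom_Mod is_group
  by (auto simp: group_hom_def group_hom_axioms_def)

lemma rcoset_eq_iff:
  assumes "T \<lhd> G" "x \<in> carrier G" "y \<in> carrier G"
  shows "T #> x = T #> y \<longleftrightarrow> x \<otimes> inv y \<in> T"
proof -
  have T: "subgroup T G" using assms normal_imp_subgroup by blast
  have "T #> x = T #> y \<longleftrightarrow> x \<in> T #> y"
    using repr_independence[OF _ assms(3) T] rcos_self[OF assms(2) T] by auto
  then show ?thesis using subgroup.rcos_module[OF T is_group assms(3,2)] by simp
qed

lemma rcoset_one_iff:
  assumes "T \<lhd> G" "x \<in> carrier G"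
  shows "T #> x = T \<longleftrightarrow> x \<in> T"
  using rcoset_eq_iff[OF assms one_closed] assms normal_subset by simp

lemma rcoset_commute_iff:
  assumes T: "T \<lhd> G" and x: "x \<in> carrier G" and y: "y \<in> carrier G"
  shows "(T #> x) \<otimes>\<^bsub>G Mod T\<^esub> (T #> y) = (T #> y) \<otimes>\<^bsub>G Mod T\<^esub> (T #> x) \<longleftrightarrow> x \<otimes> y \<otimes> inv x \<otimes> inv y \<in> T"
proof -
  interpret h: group_hom G "G Mod T" "\<lambda>x. T #> x" using rcoset_hom[OF T] .
  show ?thesis
    using rcoset_eq_iff[OF T, of "x \<otimes> y" "y \<otimes> x"] x y h.hom_mult[of x y] h.hom_mult[of y x]
    by (simp add: inv_mult_group m_assoc del: mult_FactGroup h.hom_mult)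
qed

lemma rcoset_pow_iff:
  assumes T: "T \<lhd> G" and x: "x \<in> carrier G"
  shows "(T #> x) [^]\<^bsub>G Mod T\<^esub> (n::nat) = \<one>\<^bsub>G Mod T\<^esub> \<longleftrightarrow> x [^] n \<in> T"
  using rcoset_one_iff[OF T, of "x [^] n"] x normal.FactGroup_pow[OF T x] by simp

lemma power_mod_subgroup:
  assumes T: "T \<lhd> G" and N: "subgroup N G" and ab: "N \<subseteq> centralizer_mod T N"
  shows "subgroup {x \<in> N. x [^] (n::nat) \<in> T} G"
proof (rule subgroupI)
  have TG: "subgroup T G" using T normal_imp_subgroup by blast
  interpret h: group_hom G "G Mod T" "\<lambda>x. T #> x" using rcoset_hom[OF T] .
  have NG: "x \<in> carrier G" if "x \<in> N" for x using N that by (rule subgroup.mem_carrier)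
  show "{x \<in> N. x [^] n \<in> T} \<subseteq> carrier G" using NG by blast
  show "{x \<in> N. x [^] n \<in> T} \<noteq> {}"
    using subgroup.one_closed[OF N] subgroup.one_closed[OF TG] by (auto intro!: exI[of _ \<one>])
  fix a assume a: "a \<in> {x \<in> N. x [^] n \<in> T}"
  then show "inv a \<in> {x \<in> N. x [^] n \<in> T}"
    using NG N TG by (auto simp: nat_pow_inv intro: subgroup.m_inv_closed)
  fix b assume b: "b \<in> {x \<in> N. x [^] n \<in> T}"
  have c: "a \<in> carrier G" "b \<in> carrier G" using a b NG by auto
  have "(T #> a) \<otimes>\<^bsub>G Mod T\<^esub> (T #> b) = (T #> b) \<otimes>\<^bsub>G Mod T\<^esub> (T #> a)"
    using rcoset_commute_iff[OF T c] ab a b centralizer_modD by blast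
  then have "((T #> a) \<otimes>\<^bsub>G Mod T\<^esub> (T #> b)) [^]\<^bsub>G Mod T\<^esub> n = (T #> a) [^]\<^bsub>G Mod T\<^esub> n \<otimes>\<^bsub>G Mod T\<^esub> (T #> b) [^]\<^bsub>G Mod T\<^esub> n"
    by (rule h.H.pow_mult_distrib[OF _ h.hom_closed[OF c(1)] h.hom_closed[OF c(2)]])
  also have "\<dots> = \<one>\<^bsub>G Mod T\<^esub>"
  proof -
    have "(T #> a) [^]\<^bsub>G Mod T\<^esub> n = \<one>\<^bsub>G Mod T\<^esub>" "(T #> b) [^]\<^bsub>G Mod T\<^esub> n = \<one>\<^bsub>G Mod T\<^esub>"
      using a b rcoset_pow_iff[OF T c(1)] rcoset_pow_iff[OF T c(2)] by blast+
    then show ?thesis using h.H.l_one[OF h.H.one_closed] by metis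
  qed
  finally have "(a \<otimes> b) [^] n \<in> T"
    using rcoset_pow_iff[OF T, of "a \<otimes> b" n] c h.hom_mult[OF c] by simp
  then show "a \<otimes> b \<in> {x \<in> N. x [^] n \<in> T}"
    using a b N by (auto intro: subgroup.m_closed)
qed

text \<open>Primes are stripped off \<open>n\<close> until the power of \<open>x\<close> leaves
  \<open>T\<close>. As \<open>T\<close> need not be normal, this replaces the order of a
  coset.\<close>

lemma prime_power_outside:
  assumes T: "subgroup T G" and x: "x \<in> carrier G" "x \<notin> T"
  shows "0 < n \<Longrightarrow> x [^] (n::nat) \<in> T \<Longrightarrow>
    \<exists>p k. Factorial_Ring.prime (p::nat) \<and> p dvd n \<and> x [^] (k::nat) \<notin> T \<and> (x [^] k) [^] p \<in> T"
proof (induct n rule: less_induct)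
  case (less n)
  have "n \<noteq> 1" using less(3) x by auto
  then obtain p where p: "Factorial_Ring.prime p" "p dvd n" using prime_factor_nat by blast
  then obtain m where m: "n = p * m" by (auto simp: dvd_def)
  show ?case
  proof (cases "x [^] m \<in> T")
    case True
    have "0 < m" "m < n" using m less(2) prime_gt_1_nat[OF p(1)] by auto
    then show ?thesis using less(1)[of m] True m by (auto intro: dvd_mult)
  next
    case False
    moreover have "(x [^] m) [^] p \<in> T" using less(3) m x by (simp add: nat_pow_pow mult.commute)
    ultimately show ?thesis using p by blast
  qed
qed

lemma coprime_powers_mem:
  assumes T: "subgroup T G" and x: "x \<in> carrier G" and "coprime (m::nat) n" "x [^] m \<in> T" "x [^] n \<in> T"
  shows "x \<in> T"
proof -
  obtain u v where uv: "u * int m + v * int n = 1"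
    using assms(3) bezout_int[of "int m" "int n"] by auto
  have "x [^] (u * int m + v * int n) = (x [^] m) [^] u \<otimes> (x [^] n) [^] v"
    using x by (simp add: int_pow_mult int_pow_pow int_pow_int[symmetric] mult.commute)
  also have "\<dots> \<in> T"
    using assms(4,5) T by (intro subgroup.m_closed subgroup_int_pow_closed)
  finally show ?thesis using uv x by simp
qed

end

locale finite_solvable_group = finite_group +
  assumes solvable_G: "solvable G"
begin

section \<open>The two lengths in a finite soluble group\<close>

abbreviation "clen \<equiv> chief_length unit_weight"
abbreviation "dlen \<equiv> chief_length non_frattini_weight"

lemmas chief_abelian = solvable_chief_factor_abelian[OF solvable_G]

lemma unit_length_step: "chief_factor T N \<Longrightarrow> clen T = Suc (clen N)"
  using chief_length_step[OF diamond_unit_weight] by (simp add: unit_weight_def)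

lemma non_frattini_length_step:
  "chief_factor T N \<Longrightarrow> dlen T = (if N \<subseteq> frattini_over T then dlen N else Suc (dlen N))"
  using chief_length_step[OF diamond_non_frattini_weight[OF solvable_G]] by (simp add: non_frattini_weight_def)

lemma unit_length_less:
  assumes "T \<lhd> G" "K \<lhd> G" "T \<subset> K" shows "clen K < clen T"
  using assms
proof (induct "card (carrier G) - card T" arbitrary: T rule: less_induct)
  case less
  obtain N where N: "chief_factor T N" "N \<subseteq> K" using chief_factor_above less(2-4) by blast
  show ?case
  proof (cases "N = K")
    case False
    then have "clen K < clen N"
      using less(1)[of N] card_normal_less[OF chief_factorD(2,3)[OF N(1)]] chief_factorD(2)[OF N(1)] less(3) N(2) by blast
    then show ?thesis using unit_length_step[OF N(1)] by simp
  qed (use unit_length_step[OF N(1)] in simp)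
qed

lemma unit_length_mono:
  assumes "T \<lhd> G" "K \<lhd> G" "T \<subseteq> K" shows "clen K \<le> clen T"
  using unit_length_less[OF assms(1,2)] assms(3) by (cases "T = K") (auto simp: psubset_eq)

text \<open>\<open>frattini_over\<close> keeps its value on the way from \<open>T\<close> up to
  \<open>K\<close>, so each factor met there is Frattini.\<close>

lemma non_frattini_length_eq:
  assumes "T \<lhd> G" "K \<lhd> G" "T \<subseteq> K" "K \<subseteq> frattini_over T" shows "dlen T = dlen K"
  using assms
proof (induct "card (carrier G) - card T" arbitrary: T rule: less_induct)
  case less
  show ?case
  proof (cases "T = K")
    case False
    obtain N where N: "chief_factor T N" "N \<subseteq> K"
      using chief_factor_above[OF less(2,3)] less(4) False by blast
    have NF: "N \<subseteq> frattini_over T" using N(2) less(5) by blast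
    have "frattini_over N = frattini_over T"
      using frattini_over_eq[OF _ NF] chief_factorD(3)[OF N(1)] by blast
    then have "dlen N = dlen K"
      using less(1)[of N] card_normal_less[OF chief_factorD(2,3)[OF N(1)]] chief_factorD(2)[OF N(1)] less(3,5) N(2) by metis
    then show ?thesis using non_frattini_length_step[OF N(1)] NF by simp
  qed simp
qed

lemma chief_series_weight:
  assumes "chief_series G N k"
  shows "chief_weight w {\<one>} (\<Sum>i<k. w (N i) (N (Suc i)))"
proof -
  \<comment> \<open>\<open>j\<close> counts factors from the top, because
    \<open>chief_weight\<close> is built downwards from \<open>carrier G\<close>.\<close>
  have "chief_weight w (N (k - j)) (\<Sum>i\<in>{k - j..<k}. w (N i) (N (Suc i)))" if "j \<le> k" for j
    using that
  proof (induct j)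
    case 0
    then show ?case using assms chief_weight.top by (simp add: chief_series_def)
  next
    case (Suc j)
    let ?i = "k - Suc j"
    have i: "Suc ?i = k - j" "?i < k" using Suc by auto
    have "chief_factor (N ?i) (N (Suc ?i))"
      using assms i unfolding chief_series_def chief_factor_def by (metis Suc_leI less_imp_le)
    then have "chief_weight w (N ?i) (w (N ?i) (N (Suc ?i)) + (\<Sum>i\<in>{k - j..<k}. w (N i) (N (Suc i))))"
      using Suc i by (intro chief_weight.step) auto
    then show ?case using i by (simp add: sum.atLeast_Suc_lessThan)
  qed
  from this[of k] show ?thesis using assms by (simp add: chief_series_def atLeast0LessThan)
qed

text \<open>This is the faithfulness of the action on \<open>N/T\<close>. The intersection
  \<open>K\<close> is normal, being normalised by \<open>M\<close> and centralised by
  \<open>N\<close> modulo \<open>T\<close>. If a maximal \<open>L\<close> over \<open>T\<close>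
  missed \<open>K\<close>, then \<open>M = K R\<close> with \<open>R = L \<inter> M\<close>. Here
  \<open>N R = G\<close>, since a maximal subgroup above \<open>N R\<close> contains
  \<open>K\<close>, hence \<open>M\<close> and \<open>N\<close>. Dedekind then gives
  \<open>M = R (N \<inter> M) = R T \<subseteq> L\<close>, although
  \<open>K \<subseteq> M\<close>.\<close>

lemma frattini_centralizer_inter_complement:
  assumes c: "chief_factor T N" and M: "maximal_subgroup G M" "T \<subseteq> M" "\<not> N \<subseteq> M"
  shows "frattini_over N \<inter> centralizer_mod T N \<inter> M \<subseteq> frattini_over T"
proof -
  note cf = chief_factorD(1-3)[OF c]
  define K where "K = frattini_over N \<inter> centralizer_mod T N \<inter> M"
  have MG: "subgroup M G" using M(1) by (rule maximal_subgroupD)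
  have NG: "subgroup N G" using cf(2) by (rule normal_imp_subgroup)
  have NM: "N <#> M = carrier G" using M(1) cf(2) M(3) by (rule maximal_mult_normal)
  have meet: "M \<inter> N = T" using chief_inter_maximal[OF c chief_abelian[OF c] M] .
  have Cn: "frattini_over N \<inter> centralizer_mod T N \<lhd> G"
    using frattini_over_normal[OF cf(2)] centralizer_mod_normal'[OF cf(1,2)] by (rule normal_subgroup_intersect)
  have KG: "subgroup K G" unfolding K_def
    using normal_imp_subgroup[OF Cn] MG by (rule subgroups_Inter_pair)
  have TK: "T \<subseteq> K"
    using subset_frattini_over[OF normal_subset[OF cf(2)]] cf(3) M(2)
      normal_subset_centralizer_mod[OF cf(1) normal_subset[OF cf(2)]] by (auto simp: K_def)
  have "K \<lhd> G"
  proof (rule normal_if_supplemented[OF KG NM])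
    show "N \<subseteq> centralizer_mod T K"
      by (rule centralizer_mod_sym)
        (use subgroup.subset[OF KG] normal_imp_subgroup[OF cf(1)] normal_subset[OF cf(2)] in \<open>auto simp: K_def\<close>)
    show "m \<otimes> h \<otimes> inv m \<in> K" if "m \<in> M" "h \<in> K" for m h
      using that normal_invE(2)[OF Cn, of m h] subgroup.mem_carrier[OF MG] MG
      by (auto simp: K_def intro: subgroup.m_closed subgroup.m_inv_closed)
  qed (use TK subgroup.subset[OF MG] in auto)
  have "K \<subseteq> L" if L: "maximal_subgroup G L" "T \<subseteq> L" for L
  proof (rule ccontr)
    assume KL: "\<not> K \<subseteq> L"
    have LG: "subgroup L G" using L(1) by (rule maximal_subgroupD)
    define R where "R = L \<inter> M"
    have RG: "subgroup R G" unfolding R_def using LG MG by (rule subgroups_Inter_pair)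
    have KM: "K \<subseteq> M" by (auto simp: K_def)
    have MKR: "M = K <#> R"
      using dedekind[OF KG LG MG KM] maximal_mult_normal[OF L(1) \<open>K \<lhd> G\<close> KL] subgroup.subset[OF MG]
      by (auto simp: R_def)
    have SG: "subgroup (N <#> R) G" using mult_norm_subgroup[OF cf(2) RG] .
    have "N <#> R = carrier G"
    proof (rule ccontr)
      assume "N <#> R \<noteq> carrier G"
      then obtain S where S: "maximal_subgroup G S" "N <#> R \<subseteq> S"
        using maximal_subgroup_above[OF SG] by blast
      have NS: "N \<subseteq> S" "R \<subseteq> S" using subset_set_mult[OF NG RG] S(2) by auto
      have "K \<subseteq> S" using frattini_over_subset[OF S(1) NS(1)] by (auto simp: K_def)
      then have "M \<subseteq> S" using MKR set_mult_least[OF maximal_subgroupD(1)[OF S(1)] _ NS(2)] by simp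
      then show False
        using maximal_subgroupD(3)[OF M(1) maximal_subgroupD(1)[OF S(1)]] maximal_subgroupD(2)[OF S(1)] NS(1) M(3) by auto
    qed
    then have "M = R <#> (N \<inter> M)"
      using dedekind[OF RG NG MG] commut_normal[OF RG cf(2)] subgroup.subset[OF MG] by (auto simp: R_def)
    then have "M \<subseteq> L"
      using set_mult_least[OF LG, of R "N \<inter> M"] meet L(2) by (auto simp: R_def)
    then show False using KL KM by blast
  qed
  then have "K \<subseteq> frattini_over T"
    using subgroup.subset[OF KG] by (auto simp: frattini_over_def)
  then show ?thesis by (simp add: K_def)
qed

lemma frattini_inter_centralizer_eq:
  assumes c: "chief_factor T N" and T: "frattini_over T = T" and M: "maximal_subgroup G M" "T \<subseteq> M" "\<not> N \<subseteq> M"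
  shows "frattini_over N \<inter> centralizer_mod T N \<subseteq> N"
proof -
  note cf = chief_factorD(1-3)[OF c]
  let ?C = "frattini_over N \<inter> centralizer_mod T N"
  have MG: "subgroup M G" using M(1) by (rule maximal_subgroupD)
  have CG: "subgroup ?C G"
    using normal_imp_subgroup[OF frattini_over_normal[OF cf(2)]] normal_imp_subgroup[OF centralizer_mod_normal'[OF cf(1,2)]]
    by (rule subgroups_Inter_pair)
  have NC: "N \<subseteq> ?C" using chief_abelian[OF c] subset_frattini_over[OF normal_subset[OF cf(2)]] by blast
  have "?C = N <#> (M \<inter> ?C)"
    using dedekind[OF normal_imp_subgroup[OF cf(2)] MG CG NC] maximal_mult_normal[OF M(1) cf(2) M(3)] subgroup.subset[OF CG] by auto
  also have "\<dots> \<subseteq> N"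
    using frattini_centralizer_inter_complement[OF c M] cf(3) T
    by (intro set_mult_least normal_imp_subgroup[OF cf(2)]) auto
  finally show ?thesis .
qed

text \<open>The elements of \<open>N\<close> with p-th power in \<open>T\<close> form a subgroup
  because \<open>N/T\<close> is abelian, and a normal one, so a single such element outside
  \<open>T\<close> suffices. The last conclusion says that \<open>p\<close> divides
  \<open>|N/T|\<close>.\<close>

lemma chief_factor_exponent:
  assumes c: "chief_factor T N"
  obtains p where "Factorial_Ring.prime (p::nat)" "\<And>x. x \<in> N \<Longrightarrow> x [^] p \<in> T"
    "p dvd card ((\<lambda>x. T #> x) ` N)"
proof -
  note cf = chief_factorD(1-3)[OF c]
  have TG: "subgroup T G" and NG: "subgroup N G" using cf(1,2) normal_imp_subgroup by auto
  interpret h: group_hom G "G Mod T" "\<lambda>x. T #> x" using rcoset_hom[OF cf(1)] .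
  obtain x where x: "x \<in> N" "x \<notin> T" using cf(3) by blast
  have xc: "x \<in> carrier G" using NG x(1) by (rule subgroup.mem_carrier)
  have "x [^] order G \<in> T" using pow_order_eq_1[OF xc] subgroup.one_closed[OF TG] by simp
  moreover have "0 < order G" using finite_carrier order_gt_0_iff_finite by blast
  ultimately obtain p k where p: "Factorial_Ring.prime (p::nat)" and k: "x [^] (k::nat) \<notin> T" "(x [^] k) [^] p \<in> T"
    using prime_power_outside[OF TG xc x(2)] by blast
  define u where "u = x [^] k"
  have u: "u \<in> N" "u \<notin> T" "u [^] p \<in> T" using k pow_subgroup[OF NG x(1)] by (auto simp: u_def)
  have uc: "u \<in> carrier G" using NG u(1) by (rule subgroup.mem_carrier)
  define E where "E = {x \<in> N. x [^] p \<in> T}"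
  have "E \<lhd> G"
  proof (rule normal_invI)
    show "subgroup E G" unfolding E_def using power_mod_subgroup[OF cf(1) NG chief_abelian[OF c]] .
    fix g y assume g: "g \<in> carrier G" and y: "y \<in> E"
    have yc: "y \<in> carrier G" using y subgroup.mem_carrier[OF NG] by (auto simp: E_def)
    have "(g \<otimes> y \<otimes> inv g) [^] n = g \<otimes> y [^] n \<otimes> inv g" for n :: nat
      using g yc by (induct n) (simp_all add: m_assoc)
    then show "g \<otimes> y \<otimes> inv g \<in> E"
      using y normal_invE(2)[OF cf(2) g] normal_invE(2)[OF cf(1) g] by (simp add: E_def)
  qed
  moreover have "T \<subseteq> E" using cf(3) pow_subgroup[OF TG] by (auto simp: E_def)
  moreover have "E \<subseteq> N" by (auto simp: E_def)
  ultimately have "E = N" using chief_factorD(4)[OF c, of E] u by (auto simp: E_def)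
  then have exp: "\<And>x. x \<in> N \<Longrightarrow> x [^] p \<in> T" by (auto simp: E_def)
  have "h.H.ord (T #> u) dvd p"
    using rcoset_pow_iff[OF cf(1) uc, of p] u(3) h.H.pow_eq_id[OF h.hom_closed[OF uc]] by blast
  moreover have "h.H.ord (T #> u) \<noteq> 1"
    using rcoset_one_iff[OF cf(1) uc] u(2) h.H.ord_eq_1[OF h.hom_closed[OF uc]] by simp
  ultimately have "h.H.ord (T #> u) = p" using p unfolding prime_nat_iff by blast
  then have "p dvd card ((\<lambda>x. T #> x) ` N)"
    using h.H.ord_dvd_card_subgroup[OF h.subgroup_img_is_subgroup[OF NG], of "T #> u"] u(1) finite_normal[OF cf(2)] by auto
  then show thesis using that p exp by blast
qed

text \<open>Frattini argument: \<open>conjugate g P\<close> is a p-subgroup of \<open>Q\<close> of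
  the same order as \<open>P\<close>, so some \<open>a \<in> Q\<close> conjugates it back to
  \<open>P\<close>, and \<open>a \<otimes> g\<close> normalises \<open>P\<close>.\<close>

lemma sylow_normalizer_supplement:
  assumes Q: "Q \<lhd> G" and p: "Factorial_Ring.prime p" and P: "subgroup P G" "P \<subseteq> Q" "card P = p ^ a"
    and index: "\<not> p dvd card (rcosets\<^bsub>G\<lparr>carrier := Q\<rparr>\<^esub> P)"
  shows "subgroup {g \<in> carrier G. conjugate g P = P} G" "Q <#> {g \<in> carrier G. conjugate g P = P} = carrier G"
proof -
  let ?R = "{g \<in> carrier G. conjugate g P = P}"
  have PG: "P \<subseteq> carrier G" using P(1) by (rule subgroup.subset)
  have QG: "subgroup Q G" using Q by (rule normal_imp_subgroup)
  have Qc: "Q \<subseteq> carrier G" using QG by (rule subgroup.subset)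
  show R: "subgroup ?R G"
  proof (rule subgroupI)
    show "?R \<noteq> {}" using conjugate_one[OF PG] by auto
    fix a assume a: "a \<in> ?R"
    then have "conjugate (inv a) (conjugate a P) = P"
      using conjugate_conjugate[of "inv a" a P] conjugate_one[OF PG] by simp
    then show "inv a \<in> ?R" using a by simp
    fix b assume b: "b \<in> ?R"
    then show "a \<otimes> b \<in> ?R" using a conjugate_conjugate[of a b P] by simp
  qed auto
  interpret Q: group "G\<lparr>carrier := Q\<rparr>" using subgroup.subgroup_is_group[OF QG is_group] .
  have "g \<in> Q <#> ?R" if g: "g \<in> carrier G" for g
  proof -
    define P' where "P' = conjugate g P"
    have P'G: "subgroup P' G" unfolding P'_def using g P(1) by (rule conjugate_subgroup)
    have P'Q: "P' \<subseteq> Q"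
      using conjugate_mono[OF P(2), of g] normal_conjugate[OF Q g] by (simp add: P'_def)
    have card_conj: "card (conjugate x P) = card P" if x: "x \<in> carrier G" for x
    proof -
      have "conjugate x P = (\<lambda>y. x \<otimes> y \<otimes> inv x) ` P"
      proof (intro equalityI subsetI)
        fix y assume y: "y \<in> conjugate x P"
        then have "y = x \<otimes> (inv x \<otimes> y \<otimes> x) \<otimes> inv x" using x by (simp add: conjugate_def m_assoc)
        then show "y \<in> (\<lambda>y. x \<otimes> y \<otimes> inv x) ` P" using y by (auto simp: conjugate_def)
      qed (use x PG in \<open>auto simp: conjugate_def m_assoc subset_iff\<close>)
      moreover have "inj_on (\<lambda>y. x \<otimes> y \<otimes> inv x) P"
        using x PG by (auto intro!: inj_onI simp: subset_iff)
      ultimately show ?thesis by (simp add: card_image)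
    qed
    have "\<exists>a\<in>carrier (G\<lparr>carrier := Q\<rparr>). \<forall>y\<in>P'. a \<otimes>\<^bsub>G\<lparr>carrier := Q\<rparr>\<^esub> y \<otimes>\<^bsub>G\<lparr>carrier := Q\<rparr>\<^esub> inv\<^bsub>G\<lparr>carrier := Q\<rparr>\<^esub> a \<in> P"
      using finite_normal[OF Q] p index P'G P'Q P card_conj[OF g]
      by (intro Q.p_subgroup_in_conjugate_of_sylow[of p P P' a]) (auto intro: subgroup_incl QG simp: P'_def)
    then obtain a where a: "a \<in> Q" "\<And>y. y \<in> P' \<Longrightarrow> a \<otimes> y \<otimes> inv a \<in> P"
      using m_inv_consistent[OF QG] by auto
    have ac: "a \<in> carrier G" using QG a(1) by (rule subgroup.mem_carrier)
    have "P' \<subseteq> conjugate (inv a) P"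
      using a(2) ac subgroup.subset[OF P'G] by (auto simp: conjugate_def)
    moreover have "finite (conjugate (inv a) P)"
      using finite_subgroup conjugate_subgroup[OF _ P(1)] ac by blast
    ultimately have "P' = conjugate (inv a) P"
      using card_conj[OF g] card_conj[of "inv a"] ac by (intro card_subset_eq) (auto simp: P'_def)
    then have "conjugate (a \<otimes> g) P = P"
      using conjugate_conjugate[of a g P] conjugate_conjugate[of a "inv a" P] conjugate_one[OF PG] ac g
      by (simp add: P'_def)
    then have "a \<otimes> g \<in> ?R" using ac g by simp
    then have "inv a \<otimes> (a \<otimes> g) \<in> Q <#> ?R"
      using subgroup.m_inv_closed[OF QG a(1)] by (intro set_multI)
    then show ?thesis using ac g by simp
  qed
  then show "Q <#> ?R = carrier G"
    using set_mult_least[OF subgroup_self Qc, of ?R] by auto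
qed

lemma index_power_mem:
  assumes N: "N \<lhd> G" and Q: "subgroup Q G" and NQ: "N \<subseteq> Q" and y: "y \<in> Q"
  shows "y [^] (card (rcosets\<^bsub>G\<lparr>carrier := Q\<rparr>\<^esub> N)) \<in> N"
proof -
  let ?Q = "G\<lparr>carrier := Q\<rparr>"
  interpret Q: group ?Q using subgroup.subgroup_is_group[OF Q is_group] .
  have N': "N \<lhd> ?Q" using normal_restrict_supergroup[OF Q N NQ] .
  interpret M: group "?Q Mod N" using normal.factorgroup_is_group[OF N'] .
  have c: "N #>\<^bsub>?Q\<^esub> y \<in> carrier (?Q Mod N)"
    using Q.rcosetsI[of N y] NQ y by (simp add: FactGroup_def)
  have "(N #>\<^bsub>?Q\<^esub> y) [^]\<^bsub>?Q Mod N\<^esub> (card (rcosets\<^bsub>?Q\<^esub> N)) = \<one>\<^bsub>?Q Mod N\<^esub>"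
    using M.pow_order_eq_1[OF c] by (simp add: order_def FactGroup_def)
  then have "y [^]\<^bsub>?Q\<^esub> (card (rcosets\<^bsub>?Q\<^esub> N)) \<in> N"
    using Q.rcoset_pow_iff[OF N', of y] y by simp
  then show ?thesis by (simp add: nat_pow_consistent[symmetric])
qed

text \<open>A Sylow p-subgroup \<open>P\<close> of \<open>Q = frattini_over N\<close> turns out to
  lie in \<open>N\<close>, so the full p-part of \<open>|Q|\<close> divides \<open>|N|\<close>. The
  reason is that \<open>P\<close> centralises \<open>N/T\<close>: it fixes a nontrivial vector
  \<open>u\<close>, all its conjugates fix the same \<open>u\<close>, and \<open>N/T\<close> is
  minimal.\<close>

lemma frattini_index_coprime:
  assumes c: "chief_factor T N" and T: "frattini_over T = T" and nf: "\<not> N \<subseteq> T"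
    and p: "Factorial_Ring.prime (p::nat)" "p dvd card ((\<lambda>x. T #> x) ` N)"
  shows "\<not> p dvd card (rcosets\<^bsub>G\<lparr>carrier := frattini_over N\<rparr>\<^esub> N)"
proof -
  note cf = chief_factorD(1-3)[OF c]
  define Q where "Q = frattini_over N"
  let ?Q = "G\<lparr>carrier := Q\<rparr>"
  have Qn: "Q \<lhd> G" unfolding Q_def using cf(2) by (rule frattini_over_normal)
  have QG: "subgroup Q G" using Qn by (rule normal_imp_subgroup)
  have NG: "subgroup N G" using cf(2) by (rule normal_imp_subgroup)
  have NQ: "N \<subseteq> Q" unfolding Q_def using subset_frattini_over normal_subset[OF cf(2)] by blast
  have TG: "subgroup T G" using cf(1) by (rule normal_imp_subgroup)
  interpret Q: group ?Q using subgroup.subgroup_is_group[OF QG is_group] .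
  obtain M where M: "maximal_subgroup G M" "T \<subseteq> M" "\<not> N \<subseteq> M"
    using supplement_exists[of N T] T nf normal_subset[OF cf(2)] by metis
  have fin: "finite Q" using Qn by (rule finite_normal)
  have "card Q \<noteq> 0" using fin subgroup.one_closed[OF QG] by auto
  then obtain m where m: "card Q = p ^ multiplicity p (card Q) * m" "\<not> p dvd m"
    using multiplicity_decompose'[of "card Q" p] p(1) by (metis not_prime_unit)
  define a where "a = multiplicity p (card Q)"
  obtain P where P: "subgroup P ?Q" "card P = p ^ a"
    using sylow_thm[OF p(1) Q.is_group, of a m] m(1) fin by (auto simp: order_def a_def)
  have PG: "subgroup P G" using QG P(1) by (rule incl_subgroup)
  have PQ: "P \<subseteq> Q" using subgroup.subset[OF P(1)] by simp
  have PGc: "P \<subseteq> carrier G" using PG by (rule subgroup.subset)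
  have "card (rcosets\<^bsub>?Q\<^esub> P) * card P = card Q"
    using Q.lagrange[OF P(1)] by (simp add: order_def)
  then have "p ^ a * card (rcosets\<^bsub>?Q\<^esub> P) = p ^ a * m"
    using m(1) P(2) by (simp only: a_def mult.commute)
  then have index: "\<not> p dvd card (rcosets\<^bsub>?Q\<^esub> P)"
    using m(2) prime_gt_0_nat[OF p(1)] by simp
  define R where "R = {g \<in> carrier G. conjugate g P = P}"
  have R: "subgroup R G" "Q <#> R = carrier G"
    using sylow_normalizer_supplement[OF Qn p(1) PG PQ P(2) index] by (simp_all add: R_def)
  \<comment> \<open>In \<open>Q R = G\<close> the factor \<open>Q\<close> shrinks to
    \<open>N\<close>, because every maximal subgroup over \<open>N\<close> contains
    \<open>Q\<close>.\<close>
  have NR: "N <#> R = carrier G"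
  proof (rule ccontr)
    assume "N <#> R \<noteq> carrier G"
    then obtain S where S: "maximal_subgroup G S" "N <#> R \<subseteq> S"
      using maximal_subgroup_above[OF mult_norm_subgroup[OF cf(2) R(1)]] by blast
    have NS: "N \<subseteq> S" "R \<subseteq> S" using subset_set_mult[OF NG R(1)] S(2) by auto
    have "Q \<subseteq> S" unfolding Q_def using S(1) NS(1) by (rule frattini_over_subset)
    then have "carrier G \<subseteq> S"
      using R(2) set_mult_least[OF maximal_subgroupD(1)[OF S(1)] _ NS(2)] by metis
    then show False using maximal_subgroupD(1,2)[OF S(1)] subgroup.subset by blast
  qed
  interpret h: group_hom G "G Mod T" "\<lambda>x. T #> x" using rcoset_hom[OF cf(1)] .
  have "\<exists>x\<in>(\<lambda>x. T #> x) ` N. x \<noteq> \<one>\<^bsub>G Mod T\<^esub> \<and>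
      (\<forall>g\<in>carrier (G\<lparr>carrier := P\<rparr>). (T #> g) \<otimes>\<^bsub>G Mod T\<^esub> x = x \<otimes>\<^bsub>G Mod T\<^esub> (T #> g))"
  proof (rule h.H.p_group_fixes_vector[where f = "\<lambda>x. T #> x" and p = p and a = a])
    show "Group.group (G\<lparr>carrier := P\<rparr>)" using subgroup.subgroup_is_group[OF PG is_group] .
    show "order (G\<lparr>carrier := P\<rparr>) = p ^ a" using P(2) by (simp add: order_def)
    show "(\<lambda>x. T #> x) \<in> hom (G\<lparr>carrier := P\<rparr>) (G Mod T)"
    proof (rule homI)
      show "T #> x \<in> carrier (G Mod T)" if "x \<in> carrier (G\<lparr>carrier := P\<rparr>)" for x
        using that PGc by (intro h.hom_closed) auto
      show "T #> (x \<otimes>\<^bsub>G\<lparr>carrier := P\<rparr>\<^esub> y) = (T #> x) \<otimes>\<^bsub>G Mod T\<^esub> (T #> y)"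
        if "x \<in> carrier (G\<lparr>carrier := P\<rparr>)" "y \<in> carrier (G\<lparr>carrier := P\<rparr>)" for x y
      proof -
        have "x \<in> carrier G" "y \<in> carrier G" using that PGc by auto
        then show ?thesis using h.hom_mult[of x y] by simp
      qed
    qed
    show "subgroup ((\<lambda>x. T #> x) ` N) (G Mod T)" using NG by (rule h.subgroup_img_is_subgroup)
    show "finite ((\<lambda>x. T #> x) ` N)" using finite_normal[OF cf(2)] by simp
    show "(T #> g) \<otimes>\<^bsub>G Mod T\<^esub> x \<otimes>\<^bsub>G Mod T\<^esub> inv\<^bsub>G Mod T\<^esub> (T #> g) \<in> (\<lambda>x. T #> x) ` N"
      if g: "g \<in> carrier (G\<lparr>carrier := P\<rparr>)" and x: "x \<in> (\<lambda>x. T #> x) ` N" for g x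
    proof -
      obtain n where n: "n \<in> N" "x = T #> n" using x by blast
      have gc: "g \<in> carrier G" using g PGc by auto
      have nc: "n \<in> carrier G" using n(1) NG subgroup.mem_carrier by metis
      have "T #> (g \<otimes> n \<otimes> inv g) = (T #> g) \<otimes>\<^bsub>G Mod T\<^esub> x \<otimes>\<^bsub>G Mod T\<^esub> inv\<^bsub>G Mod T\<^esub> (T #> g)"
        using gc nc n(2) h.hom_mult[of "g \<otimes> n" "inv g"] h.hom_mult[of g n] h.hom_inv[of g] by simp
      then show ?thesis using normal_invE(2)[OF cf(2) gc n(1)] by (metis image_eqI)
    qed
  qed (use p in auto)
  then obtain u where u: "u \<in> N" "T #> u \<noteq> T" and
    ucomm: "\<And>g. g \<in> P \<Longrightarrow> (T #> g) \<otimes>\<^bsub>G Mod T\<^esub> (T #> u) = (T #> u) \<otimes>\<^bsub>G Mod T\<^esub> (T #> g)"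
    by auto
  have uc: "u \<in> carrier G" using u(1) NG subgroup.mem_carrier by metis
  define W where "W = centralizer_mod T {u}"
  have W: "subgroup W G" unfolding W_def using cf(1) uc by (intro centralizer_mod_subgroup) auto
  have PW: "P \<subseteq> W"
    using rcoset_commute_iff[OF cf(1) _ uc] ucomm PGc by (auto simp: W_def centralizer_mod_def)
  have NW: "N \<subseteq> W" using chief_abelian[OF c] u(1) by (auto simp: W_def centralizer_mod_def)
  \<comment> \<open>The union of all conjugates of \<open>P\<close> is invariant, as minimality of
    \<open>N/T\<close> requires. By \<open>N R = G\<close> each conjugate has the form
    \<open>n P n^-1\<close> with \<open>n \<in> N\<close>, and both \<open>N\<close> and
    \<open>P\<close> lie in \<open>W\<close>.\<close>
  define S where "S = (\<Union>g\<in>carrier G. (\<lambda>x. g \<otimes> x \<otimes> inv g) ` P)"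
  have SG: "S \<subseteq> carrier G" using PGc by (auto simp: S_def)
  have "S \<subseteq> W"
  proof
    fix s assume "s \<in> S"
    then obtain g x where gx: "g \<in> carrier G" "x \<in> P" "s = g \<otimes> x \<otimes> inv g" by (auto simp: S_def)
    obtain n h where nh: "n \<in> N" "h \<in> R" "g = n \<otimes> h" using gx(1) NR by (metis set_multE)
    have hc: "h \<in> carrier G" and hP: "conjugate h P = P" using nh(2) by (auto simp: R_def)
    have nc: "n \<in> carrier G" using nh(1) NG subgroup.mem_carrier by metis
    have xc: "x \<in> carrier G" using gx PGc by blast
    have "h \<otimes> x \<otimes> inv h \<in> conjugate h P"
      using hc gx(2) xc by (simp add: conjugate_def m_assoc)
    then have "h \<otimes> x \<otimes> inv h \<in> W" using hP PW by blast
    moreover have "s = n \<otimes> (h \<otimes> x \<otimes> inv h) \<otimes> inv n"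
      using nc hc xc by (simp add: gx nh m_assoc inv_mult_group)
    ultimately show "s \<in> W"
      using NW nh(1) W by (auto intro: subgroup.m_closed subgroup.m_inv_closed)
  qed
  then have "{u} \<subseteq> centralizer_mod T S"
    using centralizer_mod_sym[OF TG SG, of "{u}"] uc by (simp add: W_def)
  moreover have "x \<otimes> s \<otimes> inv x \<in> S" if xs: "x \<in> carrier G" "s \<in> S" for x s
  proof -
    obtain g y where gy: "g \<in> carrier G" "y \<in> P" "s = g \<otimes> y \<otimes> inv g" using xs(2) by (auto simp: S_def)
    have "x \<otimes> s \<otimes> inv x = (x \<otimes> g) \<otimes> y \<otimes> inv (x \<otimes> g)"
      using gy PGc xs(1) by (simp add: m_assoc inv_mult_group subset_iff)
    then show ?thesis using gy xs(1) unfolding S_def by blast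
  qed
  moreover have "u \<notin> T" using u(2) rcoset_one_iff[OF cf(1) uc] by simp
  ultimately have "N \<subseteq> centralizer_mod T S"
    using chief_centralizer_cases[OF c SG] u(1) by blast
  then have "S \<subseteq> centralizer_mod T N"
    using centralizer_mod_sym[OF TG normal_subset[OF cf(2)] SG] by blast
  moreover have "P \<subseteq> S"
  proof
    fix x assume "x \<in> P"
    then have "x = \<one> \<otimes> x \<otimes> inv \<one>" using PGc by auto
    then show "x \<in> S" using \<open>x \<in> P\<close> unfolding S_def by blast
  qed
  ultimately have PN: "P \<subseteq> N"
    using frattini_inter_centralizer_eq[OF c T M] PQ by (auto simp: Q_def)
  have "p ^ a dvd card N"
  proof -
    interpret N: group "G\<lparr>carrier := N\<rparr>" using subgroup.subgroup_is_group[OF NG is_group] .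
    have "subgroup P (G\<lparr>carrier := N\<rparr>)" using subgroup_incl[OF PG NG PN] .
    then have "card (rcosets\<^bsub>G\<lparr>carrier := N\<rparr>\<^esub> P) * card P = card N"
      using N.lagrange by (simp add: order_def)
    then show ?thesis using P(2) by (metis dvd_triv_right)
  qed
  then obtain s where s: "card N = p ^ a * s" by (auto simp: dvd_def)
  have "card (rcosets\<^bsub>?Q\<^esub> N) * card N = card Q"
    using Q.lagrange[OF subgroup_incl[OF NG QG NQ]] by (simp add: order_def)
  then have "p ^ a * (card (rcosets\<^bsub>?Q\<^esub> N) * s) = p ^ a * m"
    using m(1) s by (simp add: a_def mult_ac)
  then have "card (rcosets\<^bsub>?Q\<^esub> N) * s = m" using prime_gt_0_nat[OF p(1)] by simp
  then show ?thesis using m(2) by (auto simp: Q_def)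
qed

text \<open>\<open>[v^-1, x]\<close> lies in \<open>M\<close> because \<open>x\<close> and
  \<open>v^-1 x v\<close> do, and in \<open>N\<close> because \<open>v\<close> does, hence in
  \<open>M \<inter> N = T\<close>. Intersecting \<open>M\<close> with its conjugate by
  \<open>v\<close> leaves only stabilisers of the vector \<open>v\<close>.\<close>

lemma conjugate_mem_commutes:
  assumes c: "chief_factor T N" and M: "maximal_subgroup G M" "T \<subseteq> M" "\<not> N \<subseteq> M"
    and v: "v \<in> N" and x: "x \<in> M" "x \<in> conjugate v M"
  shows "v \<otimes> x \<otimes> inv v \<otimes> inv x \<in> T"
proof -
  note cf = chief_factorD(1-3)[OF c]
  have MG: "subgroup M G" using M(1) by (rule maximal_subgroupD)
  have NG: "subgroup N G" using cf(2) by (rule normal_imp_subgroup)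
  have vc: "v \<in> carrier G" using NG v by (rule subgroup.mem_carrier)
  have xc: "x \<in> carrier G" using MG x(1) by (rule subgroup.mem_carrier)
  have "inv v \<otimes> x \<otimes> v \<otimes> inv x \<in> M"
    using x MG by (auto simp: conjugate_def intro: subgroup.m_closed subgroup.m_inv_closed)
  moreover have "inv v \<otimes> x \<otimes> inv (inv v) \<otimes> inv x \<in> N"
    using normal_commutator_mem(1)[OF cf(2) subgroup.m_inv_closed[OF NG v] xc] .
  ultimately have "inv v \<otimes> x \<otimes> inv (inv v) \<otimes> inv x \<in> T"
    using chief_inter_maximal[OF c chief_abelian[OF c] M] vc by auto
  then have "inv v \<in> centralizer_mod T {x}" using vc by (simp add: centralizer_mod_def)
  then have "inv (inv v) \<in> centralizer_mod T {x}"
    using centralizer_mod_subgroup[OF cf(1), of "{x}"] xc by (simp add: subgroup.m_inv_closed del: inv_inv)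
  then show ?thesis using vc by (simp add: centralizer_mod_def)
qed

text \<open>Induction down the chief factors between \<open>N\<close> and \<open>K\<close>, with one
  more conjugate for each. What survives in \<open>K\<close>, the subgroup \<open>Y\<close>, meets
  the next lower term \<open>L\<close> inside \<open>T\<close>; so modulo \<open>T\<close> it embeds
  in \<open>K/L\<close> and is abelian. As \<open>clen\<close> counts from the top,
  \<open>clen N - clen K\<close> is the number of these factors; the bound avoids the
  subtraction.\<close>

lemma conjugates_cut_frattini:
  assumes c: "chief_factor T N" and T: "frattini_over T = T" and M: "maximal_subgroup G M" "T \<subseteq> M" "\<not> N \<subseteq> M"
    and K: "K \<lhd> G" "N \<subseteq> K" "K \<subseteq> frattini_over N"
  shows "\<exists>V. finite V \<and> V \<subseteq> N \<and> card V + clen K \<le> clen N \<and> K \<inter> M \<inter> (\<Inter>v\<in>V. conjugate v M) \<subseteq> T"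
  using K
proof (induct "card K" arbitrary: K rule: less_induct)
  case less
  note cf = chief_factorD(1-3)[OF c]
  have meet: "M \<inter> N = T" using chief_inter_maximal[OF c chief_abelian[OF c] M] .
  have MG: "subgroup M G" using M(1) by (rule maximal_subgroupD)
  have NG: "subgroup N G" using cf(2) by (rule normal_imp_subgroup)
  have TG: "subgroup T G" using cf(1) by (rule normal_imp_subgroup)
  have Nc: "N \<subseteq> carrier G" using NG by (rule subgroup.subset)
  show ?case
  proof (cases "K = N")
    case True
    then show ?thesis using meet by (intro exI[of _ "{}"]) auto
  next
    case False
    obtain L where L: "chief_factor L K" "N \<subseteq> L"
      using chief_factor_below[OF cf(2) less(2)] less(3) False by blast
    note cfL = chief_factorD(1-3)[OF L(1)]
    have "card L < card K" using cfL finite_normal psubset_card_mono by blast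
    then obtain V where V: "finite V" "V \<subseteq> N" "card V + clen L \<le> clen N"
        "L \<inter> M \<inter> (\<Inter>v\<in>V. conjugate v M) \<subseteq> T"
      using less(1)[of L] cfL L(2) less(4) by blast
    define Y where "Y = K \<inter> M \<inter> (\<Inter>v\<in>V. conjugate v M)"
    have KG: "subgroup K G" using less(2) by (rule normal_imp_subgroup)
    have YG: "subgroup Y G"
    proof -
      have "subgroup (\<Inter> (insert K (insert M ((\<lambda>v. conjugate v M) ` V)))) G"
        using KG MG conjugate_subgroup[OF _ MG] V(2) Nc by (intro subgroups_Inter) auto
      then show ?thesis by (simp add: Y_def Int_assoc)
    qed
    have Yc: "Y \<subseteq> carrier G" using YG by (rule subgroup.subset)
    have Yab: "a \<otimes> b \<otimes> inv a \<otimes> inv b \<in> T" if ab: "a \<in> Y" "b \<in> Y" for a b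
    proof -
      have "a \<otimes> b \<otimes> inv a \<otimes> inv b \<in> Y"
        using ab YG by (blast intro: subgroup.m_closed subgroup.m_inv_closed)
      moreover have "a \<otimes> b \<otimes> inv a \<otimes> inv b \<in> L"
        using chief_abelian[OF L(1)] ab centralizer_modD by (auto simp: Y_def)
      ultimately show ?thesis using V(4) by (auto simp: Y_def)
    qed
    obtain p where p: "Factorial_Ring.prime (p::nat)" "\<And>x. x \<in> N \<Longrightarrow> x [^] p \<in> T"
        "p dvd card ((\<lambda>x. T #> x) ` N)"
      using chief_factor_exponent[OF c] by blast
    \<comment> \<open>The index \<open>r\<close> is an exponent of \<open>Y\<close> modulo
      \<open>T\<close>, since \<open>y^r\<close> lies in \<open>N \<inter> M = T\<close>, and it is
      prime to the exponent \<open>p\<close> of \<open>N/T\<close>.\<close>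
    define r where "r = card (rcosets\<^bsub>G\<lparr>carrier := frattini_over N\<rparr>\<^esub> N)"
    have "\<not> p dvd r"
      unfolding r_def using frattini_index_coprime[OF c T _ p(1,3)] cf(3) by blast
    then have cop: "coprime p r" using p(1) prime_imp_coprime by blast
    have Yr: "y [^] r \<in> T" if "y \<in> Y" for y
    proof -
      have "y [^] r \<in> N" unfolding r_def
        using that less(4) subset_frattini_over[OF Nc] normal_imp_subgroup[OF frattini_over_normal[OF cf(2)]]
        by (intro index_power_mem[OF cf(2)]) (auto simp: Y_def)
      moreover have "y [^] r \<in> M" using that pow_subgroup[OF MG] by (auto simp: Y_def)
      ultimately show ?thesis using meet by blast
    qed
    interpret h: group_hom G "G Mod T" "\<lambda>x. T #> x" using rcoset_hom[OF cf(1)] .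
    have comm: "(T #> a) \<otimes>\<^bsub>G Mod T\<^esub> (T #> b) = (T #> b) \<otimes>\<^bsub>G Mod T\<^esub> (T #> a) \<longleftrightarrow> a \<otimes> b \<otimes> inv a \<otimes> inv b \<in> T"
      if "a \<in> carrier G" "b \<in> carrier G" for a b using rcoset_commute_iff[OF cf(1) that] .
    have "\<exists>v\<in>(\<lambda>x. T #> x) ` N. \<forall>y\<in>(\<lambda>x. T #> x) ` Y. y \<otimes>\<^bsub>G Mod T\<^esub> v = v \<otimes>\<^bsub>G Mod T\<^esub> y \<longrightarrow>
        (\<forall>a\<in>(\<lambda>x. T #> x) ` N. y \<otimes>\<^bsub>G Mod T\<^esub> a = a \<otimes>\<^bsub>G Mod T\<^esub> y)"
    proof (rule h.H.coprime_abelian_regular_vector[where r = r])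
      show "subgroup ((\<lambda>x. T #> x) ` N) (G Mod T)" using NG by (rule h.subgroup_img_is_subgroup)
      show "subgroup ((\<lambda>x. T #> x) ` Y) (G Mod T)" using YG by (rule h.subgroup_img_is_subgroup)
      show "finite ((\<lambda>x. T #> x) ` Y)" using finite_subgroup[OF YG] by simp
      show "a \<otimes>\<^bsub>G Mod T\<^esub> b = b \<otimes>\<^bsub>G Mod T\<^esub> a" if ab: "a \<in> (\<lambda>x. T #> x) ` N" "b \<in> (\<lambda>x. T #> x) ` N" for a b
      proof -
        obtain m n where "m \<in> N" "a = T #> m" "n \<in> N" "b = T #> n" using ab by blast
        then show ?thesis using comm[of m n] Nc chief_abelian[OF c] centralizer_modD by blast
      qed
      show "a \<otimes>\<^bsub>G Mod T\<^esub> b = b \<otimes>\<^bsub>G Mod T\<^esub> a" if ab: "a \<in> (\<lambda>x. T #> x) ` Y" "b \<in> (\<lambda>x. T #> x) ` Y" for a b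
      proof -
        obtain m n where "m \<in> Y" "a = T #> m" "n \<in> Y" "b = T #> n" using ab by blast
        then show ?thesis using comm[of m n] Yc Yab by blast
      qed
      show "y \<otimes>\<^bsub>G Mod T\<^esub> a \<otimes>\<^bsub>G Mod T\<^esub> inv\<^bsub>G Mod T\<^esub> y \<in> (\<lambda>x. T #> x) ` N"
        if ya: "y \<in> (\<lambda>x. T #> x) ` Y" "a \<in> (\<lambda>x. T #> x) ` N" for y a
      proof -
        obtain g n where gn: "g \<in> Y" "y = T #> g" "n \<in> N" "a = T #> n" using ya by blast
        then have c: "g \<in> carrier G" "n \<in> carrier G" using Yc Nc by auto
        have "T #> (g \<otimes> n \<otimes> inv g) = y \<otimes>\<^bsub>G Mod T\<^esub> a \<otimes>\<^bsub>G Mod T\<^esub> inv\<^bsub>G Mod T\<^esub> y"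
          using c gn h.hom_mult[of "g \<otimes> n" "inv g"] h.hom_mult[of g n] h.hom_inv[of g] by simp
        then show ?thesis using normal_invE(2)[OF cf(2) c(1) gn(3)] by (metis image_eqI)
      qed
      show "y [^]\<^bsub>G Mod T\<^esub> r = \<one>\<^bsub>G Mod T\<^esub>" if yY: "y \<in> (\<lambda>x. T #> x) ` Y" for y
      proof -
        obtain g where g: "g \<in> Y" "y = T #> g" using yY by blast
        then show ?thesis using Yr[OF g(1)] rcoset_pow_iff[OF cf(1), of g r] Yc by blast
      qed
      show "a = \<one>\<^bsub>G Mod T\<^esub>" if aN: "a \<in> (\<lambda>x. T #> x) ` N" "a [^]\<^bsub>G Mod T\<^esub> r = \<one>\<^bsub>G Mod T\<^esub>" for a
      proof -
        obtain n where n: "n \<in> N" "a = T #> n" using aN(1) by blast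
        have nc: "n \<in> carrier G" using n(1) Nc by blast
        have "n [^] r \<in> T" using aN(2) n(2) rcoset_pow_iff[OF cf(1) nc, of r] by simp
        then have "n \<in> T" using coprime_powers_mem[OF TG nc cop p(2)[OF n(1)]] by blast
        then show ?thesis using rcoset_one_iff[OF cf(1) nc] n(2) by simp
      qed
    qed
    then obtain v where v: "v \<in> N" and reg: "\<forall>y\<in>Y. (T #> y) \<otimes>\<^bsub>G Mod T\<^esub> (T #> v) = (T #> v) \<otimes>\<^bsub>G Mod T\<^esub> (T #> y) \<longrightarrow>
        (\<forall>n\<in>N. (T #> y) \<otimes>\<^bsub>G Mod T\<^esub> (T #> n) = (T #> n) \<otimes>\<^bsub>G Mod T\<^esub> (T #> y))"
      by (auto simp del: mult_FactGroup)
    have vc: "v \<in> carrier G" using v Nc by blast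
    \<comment> \<open>An element that survives the conjugate by \<open>v\<close> fixes
      \<open>v\<close>, hence all of \<open>N/T\<close> by the choice of \<open>v\<close>, and
      faithfulness puts it into \<open>T\<close>.\<close>
    have "x \<in> T" if x: "x \<in> Y" "x \<in> conjugate v M" for x
    proof -
      have xM: "x \<in> M" and xQ: "x \<in> frattini_over N" using x(1) less(4) by (auto simp: Y_def)
      have xc: "x \<in> carrier G" using x(1) Yc by blast
      have "(T #> x) \<otimes>\<^bsub>G Mod T\<^esub> (T #> v) = (T #> v) \<otimes>\<^bsub>G Mod T\<^esub> (T #> x)"
        using comm[OF vc xc] conjugate_mem_commutes[OF c M v xM x(2)] by simp
      then have "x \<otimes> n \<otimes> inv x \<otimes> inv n \<in> T" if "n \<in> N" for n
        using reg x(1) comm[of x n] xc that Nc by blast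
      then have "x \<in> centralizer_mod T N" using xc by (simp add: centralizer_mod_def)
      then show ?thesis
        using frattini_centralizer_inter_complement[OF c M] T xM xQ by blast
    qed
    then have "K \<inter> M \<inter> (\<Inter>v\<in>insert v V. conjugate v M) \<subseteq> T"
      by (auto simp: Y_def)
    moreover have "card (insert v V) + clen K \<le> clen N"
      using V(1,3) unit_length_step[OF L(1)] card_insert_le_m1[of "Suc (card V)" V v] by simp
    ultimately show ?thesis
      using V(1,2) v by (intro exI[of _ "insert v V"]) blast
  qed
qed

text \<open>The bound starts at \<open>frattini_over T\<close>, not at \<open>T\<close>, and this
  makes the costs add up to \<open>clen S\<close>: the inductive family for \<open>N\<close> costs
  at most \<open>clen Q\<close>, the conjugates at most \<open>clen N - clen Q\<close>, and
  \<open>M\<close> is paid by the factor \<open>N/S\<close>.\<close>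

theorem maximal_family_unit_length:
  assumes "T \<lhd> G"
  shows "\<exists>\<M>. finite \<M> \<and> (\<forall>M\<in>\<M>. maximal_subgroup G M) \<and> card \<M> \<le> clen (frattini_over T) \<and>
    carrier G \<inter> \<Inter> \<M> \<subseteq> frattini_over T"
  using assms
proof (induct "card (carrier G) - card T" arbitrary: T rule: less_induct)
  case less
  define S where "S = frattini_over T"
  have Sn: "S \<lhd> G" unfolding S_def using less(2) by (rule frattini_over_normal)
  have TS: "T \<subseteq> S" unfolding S_def using subset_frattini_over normal_subset[OF less(2)] by blast
  have SS: "frattini_over S = S" using frattini_over_eq[of T S] TS by (simp add: S_def)
  show ?case
  proof (cases "S = carrier G")
    case True
    then show ?thesis by (intro exI[of _ "{}"]) (simp add: S_def)
  next
    case False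
    then have "S \<subset> carrier G" using normal_subset[OF Sn] by blast
    then obtain N where N: "chief_factor S N"
      using chief_factor_above[OF Sn normal_self] by blast
    note cf = chief_factorD(1-3)[OF N]
    have "\<not> N \<subseteq> frattini_over S" using SS cf(3) by blast
    then obtain M where M: "maximal_subgroup G M" "S \<subseteq> M" "\<not> N \<subseteq> M"
      using normal_subset[OF cf(2)] by (rule supplement_exists)
    define Q where "Q = frattini_over N"
    have Qn: "Q \<lhd> G" unfolding Q_def using cf(2) by (rule frattini_over_normal)
    have NQ: "N \<subseteq> Q" unfolding Q_def using subset_frattini_over normal_subset[OF cf(2)] by blast
    have "T \<subset> N" using TS cf(3) by blast
    then obtain \<M> where \<M>: "finite \<M>" "\<forall>M\<in>\<M>. maximal_subgroup G M" "card \<M> \<le> clen Q" "carrier G \<inter> \<Inter> \<M> \<subseteq> Q"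
      using less(1)[of N] card_normal_less[OF cf(2)] cf(2) by (auto simp: Q_def)
    obtain V where V: "finite V" "V \<subseteq> N" "card V + clen Q \<le> clen N" "Q \<inter> M \<inter> (\<Inter>v\<in>V. conjugate v M) \<subseteq> S"
      using conjugates_cut_frattini[OF N SS M Qn NQ] by (auto simp: Q_def)
    define \<N> where "\<N> = \<M> \<union> insert M ((\<lambda>v. conjugate v M) ` V)"
    have "card \<N> \<le> card \<M> + card (insert M ((\<lambda>v. conjugate v M) ` V))"
      unfolding \<N>_def by (rule card_Un_le)
    also have "\<dots> \<le> card \<M> + Suc (card V)"
      using V(1) card_image_le[of V "\<lambda>v. conjugate v M"] card_insert_le_m1[of "Suc (card V)" "(\<lambda>v. conjugate v M) ` V" M]
      by simp
    also have "\<dots> \<le> clen S" using \<M>(3) V(3) unit_length_step[OF N] by simp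
    finally have "card \<N> \<le> clen S" .
    moreover have "carrier G \<inter> \<Inter> \<N> \<subseteq> S" using \<M>(4) V(4) by (auto simp: \<N>_def)
    moreover have "\<forall>M\<in>\<N>. maximal_subgroup G M"
      using \<M>(2) M(1) maximal_conjugate V(2) normal_subset[OF cf(2)] by (auto simp: \<N>_def)
    moreover have "finite \<N>" using \<M>(1) V(1) by (simp add: \<N>_def)
    ultimately show ?thesis unfolding S_def by blast
  qed
qed

end

section \<open>Groups with nilpotent derived subgroup\<close>

context group
begin

lemma normal_if_contains_derived:
  assumes H: "subgroup H G" and D: "derived G (carrier G) \<subseteq> H" shows "H \<lhd> G"
proof (rule normal_invI[OF H])
  fix x h assume x: "x \<in> carrier G" and h: "h \<in> H"
  have hc: "h \<in> carrier G" using H h by (rule subgroup.mem_carrier)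
  have "(x \<otimes> h \<otimes> inv x \<otimes> inv h) \<otimes> h \<in> H"
    using commutator_in_derived[OF x hc] D h H by (blast intro: subgroup.m_closed)
  then show "x \<otimes> h \<otimes> inv x \<in> H" using conjugate_decompose[OF x hc] by simp
qed

lemma abelian_quotient_centralizer:
  assumes "derived G (carrier G) \<subseteq> F" shows "carrier G \<subseteq> centralizer_mod F (carrier G)"
  using commutator_in_derived assms by (auto simp: centralizer_mod_def)

definition power_preimage :: "nat \<Rightarrow> 'a set \<Rightarrow> 'a set" where
  "power_preimage n F = {x \<in> carrier G. x [^] n \<in> F}"

lemma power_preimage_normal:
  assumes F: "F \<lhd> G" and D: "derived G (carrier G) \<subseteq> F"
  shows "power_preimage n F \<lhd> G" "F \<subseteq> power_preimage n F"
proof -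
  show "F \<subseteq> power_preimage n F"
    using normal_subset[OF F] pow_subgroup[OF normal_imp_subgroup[OF F]] by (auto simp: power_preimage_def)
  then show "power_preimage n F \<lhd> G"
    using power_mod_subgroup[OF F subgroup_self abelian_quotient_centralizer[OF D]] D
    by (intro normal_if_contains_derived) (auto simp: power_preimage_def)
qed

lemma centralizer_mod_set_mult:
  assumes T: "T \<lhd> G" and S: "S \<subseteq> carrier G" and "A \<subseteq> centralizer_mod T S" "B \<subseteq> centralizer_mod T S"
  shows "A <#> B \<subseteq> centralizer_mod T S"
  using set_mult_least[OF centralizer_mod_subgroup[OF T S] assms(3,4)] .

lemma centralizer_mod_antimono: "S \<subseteq> S' \<Longrightarrow> centralizer_mod T S' \<subseteq> centralizer_mod T S"
  by (auto simp: centralizer_mod_def)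

lemma maximal_subgroup_quotient:
  assumes K: "K \<lhd> G" and M: "maximal_subgroup G M" "K \<subseteq> M"
  shows "maximal_subgroup (G Mod K) ((\<lambda>x. K #> x) ` M)"
proof -
  interpret h: group_hom G "G Mod K" "\<lambda>x. K #> x" using rcoset_hom[OF K] .
  have MG: "subgroup M G" using M(1) by (rule maximal_subgroupD)
  have mem: "x \<in> M" if x: "x \<in> carrier G" "K #> x \<in> (\<lambda>x. K #> x) ` M" for x
  proof -
    obtain m where m: "m \<in> M" "K #> x = K #> m" using x(2) by blast
    have mc: "m \<in> carrier G" using MG m(1) by (rule subgroup.mem_carrier)
    have "x \<otimes> inv m \<in> M" using rcoset_eq_iff[OF K x(1) mc] m(2) M(2) by blast
    then have "x \<otimes> inv m \<otimes> m \<in> M" using m(1) MG by (blast intro: subgroup.m_closed)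
    then show ?thesis using x(1) mc by (simp add: m_assoc)
  qed
  show ?thesis
    unfolding maximal_subgroup_def
  proof (intro conjI allI impI)
    show "subgroup ((\<lambda>x. K #> x) ` M) (G Mod K)" using MG by (rule h.subgroup_img_is_subgroup)
    show "(\<lambda>x. K #> x) ` M \<noteq> carrier (G Mod K)"
      using mem maximal_subgroupD(2)[OF M(1)] subgroup.subset[OF MG] by (auto simp: carrier_FactGroup)
    fix H assume H: "subgroup H (G Mod K) \<and> (\<lambda>x. K #> x) ` M \<subseteq> H"
    define H' where "H' = {x \<in> carrier G. K #> x \<in> H}"
    have "subgroup H' G"
    proof (rule subgroupI)
      show "H' \<noteq> {}" using H subgroup.subset[OF MG] subgroup.one_closed[OF MG] by (auto simp: H'_def)
      fix a assume a: "a \<in> H'"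
      have "inv\<^bsub>G Mod K\<^esub> (K #> a) \<in> H" using H a by (auto simp: H'_def intro: subgroup.m_inv_closed)
      then show "inv a \<in> H'" using a h.hom_inv[of a] by (simp add: H'_def)
      fix b assume b: "b \<in> H'"
      have "(K #> a) \<otimes>\<^bsub>G Mod K\<^esub> (K #> b) \<in> H"
        using H a b unfolding H'_def by (blast intro: subgroup.m_closed)
      then show "a \<otimes> b \<in> H'" using a b h.hom_mult[of a b] by (simp add: H'_def)
    qed (auto simp: H'_def)
    moreover have "M \<subseteq> H'" using H subgroup.subset[OF MG] by (auto simp: H'_def)
    ultimately have "H' = M \<or> H' = carrier G" using maximal_subgroupD(3)[OF M(1)] by blast
    moreover have "H = (\<lambda>x. K #> x) ` H'"
      using H subgroup.subset[of H "G Mod K"] by (auto simp: H'_def carrier_FactGroup)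
    ultimately show "H = (\<lambda>x. K #> x) ` M \<or> H = carrier (G Mod K)"
      by (auto simp: carrier_FactGroup)
  qed
qed

text \<open>By contraposition, a factor counted in \<open>dlen\<close> is non-Frattini in the sense
  of the quotient. This inclusion is what an upper bound by \<open>non_frattini_count\<close>
  requires.\<close>

lemma frattini_chief_factor_subset:
  assumes K: "K \<lhd> G" and H: "H \<subseteq> carrier G" and frat: "frattini_chief_factor G H K"
  shows "H \<subseteq> frattini_over K"
proof
  fix h assume h: "h \<in> H"
  have hc: "h \<in> carrier G" using h H by blast
  have "h \<in> M" if M: "maximal_subgroup G M" "K \<subseteq> M" for M
  proof -
    have MG: "subgroup M G" using M(1) by (rule maximal_subgroupD)
    have "K #> h \<in> (\<lambda>x. K #> x) ` M"
      using frat h maximal_subgroup_quotient[OF K M] by (auto simp: frattini_chief_factor_def frattini_def)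
    then obtain m where m: "m \<in> M" "K #> h = K #> m" by blast
    have mc: "m \<in> carrier G" using MG m(1) by (rule subgroup.mem_carrier)
    have "h \<otimes> inv m \<in> M" using rcoset_eq_iff[OF K hc mc] m(2) M(2) by blast
    then have "h \<otimes> inv m \<otimes> m \<in> M" using m(1) MG by (blast intro: subgroup.m_closed)
    then show ?thesis using hc mc by (simp add: m_assoc)
  qed
  then show "h \<in> frattini_over K" using hc by (simp add: frattini_over_def)
qed

lemma intersection_number_le:
  assumes "finite \<M>" "\<forall>M\<in>\<M>. maximal_subgroup G M" "carrier G \<inter> \<Inter> \<M> \<subseteq> frattini G"
  shows "intersection_number G \<le> card \<M>"
proof -
  have "carrier G \<inter> \<Inter> \<M> = frattini G"
    using assms(2,3) by (auto simp: frattini_def)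
  then show ?thesis
    unfolding intersection_number_def using assms(1,2) by (intro Least_le) blast
qed

end

section \<open>Socle and Frattini quotient of an abelian factor group, and families of
  complements\<close>

context finite_solvable_group
begin

text \<open>Modulo the subgroup \<open>W\<close> of q-th powers the abelian group \<open>G/F\<close>
  becomes elementary abelian, so an element outside \<open>W\<close> is missed by some maximal
  subgroup. Hence Frattini elements are q-th powers for every prime \<open>q\<close>.\<close>

lemma frattini_factor_prime_power:
  assumes c: "chief_factor F N" and D: "derived G (carrier G) \<subseteq> F" and frat: "N \<subseteq> frattini_over F"
    and x: "x \<in> N" "x \<notin> F" and q: "Factorial_Ring.prime (q::nat)"
  obtains y where "y \<in> carrier G" "F #> (y [^] q) = F #> x"
proof -
  note cf = chief_factorD(1-3)[OF c]
  have FG: "subgroup F G" using cf(1) by (rule normal_imp_subgroup)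
  have NG: "subgroup N G" using cf(2) by (rule normal_imp_subgroup)
  have xc: "x \<in> carrier G" using NG x(1) by (rule subgroup.mem_carrier)
  interpret h: group_hom G "G Mod F" "\<lambda>x. F #> x" using rcoset_hom[OF cf(1)] .
  define W where "W = {g \<in> carrier G. \<exists>y\<in>carrier G. F #> g = F #> (y [^] q)}"
  have pow: "F #> (y [^] q) = (F #> y) [^]\<^bsub>G Mod F\<^esub> q" if "y \<in> carrier G" for y
    using normal.FactGroup_pow[OF cf(1) that] by simp
  have W: "subgroup W G"
  proof (rule subgroupI)
    show "W \<noteq> {}" unfolding W_def using one_closed nat_pow_one by blast
    fix a assume "a \<in> W"
    then obtain y where y: "a \<in> carrier G" "y \<in> carrier G" "F #> a = F #> (y [^] q)" by (auto simp: W_def)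
    have "F #> inv a = F #> (inv y [^] q)"
      using y h.hom_inv[of a] h.hom_inv[of "y [^] q"] nat_pow_inv[of y q] by simp
    then show "inv a \<in> W" unfolding W_def using y by blast
    fix b assume "b \<in> W"
    then obtain z where z: "b \<in> carrier G" "z \<in> carrier G" "F #> b = F #> (z [^] q)" by (auto simp: W_def)
    have "y \<otimes> z \<otimes> inv y \<otimes> inv z \<in> F" using commutator_in_derived[OF y(2) z(2)] D by blast
    then have comm: "(F #> y) \<otimes>\<^bsub>G Mod F\<^esub> (F #> z) = (F #> z) \<otimes>\<^bsub>G Mod F\<^esub> (F #> y)"
      using rcoset_commute_iff[OF cf(1) y(2) z(2)] by blast
    have "F #> (a \<otimes> b) = (F #> y) [^]\<^bsub>G Mod F\<^esub> q \<otimes>\<^bsub>G Mod F\<^esub> (F #> z) [^]\<^bsub>G Mod F\<^esub> q"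
      using h.hom_mult[OF y(1) z(1)] y(3) z(3) pow[OF y(2)] pow[OF z(2)] by metis
    also have "\<dots> = ((F #> y) \<otimes>\<^bsub>G Mod F\<^esub> (F #> z)) [^]\<^bsub>G Mod F\<^esub> q"
      by (rule h.H.pow_mult_distrib[OF comm h.hom_closed[OF y(2)] h.hom_closed[OF z(2)], symmetric])
    also have "\<dots> = F #> ((y \<otimes> z) [^] q)"
      using h.hom_mult[OF y(2) z(2)] pow[of "y \<otimes> z"] y(2) z(2) by simp
    finally show "a \<otimes> b \<in> W" unfolding W_def using y z by blast
  qed (auto simp: W_def)
  have powW: "y [^] q \<in> W" if "y \<in> carrier G" for y using that by (auto simp: W_def)
  have FW: "F \<subseteq> W"
  proof
    fix f assume f: "f \<in> F"
    have fc: "f \<in> carrier G" using FG f by (rule subgroup.mem_carrier)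
    have "F #> f = F #> (\<one> [^] q)"
      using rcoset_one_iff[OF cf(1) fc] f normal_subset[OF cf(1)] by simp
    then show "f \<in> W" unfolding W_def using fc by blast
  qed
  have "x \<in> W"
  proof (rule ccontr)
    assume xW: "x \<notin> W"
    \<comment> \<open>A subgroup \<open>M\<close> maximal among those over \<open>W\<close> missing
      \<open>x\<close> is a maximal subgroup: if \<open>M < H\<close> and \<open>y\<close> is
      outside \<open>H\<close>, then \<open>x\<close> lies in \<open>H\<close> and in
      \<open>M <y>\<close>, so \<open>y^k \<in> H\<close> for some \<open>k\<close> prime to
      \<open>q\<close>; together with \<open>y^q \<in> W\<close> this gives
      \<open>y \<in> H\<close>.\<close>
    let ?S = "{M. subgroup M G \<and> W \<subseteq> M \<and> x \<notin> M}"
    have "?S \<subseteq> Pow (carrier G)" by (auto dest: subgroup.subset)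
    then have "finite ?S" using finite_carrier by (meson finite_Pow_iff finite_subset)
    moreover have "W \<in> ?S" using W xW by simp
    ultimately obtain M where M: "M \<in> ?S" "\<forall>H\<in>?S. M \<subseteq> H \<longrightarrow> M = H"
      using finite_has_maximal2[of ?S W] by (auto simp del: mem_Collect_eq)
    have MG: "subgroup M G" and WM: "W \<subseteq> M" and xM: "x \<notin> M" using M(1) by auto
    have Mn: "M \<lhd> G" using normal_if_contains_derived[OF MG] D FW WM by blast
    have "maximal_subgroup G M"
      unfolding maximal_subgroup_def
    proof (intro conjI allI impI)
      show "M \<noteq> carrier G" using xM xc by blast
      fix H assume H: "subgroup H G \<and> M \<subseteq> H"
      show "H = M \<or> H = carrier G"
      proof (rule disjCI)
        assume "H \<noteq> carrier G"
        then obtain y where y: "y \<in> carrier G" "y \<notin> H" using H subgroup.subset by blast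
        show "H = M"
        proof (rule ccontr)
          assume "H \<noteq> M"
          then have xH: "x \<in> H" using M(2) H WM by blast
          have gen: "subgroup (generate G {y}) G" using y by (intro generate_is_subgroup) simp
          have SG: "subgroup (M <#> generate G {y}) G" using mult_norm_subgroup[OF Mn gen] .
          have "y \<in> M <#> generate G {y}"
            using subset_set_mult(2)[OF MG gen] generate.incl[of y "{y}"] by blast
          then have "x \<in> M <#> generate G {y}"
            using M(2) SG subset_set_mult(1)[OF MG gen] WM y(2) H by blast
          then obtain m k where mk: "m \<in> M" "x = m \<otimes> y [^] (k::int)"
            using generate_pow[OF y(1)] by (auto elim!: set_multE)
          have mc: "m \<in> carrier G" using MG mk(1) by (rule subgroup.mem_carrier)
          have "y [^] k = inv m \<otimes> x" using mk mc y(1) by simp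
          then have ykH: "y [^] k \<in> H"
            using H mk(1) xH by (auto intro: subgroup.m_closed subgroup.m_inv_closed)
          have "\<not> int q dvd k"
          proof
            assume "int q dvd k"
            then obtain j where j: "k = j * int q" by (metis dvdE mult.commute)
            have "y [^] k = (y [^] j) [^] q" using y(1) by (simp add: j int_pow_pow flip: int_pow_int)
            then have "y [^] k \<in> M" using powW[of "y [^] j"] y(1) WM by auto
            then show False using mk MG xM by (auto intro: subgroup.m_closed)
          qed
          then have "coprime (int q) k" using q by (simp add: prime_imp_coprime)
          then obtain u v where uv: "u * int q + v * k = 1" using bezout_int[of "int q" k] by auto
          have "y [^] int q \<in> H" using powW[OF y(1)] WM H by (auto simp: int_pow_int)
          then have "(y [^] int q) [^] u \<otimes> (y [^] k) [^] v \<in> H"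
            using H ykH by (blast intro: subgroup.m_closed subgroup_int_pow_closed)
          also have "(y [^] int q) [^] u \<otimes> (y [^] k) [^] v = y [^] (u * int q + v * k)"
            using y(1) by (simp add: int_pow_mult int_pow_pow mult.commute)
          finally show False using uv y by simp
        qed
      qed
    qed fact
    then have "frattini_over F \<subseteq> M" using FW WM by (intro frattini_over_subset) auto
    then show False using frat x(1) xM by blast
  qed
  then show thesis using that by (auto simp: W_def)
qed

text \<open>If \<open>G/F\<close> is abelian, \<open>power_preimage radical_order F\<close> is the
  preimage of its socle. One squarefree exponent, the product of the primes dividing
  \<open>order G\<close>, serves every \<open>F\<close>.\<close>

definition radical_order :: nat where
  "radical_order = \<Prod>(prime_factors (order G))"

lemma radical_order_factor:
  assumes q: "Factorial_Ring.prime q" "q dvd order G"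
  obtains m where "radical_order = q * m" "coprime q m"
proof -
  have "order G \<noteq> 0" using finite_carrier order_gt_0_iff_finite by simp
  then have "q \<in> prime_factors (order G)" using q by (simp add: in_prime_factors_iff)
  then have "radical_order = q * \<Prod>(prime_factors (order G) - {q})"
    unfolding radical_order_def by (simp add: prod.remove)
  moreover have "coprime q (\<Prod>(prime_factors (order G) - {q}))"
    using q(1) by (intro prod_coprime_right) (auto simp: in_prime_factors_iff primes_coprime)
  ultimately show thesis by (rule that)
qed

lemma prime_order_element:
  assumes F: "F \<lhd> G" and z: "z \<in> carrier G" "z \<notin> F"
  obtains q k where "Factorial_Ring.prime (q::nat)" "q dvd order G" "z [^] (k::nat) \<notin> F" "(z [^] k) [^] q \<in> F"
proof -
  have FG: "subgroup F G" using F by (rule normal_imp_subgroup)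
  have "z [^] order G \<in> F" using pow_order_eq_1[OF z(1)] subgroup.one_closed[OF FG] by simp
  moreover have "0 < order G" using finite_carrier order_gt_0_iff_finite by blast
  ultimately show thesis using prime_power_outside[OF FG z] that by blast
qed

text \<open>In the abelian group \<open>G/F\<close> the socle and the quotient by the Frattini subgroup have the same
  length. Passing from \<open>F\<close> to a Frattini factor \<open>N\<close> enlarges the socle, since a generator of
  \<open>N/F\<close> is a \<open>q\<close>-th power.\<close>
lemma unit_length_le_abelian:
  assumes "F \<lhd> G" "derived G (carrier G) \<subseteq> F"
  shows "clen F \<le> dlen F + clen (power_preimage radical_order F)"
  using assms
proof (induct "card (carrier G) - card F" arbitrary: F rule: less_induct)
  case less
  let ?P = "power_preimage radical_order"
  show ?case
  proof (cases "F = carrier G")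
    case True
    then have "power_preimage radical_order F = F" by (auto simp: power_preimage_def)
    then show ?thesis by simp
  next
    case False
    then have "F \<subset> carrier G" using normal_subset[OF less(2)] by blast
    then obtain N where N: "chief_factor F N"
      using chief_factor_above[OF less(2) normal_self] by blast
    note cf = chief_factorD(1-3)[OF N]
    have DN: "derived G (carrier G) \<subseteq> N" using less(3) cf(3) by blast
    have IH: "clen N \<le> dlen N + clen (?P N)"
      using less(1)[OF card_normal_less[OF cf(2,3)] cf(2) DN] .
    have P: "?P F \<lhd> G" "?P N \<lhd> G" using power_preimage_normal less(2,3) cf(2) DN by auto
    have PFN: "?P F \<subseteq> ?P N" using cf(3) by (auto simp: power_preimage_def)
    show ?thesis
    proof (cases "N \<subseteq> frattini_over F")
      \<comment> \<open>Both lengths drop by one, and the preimage of the socle can only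
        grow.\<close>
      case False
      then show ?thesis
        using IH unit_length_mono[OF P PFN] unit_length_step[OF N] non_frattini_length_step[OF N] by simp
    next
      case True
      obtain z where z: "z \<in> N" "z \<notin> F" using cf(3) by blast
      obtain q k where q: "Factorial_Ring.prime (q::nat)" "q dvd order G" "z [^] (k::nat) \<notin> F" "(z [^] k) [^] q \<in> F"
        using prime_order_element[OF cf(1) _ z(2)] z(1) normal_subset[OF cf(2)] by blast
      define x where "x = z [^] k"
      have x: "x \<in> N" "x \<notin> F" "x [^] q \<in> F"
        using q pow_subgroup[OF normal_imp_subgroup[OF cf(2)] z(1)] by (auto simp: x_def)
      have xc: "x \<in> carrier G" using x(1) normal_subset[OF cf(2)] by blast
      obtain y where y: "y \<in> carrier G" "F #> (y [^] q) = F #> x"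
        using frattini_factor_prime_power[OF N less(3) True x(1,2) q(1)] by blast
      have yc: "y [^] q \<in> carrier G" using y(1) by simp
      have yF: "y [^] q \<notin> F" using y(2) x(2) rcoset_one_iff[OF cf(1) xc] rcoset_one_iff[OF cf(1) yc] by simp
      have yq: "(y [^] q) [^] q \<in> F"
        using y(2) x(3) rcoset_pow_iff[OF cf(1) xc, of q] rcoset_pow_iff[OF cf(1) yc, of q] by simp
      have "y [^] q \<otimes> inv x \<in> N" using rcoset_eq_iff[OF cf(1) yc xc] y(2) cf(3) by blast
      then have "y [^] q \<otimes> inv x \<otimes> x \<in> N"
        using x(1) normal_imp_subgroup[OF cf(2)] by (blast intro: subgroup.m_closed)
      then have yN: "y [^] q \<in> N" using xc yc by (simp add: m_assoc)
      \<comment> \<open>Squarefreeness enters here as \<open>coprime q m\<close>. The power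
        \<open>y^radical_order = (y^q)^m\<close> lies in \<open>N\<close>; if it lay in
        \<open>F\<close>, so would \<open>y^q\<close>, whose q-th power is in
        \<open>F\<close>.\<close>
      obtain m where m: "radical_order = q * m" "coprime q m" using radical_order_factor[OF q(1,2)] by blast
      have ym: "y [^] radical_order = (y [^] q) [^] m" using y(1) by (simp add: m(1) nat_pow_pow)
      have "y \<in> ?P N"
        using y(1) pow_subgroup[OF normal_imp_subgroup[OF cf(2)] yN] ym by (simp add: power_preimage_def)
      moreover have "y \<notin> ?P F"
      proof
        assume "y \<in> ?P F"
        then have "(y [^] q) [^] m \<in> F" using ym by (simp add: power_preimage_def)
        then show False
          using coprime_powers_mem[OF normal_imp_subgroup[OF cf(1)] yc m(2) yq] yF by blast
      qed
      ultimately have "clen (?P N) < clen (?P F)"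
        using PFN by (intro unit_length_less P) blast
      then show ?thesis using IH unit_length_step[OF N] non_frattini_length_step[OF N] True by simp
    qed
  qed
qed

text \<open>Intersecting with a \<open>C i\<close> that does not contain \<open>K\<close> removes at
  least one chief factor from \<open>K/F\<close>, so a greedy choice uses at most as many members as
  \<open>K/F\<close> has factors.\<close>

lemma normal_family_cut:
  assumes F: "F \<lhd> G" and C: "\<And>i. i \<in> I \<Longrightarrow> C i \<lhd> G" "\<And>i. i \<in> I \<Longrightarrow> F \<subseteq> C i"
    and meet: "carrier G \<inter> (\<Inter>i\<in>I. C i) \<subseteq> F" and K: "K \<lhd> G" "F \<subseteq> K"
  shows "\<exists>J. finite J \<and> J \<subseteq> I \<and> card J + clen K \<le> clen F \<and> K \<inter> (\<Inter>i\<in>J. C i) \<subseteq> F"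
  using K
proof (induct "card K" arbitrary: K rule: less_induct)
  case less
  show ?case
  proof (cases "K = F")
    case True
    then show ?thesis by (intro exI[of _ "{}"]) simp
  next
    case False
    then obtain i where i: "i \<in> I" "\<not> K \<subseteq> C i"
      using meet less(3) normal_subset[OF less(2)] by blast
    define K' where "K' = K \<inter> C i"
    have K': "K' \<lhd> G" "F \<subseteq> K'" "K' \<subset> K"
      using normal_subgroup_intersect[OF less(2) C(1)[OF i(1)]] less(3) C(2)[OF i(1)] i(2) by (auto simp: K'_def)
    have "card K' < card K" using K'(3) finite_normal[OF less(2)] by (rule psubset_card_mono[rotated])
    then obtain J where J: "finite J" "J \<subseteq> I" "card J + clen K' \<le> clen F" "K' \<inter> (\<Inter>i\<in>J. C i) \<subseteq> F"
      using less(1)[OF _ K'(1,2)] by blast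
    have "card (insert i J) + clen K \<le> clen F"
      using J(1,3) unit_length_less[OF K'(1) less(2) K'(3)] card_insert_le_m1[of "Suc (card J)" J i] by simp
    moreover have "K \<inter> (\<Inter>i\<in>insert i J. C i) \<subseteq> F" using J(4) by (auto simp: K'_def)
    ultimately show ?thesis using J(1,2) i(1) by (intro exI[of _ "insert i J"]) blast
  qed
qed

text \<open>A nontrivial subgroup of \<open>G/F\<close> contains an element of prime order, hence
  meets the socle. So it suffices to cut the preimage of the socle down to \<open>F\<close>, and its
  length over \<open>F\<close> is at most \<open>dlen F\<close>.\<close>

lemma normal_family_cut_abelian:
  assumes F: "F \<lhd> G" and D: "derived G (carrier G) \<subseteq> F"
    and C: "\<And>i. i \<in> I \<Longrightarrow> C i \<lhd> G" "\<And>i. i \<in> I \<Longrightarrow> F \<subseteq> C i"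
    and meet: "carrier G \<inter> (\<Inter>i\<in>I. C i) \<subseteq> F"
  obtains J where "finite J" "J \<subseteq> I" "card J \<le> dlen F" "carrier G \<inter> (\<Inter>i\<in>J. C i) \<subseteq> F"
proof -
  let ?P = "power_preimage radical_order F"
  have "\<exists>J. finite J \<and> J \<subseteq> I \<and> card J + clen ?P \<le> clen F \<and> ?P \<inter> (\<Inter>i\<in>J. C i) \<subseteq> F"
    by (rule normal_family_cut[OF F _ _ meet power_preimage_normal[OF F D]]) (use C in auto)
  then obtain J where J: "finite J" "J \<subseteq> I" "card J + clen ?P \<le> clen F" "?P \<inter> (\<Inter>i\<in>J. C i) \<subseteq> F"
    by blast
  have "card J \<le> dlen F" using J(3) unit_length_le_abelian[OF F D] by simp
  moreover have "z \<in> F" if z: "z \<in> carrier G" "\<And>i. i \<in> J \<Longrightarrow> z \<in> C i" for z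
  proof (rule ccontr)
    assume "z \<notin> F"
    then obtain q k where q: "Factorial_Ring.prime (q::nat)" "q dvd order G" "z [^] (k::nat) \<notin> F" "(z [^] k) [^] q \<in> F"
      using prime_order_element[OF F z(1)] by blast
    obtain m where m: "radical_order = q * m" using radical_order_factor[OF q(1,2)] by blast
    have "(z [^] k) [^] radical_order = ((z [^] k) [^] q) [^] m" using z(1) by (simp add: m nat_pow_pow mult.assoc)
    then have "z [^] k \<in> ?P"
      using pow_subgroup[OF normal_imp_subgroup[OF F] q(4)] z(1) by (simp add: power_preimage_def)
    moreover have "z [^] k \<in> C i" if "i \<in> J" for i
      using pow_subgroup normal_imp_subgroup[OF C(1)] z(2) that J(2) by blast
    ultimately show False using J(4) q(3) by blast
  qed
  ultimately have "card J \<le> dlen F" "carrier G \<inter> (\<Inter>i\<in>J. C i) \<subseteq> F" by auto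
  with J(1,2) show thesis by (rule that)
qed

text \<open>\<open>F/T\<close> is a product of complemented minimal normal subgroups \<open>N/T\<close>, and the chosen maximal
  subgroups meet in a complement of \<open>F\<close> modulo \<open>T\<close>.\<close>
definition complement_data :: "'a set \<Rightarrow> ('a set \<times> 'a set) set \<Rightarrow> 'a set \<Rightarrow> bool" where
  "complement_data T \<P> F \<longleftrightarrow> finite \<P> \<and> F \<lhd> G \<and> T \<subseteq> F \<and>
     (\<forall>(N, M)\<in>\<P>. chief_factor T N \<and> maximal_subgroup G M \<and> T \<subseteq> M \<and> \<not> N \<subseteq> M \<and> N \<subseteq> F) \<and>
     F <#> (carrier G \<inter> \<Inter> (snd ` \<P>)) = carrier G \<and> carrier G \<inter> \<Inter> (snd ` \<P>) \<inter> F = T \<and>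
     F \<subseteq> centralizer_mod T F \<and> card \<P> + dlen F \<le> dlen T \<and>
     (\<forall>x\<in>carrier G. (\<forall>(N, M)\<in>\<P>. x \<in> centralizer_mod T N) \<longrightarrow> x \<in> centralizer_mod T F)"

text \<open>As long as the complement \<open>D\<close> contains elements outside \<open>T\<close>
  that centralise \<open>F\<close>, these form with \<open>T\<close> a subgroup \<open>Z\<close>
  that is normal because \<open>G = F D\<close>. A minimal normal \<open>N/T\<close> in
  \<open>Z/T\<close> has a complement \<open>M\<close>, since \<open>T = frattini_over T\<close>,
  and \<open>F N\<close>, \<open>M \<inter> D\<close> replace \<open>F\<close>,
  \<open>D\<close>.\<close>

lemma complement_data_extend:
  assumes T: "T \<lhd> G" "frattini_over T = T" and d: "complement_data T \<P> F"
    and Z: "\<not> carrier G \<inter> \<Inter> (snd ` \<P>) \<inter> centralizer_mod T F \<subseteq> T"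
  shows "\<exists>\<P>' F'. complement_data T \<P>' F' \<and> F \<subset> F'"
proof -
  define D where "D = carrier G \<inter> \<Inter> (snd ` \<P>)"
  have fin: "finite \<P>" and F: "F \<lhd> G" and TF: "T \<subseteq> F"
    and FD: "F <#> D = carrier G" and DF: "D \<inter> F = T" and Fab: "F \<subseteq> centralizer_mod T F"
    and card: "card \<P> + dlen F \<le> dlen T"
    using d by (simp_all add: complement_data_def D_def)
  have P: "\<And>N M. (N, M) \<in> \<P> \<Longrightarrow> chief_factor T N \<and> maximal_subgroup G M \<and> T \<subseteq> M \<and> \<not> N \<subseteq> M \<and> N \<subseteq> F"
    and cen: "\<And>x. x \<in> carrier G \<Longrightarrow> (\<And>N M. (N, M) \<in> \<P> \<Longrightarrow> x \<in> centralizer_mod T N) \<Longrightarrow> x \<in> centralizer_mod T F"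
    using d unfolding complement_data_def by (auto simp only: split_paired_all split_paired_Ball_Sigma Ball_def prod.case)
  have TG: "subgroup T G" and FG: "subgroup F G" using T(1) F normal_imp_subgroup by auto
  have Fc: "F \<subseteq> carrier G" using FG by (rule subgroup.subset)
  have DG: "subgroup D G"
  proof -
    have "subgroup (\<Inter> (insert (carrier G) (snd ` \<P>))) G"
      using P subgroup_self maximal_subgroupD(1) by (intro subgroups_Inter) auto
    then show ?thesis by (simp add: D_def)
  qed
  have Dc: "D \<subseteq> carrier G" using DG by (rule subgroup.subset)
  define Z where "Z = D \<inter> centralizer_mod T F"
  have Cn: "centralizer_mod T F \<lhd> G" using centralizer_mod_normal'[OF T(1) F] .
  have ZG: "subgroup Z G" unfolding Z_def using DG normal_imp_subgroup[OF Cn] by (rule subgroups_Inter_pair)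
  have Zc: "Z \<subseteq> carrier G" using ZG by (rule subgroup.subset)
  have TZ: "T \<subseteq> Z" using DF normal_subset_centralizer_mod[OF T(1) Fc] by (auto simp: Z_def)
  have FZ: "F \<subseteq> centralizer_mod T Z" by (rule centralizer_mod_sym[OF TG Zc Fc]) (auto simp: Z_def)
  have Zn: "Z \<lhd> G"
  proof (rule normal_if_supplemented[OF ZG FD FZ TZ Dc])
    show "m \<otimes> h \<otimes> inv m \<in> Z" if "m \<in> D" "h \<in> Z" for m h
      using that normal_invE(2)[OF Cn, of m h] Dc DG
      by (auto simp: Z_def intro: subgroup.m_closed subgroup.m_inv_closed)
  qed
  have "T \<subset> Z" using Z TZ by (auto simp: Z_def D_def)
  then obtain N where N: "chief_factor T N" "N \<subseteq> Z" using chief_factor_above[OF T(1) Zn] by blast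
  note cf = chief_factorD(1-3)[OF N(1)]
  have NG: "subgroup N G" using cf(2) by (rule normal_imp_subgroup)
  have Nc: "N \<subseteq> carrier G" using NG by (rule subgroup.subset)
  have ND: "N \<subseteq> D" using N(2) by (auto simp: Z_def)
  have "\<not> N \<subseteq> frattini_over T" using T(2) cf(3) by blast
  then obtain M where M: "maximal_subgroup G M" "T \<subseteq> M" "\<not> N \<subseteq> M"
    using Nc by (rule supplement_exists)
  have MG: "subgroup M G" using M(1) by (rule maximal_subgroupD)
  have meet: "M \<inter> N = T" using chief_inter_maximal[OF N(1) chief_abelian[OF N(1)] M] .
  define F' where "F' = F <#> N"
  define D' where "D' = M \<inter> D"
  define \<P>' where "\<P>' = insert (N, M) \<P>"
  have D'G: "subgroup D' G" unfolding D'_def using MG DG by (rule subgroups_Inter_pair)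
  have D'_eq: "D' = carrier G \<inter> \<Inter> (snd ` \<P>')" by (auto simp: D'_def D_def \<P>'_def)
  have F'n: "F' \<lhd> G" unfolding F'_def using F cf(2) by (rule normal_set_mult)
  have F'G: "subgroup F' G" using F'n by (rule normal_imp_subgroup)
  have F'c: "F' \<subseteq> carrier G" using F'G by (rule subgroup.subset)
  have FF': "F \<subseteq> F'" "N \<subseteq> F'" unfolding F'_def using subset_set_mult[OF FG NG] by auto
  have FN: "F \<inter> N = T" using DF ND TF cf(3) by blast
  have chief: "chief_factor F F'" unfolding F'_def using chief_factor_transfer[OF N(1) F TF FN] .
  have new: "(N, M) \<notin> \<P>"
  proof
    assume "(N, M) \<in> \<P>"
    then have "D \<subseteq> M" by (auto simp: D_def)
    then show False using ND M(3) by blast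
  qed
  have D_eq: "D = N <#> D'"
    using dedekind[OF NG MG DG ND] maximal_mult_normal[OF M(1) cf(2) M(3)] Dc by (auto simp: D'_def)
  have F'D': "F' <#> D' = carrier G"
    using set_mult_assoc[OF Fc Nc subgroup.subset[OF D'G]] D_eq FD by (simp add: F'_def)
  have D'F': "D' \<inter> F' = T"
  proof (intro equalityI subsetI)
    fix x assume x: "x \<in> D' \<inter> F'"
    then obtain f n where fn: "f \<in> F" "n \<in> N" "x = f \<otimes> n" by (auto simp: F'_def elim: set_multE)
    have c: "f \<in> carrier G" "n \<in> carrier G" using fn Fc Nc by auto
    have "x \<otimes> inv n \<in> D" using x fn(2) ND DG by (auto simp: D'_def intro: subgroup.m_closed subgroup.m_inv_closed)
    moreover have "x \<otimes> inv n = f" using fn c by (simp add: m_assoc)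
    ultimately have "f \<in> N" using fn(1) DF cf(3) by blast
    then have "x \<in> N" using fn NG by (auto intro: subgroup.m_closed)
    then show "x \<in> T" using x meet by (auto simp: D'_def)
  next
    fix x assume "x \<in> T"
    then show "x \<in> D' \<inter> F'" using M(2) DF FF'(1) TF by (auto simp: D'_def)
  qed
  \<comment> \<open>Centralising \<open>F\<close> and \<open>N\<close> passes to their product. This
    preserves the last clause of \<open>complement_data\<close>, which stands in for
    \<open>F\<close> being the product of the listed \<open>N\<close>.\<close>
  have cenF': "x \<in> centralizer_mod T F'"
    if x: "x \<in> carrier G" "x \<in> centralizer_mod T F" "x \<in> centralizer_mod T N" for x
  proof -
    have "F \<subseteq> centralizer_mod T {x}" "N \<subseteq> centralizer_mod T {x}"
      using centralizer_mod_sym[OF TG _ Fc, of "{x}"] centralizer_mod_sym[OF TG _ Nc, of "{x}"] x by auto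
    then have "F' \<subseteq> centralizer_mod T {x}"
      unfolding F'_def using centralizer_mod_set_mult[OF T(1)] x(1) by simp
    then show ?thesis using centralizer_mod_sym[OF TG F'c, of "{x}"] x(1) by simp
  qed
  have NF: "N \<subseteq> centralizer_mod T F" using N(2) by (auto simp: Z_def)
  have FN': "F \<subseteq> centralizer_mod T N" using centralizer_mod_sym[OF TG Nc Fc NF] .
  have "F' \<subseteq> centralizer_mod T F" "F' \<subseteq> centralizer_mod T N"
    unfolding F'_def
    using centralizer_mod_set_mult[OF T(1) Fc Fab NF] centralizer_mod_set_mult[OF T(1) Nc FN' chief_abelian[OF N(1)]] by auto
  then have F'ab: "F' \<subseteq> centralizer_mod T F'" using cenF' F'c by blast
  \<comment> \<open>The new factor pays for the new \<open>M\<close>, so it has to be non-Frattini: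
    a maximal subgroup above \<open>F D'\<close> contains \<open>F\<close>, but not
    \<open>F'\<close>, because \<open>F' D' = G\<close>.\<close>
  have "\<not> F' \<subseteq> frattini_over F"
  proof -
    have "F <#> D' \<noteq> carrier G"
    proof
      assume eq: "F <#> D' = carrier G"
      have D'D: "D' \<subseteq> D" by (auto simp: D'_def)
      have "D = D' <#> (F \<inter> D)"
        using dedekind[OF D'G FG DG D'D] eq commut_normal[OF D'G F] Dc by auto
      also have "\<dots> \<subseteq> M" using DF M(2) by (intro set_mult_least[OF MG]) (auto simp: D'_def)
      finally show False using ND M(3) by blast
    qed
    then obtain S where S: "maximal_subgroup G S" "F <#> D' \<subseteq> S"
      using maximal_subgroup_above[OF mult_norm_subgroup[OF F D'G]] by blast
    have SG: "subgroup S G" using S(1) by (rule maximal_subgroupD)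
    have FS: "F \<subseteq> S" "D' \<subseteq> S" using subset_set_mult[OF FG D'G] S(2) by auto
    have "\<not> F' \<subseteq> S"
      using set_mult_least[OF SG _ FS(2), of F'] F'D' maximal_subgroupD(2)[OF S(1)] subgroup.subset[OF SG] by auto
    then show ?thesis using frattini_over_subset[OF S(1) FS(1)] by blast
  qed
  then have "card \<P>' + dlen F' \<le> dlen T"
    using card new fin non_frattini_length_step[OF chief] by (simp add: \<P>'_def)
  moreover have "\<forall>x\<in>carrier G. (\<forall>(N, M)\<in>\<P>'. x \<in> centralizer_mod T N) \<longrightarrow> x \<in> centralizer_mod T F'"
  proof (intro ballI impI)
    fix x assume x: "x \<in> carrier G" "\<forall>(N, M)\<in>\<P>'. x \<in> centralizer_mod T N"
    then have "x \<in> centralizer_mod T F" by (intro cen) (auto simp: \<P>'_def)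
    then show "x \<in> centralizer_mod T F'" using cenF' x by (simp add: \<P>'_def)
  qed
  moreover have "\<forall>(N', M')\<in>\<P>'. chief_factor T N' \<and> maximal_subgroup G M' \<and> T \<subseteq> M' \<and> \<not> N' \<subseteq> M' \<and> N' \<subseteq> F'"
  proof (rule ballI, clarify)
    fix N' M' assume "(N', M') \<in> \<P>'"
    then show "chief_factor T N' \<and> maximal_subgroup G M' \<and> T \<subseteq> M' \<and> \<not> N' \<subseteq> M' \<and> N' \<subseteq> F'"
      using P[of N' M'] FF' N(1) M by (auto simp: \<P>'_def)
  qed
  moreover have "finite \<P>'" using fin by (simp add: \<P>'_def)
  moreover have "T \<subseteq> F'" using TF FF'(1) by blast
  ultimately have "complement_data T \<P>' F'"
    unfolding complement_data_def D'_eq[symmetric]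
    using F'n F'D' D'F' F'ab by (intro conjI)
  then show ?thesis using chief_factorD(3)[OF chief] by blast
qed

lemma complement_data_maximal:
  assumes T: "T \<lhd> G" "frattini_over T = T"
  obtains \<P> F where "complement_data T \<P> F" "carrier G \<inter> \<Inter> (snd ` \<P>) \<inter> centralizer_mod T F \<subseteq> T"
proof -
  have Tc: "T \<subseteq> carrier G" using T(1) by (rule normal_subset)
  \<comment> \<open>The empty family has complement \<open>D = G\<close>; strict growth of
    \<open>F\<close> then bounds the number of extensions.\<close>
  have "complement_data T {} T"
    using T(1) Tc normal_subset_centralizer_mod[OF T(1)]
      commut_normal[OF subgroup_self T(1)] set_mult_carrier_idem[OF normal_imp_subgroup[OF T(1)]]
      centralizer_mod_sym[OF normal_imp_subgroup[OF T(1)] Tc order_refl normal_subset_centralizer_mod[OF T(1)]]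
    by (auto simp: complement_data_def)
  moreover have "\<exists>\<P>' F'. complement_data T \<P>' F' \<and> carrier G \<inter> \<Inter> (snd ` \<P>') \<inter> centralizer_mod T F' \<subseteq> T"
    if "complement_data T \<P> F" for \<P> F
    using that
  proof (induct "card (carrier G) - card F" arbitrary: \<P> F rule: less_induct)
    case less
    show ?case
    proof (cases "carrier G \<inter> \<Inter> (snd ` \<P>) \<inter> centralizer_mod T F \<subseteq> T")
      case False
      then obtain \<P>' F' where "complement_data T \<P>' F'" "F \<subset> F'"
        using complement_data_extend[OF T less(2)] by blast
      then show ?thesis using less(1)[OF card_normal_less] unfolding complement_data_def by blast
    qed (use less(2) in blast)
  qed
  ultimately show thesis using that by blast
qed

text \<open>Such an \<open>x\<close> centralises \<open>v\<close> modulo \<open>T\<close>. Its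
  conjugates differ from it by elements of \<open>G'\<close>, which centralise \<open>N/T\<close>,
  so they all centralise \<open>v\<close>; their set is invariant, and minimality extends this from
  \<open>v\<close> to \<open>N\<close>. Any \<open>v\<close> outside \<open>T\<close> therefore
  plays the part of a regular vector.\<close>

lemma conjugate_mem_centralizes:
  assumes c: "chief_factor T N" and cen: "N \<subseteq> centralizer_mod T (derived G (carrier G))"
    and M: "maximal_subgroup G M" "T \<subseteq> M" "\<not> N \<subseteq> M"
    and v: "v \<in> N" "v \<notin> T" and x: "x \<in> M" "x \<in> conjugate v M"
  shows "x \<in> centralizer_mod T N"
proof -
  note cf = chief_factorD(1-3)[OF c]
  have TG: "subgroup T G" using cf(1) by (rule normal_imp_subgroup)
  have MG: "subgroup M G" using M(1) by (rule maximal_subgroupD)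
  have xc: "x \<in> carrier G" using MG x(1) by (rule subgroup.mem_carrier)
  have Nc: "N \<subseteq> carrier G" using cf(2) by (rule normal_subset)
  have vc: "v \<in> carrier G" using v(1) Nc by blast
  define W where "W = centralizer_mod T {v}"
  have W: "subgroup W G" unfolding W_def using cf(1) vc by (intro centralizer_mod_subgroup) auto
  have "{v} \<subseteq> centralizer_mod T {x}"
    using conjugate_mem_commutes[OF c M v(1) x] vc by (simp add: centralizer_mod_def)
  then have xW: "x \<in> W" using centralizer_mod_sym[OF TG, of "{v}" "{x}"] vc xc by (simp add: W_def)
  have DW: "derived G (carrier G) \<subseteq> W"
    using centralizer_mod_sym[OF TG _ derived_in_carrier[OF order_refl], of "{v}"] cen v(1) vc by (auto simp: W_def)
  define S where "S = (\<lambda>g. g \<otimes> x \<otimes> inv g) ` carrier G"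
  have Sc: "S \<subseteq> carrier G" using xc by (auto simp: S_def)
  have "S \<subseteq> W"
  proof
    fix s assume "s \<in> S"
    then obtain g where g: "g \<in> carrier G" "s = g \<otimes> x \<otimes> inv g" by (auto simp: S_def)
    have "(g \<otimes> x \<otimes> inv g \<otimes> inv x) \<otimes> x \<in> W"
      using commutator_in_derived[OF g(1) xc] DW xW W by (blast intro: subgroup.m_closed)
    then show "s \<in> W" using conjugate_decompose[OF g(1) xc] g(2) by simp
  qed
  then have "v \<in> centralizer_mod T S"
    using centralizer_mod_sym[OF TG Sc, of "{v}"] vc by (simp add: W_def)
  moreover have "y \<otimes> s \<otimes> inv y \<in> S" if ys: "y \<in> carrier G" "s \<in> S" for y s
  proof -
    obtain g where g: "g \<in> carrier G" "s = g \<otimes> x \<otimes> inv g" using ys(2) by (auto simp: S_def)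
    have "y \<otimes> s \<otimes> inv y = (y \<otimes> g) \<otimes> x \<otimes> inv (y \<otimes> g)"
      using g ys(1) xc by (simp add: m_assoc inv_mult_group)
    then show ?thesis using g(1) ys(1) by (auto simp: S_def)
  qed
  ultimately have "N \<subseteq> centralizer_mod T S" using chief_centralizer_cases[OF c Sc] v by blast
  then have "S \<subseteq> centralizer_mod T N" using centralizer_mod_sym[OF TG Nc Sc] by blast
  moreover have "x \<in> S" unfolding S_def using xc by (intro image_eqI[of _ _ \<one>]) auto
  ultimately show ?thesis by blast
qed

text \<open>The complements collected in \<P> cost at most \<open>dlen T - dlen F\<close>, and the
  conjugates, indexed by \<open>J\<close>, at most \<open>dlen F\<close>.\<close>

theorem maximal_family_non_frattini_length:
  assumes nil: "nilpotent (G\<lparr>carrier := derived G (carrier G)\<rparr>)"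
    and T: "T \<lhd> G" "frattini_over T = T"
  shows "\<exists>\<M>. finite \<M> \<and> (\<forall>M\<in>\<M>. maximal_subgroup G M) \<and> card \<M> \<le> dlen T \<and> carrier G \<inter> \<Inter> \<M> \<subseteq> T"
proof -
  let ?D' = "derived G (carrier G)"
  note cen = nilpotent_derived_centralizes_chief_factor[OF nil]
  obtain \<P> F where d: "complement_data T \<P> F" and max: "carrier G \<inter> \<Inter> (snd ` \<P>) \<inter> centralizer_mod T F \<subseteq> T"
    using complement_data_maximal[OF T] by blast
  define D where "D = carrier G \<inter> \<Inter> (snd ` \<P>)"
  have fin: "finite \<P>" and F: "F \<lhd> G" and TF: "T \<subseteq> F"
    and FD: "F <#> D = carrier G" and DF: "D \<inter> F = T" and Fab: "F \<subseteq> centralizer_mod T F"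
    and card: "card \<P> + dlen F \<le> dlen T"
    using d by (simp_all add: complement_data_def D_def)
  have P: "\<And>N M. (N, M) \<in> \<P> \<Longrightarrow> chief_factor T N \<and> maximal_subgroup G M \<and> T \<subseteq> M \<and> \<not> N \<subseteq> M \<and> N \<subseteq> F"
    and cenF: "\<And>x. x \<in> carrier G \<Longrightarrow> (\<And>N M. (N, M) \<in> \<P> \<Longrightarrow> x \<in> centralizer_mod T N) \<Longrightarrow> x \<in> centralizer_mod T F"
    using d unfolding complement_data_def by (auto simp only: split_paired_all split_paired_Ball_Sigma Ball_def prod.case)
  have TG: "subgroup T G" and FG: "subgroup F G" using T(1) F normal_imp_subgroup by auto
  have Fc: "F \<subseteq> carrier G" using FG by (rule subgroup.subset)
  have DG: "subgroup D G"
  proof -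
    have "subgroup (\<Inter> (insert (carrier G) (snd ` \<P>))) G"
      using P subgroup_self maximal_subgroupD(1) by (intro subgroups_Inter) auto
    then show ?thesis by (simp add: D_def)
  qed
  \<comment> \<open>Since \<open>G = F D\<close>, the centraliser is \<open>F\<close> times its part
    in \<open>D\<close>, and that part lies in \<open>T\<close> because the data admit no
    extension.\<close>
  have CF: "centralizer_mod T F \<subseteq> F"
  proof -
    have CG: "subgroup (centralizer_mod T F) G" using T(1) Fc by (rule centralizer_mod_subgroup)
    have "centralizer_mod T F = F <#> (D \<inter> centralizer_mod T F)"
      using dedekind[OF FG DG CG Fab] FD subgroup.subset[OF CG] by auto
    also have "\<dots> \<subseteq> F" using max TF by (intro set_mult_least[OF FG]) (auto simp: D_def)
    finally show ?thesis .
  qed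
  have D'c: "?D' \<subseteq> carrier G" by (rule derived_in_carrier) simp
  have D'F: "?D' \<subseteq> F"
  proof
    fix x assume x: "x \<in> ?D'"
    have "x \<in> centralizer_mod T N" if NM: "(N, M) \<in> \<P>" for N M
    proof -
      have c: "chief_factor T N" using P[OF NM] by blast
      show ?thesis
        using centralizer_mod_sym[OF TG normal_subset[OF chief_factorD(2)[OF c]] D'c cen[OF c]] x by blast
    qed
    then have "x \<in> centralizer_mod T F" using x D'c by (intro cenF) auto
    then show "x \<in> F" using CF by blast
  qed
  \<comment> \<open>The centralisers of the listed factors contain \<open>F\<close>, hence
    \<open>G'\<close>, and meet in \<open>F\<close> by \<open>cenF\<close> and \<open>CF\<close>; in
    the abelian group \<open>G/F\<close> at most \<open>dlen F\<close> of them are needed.\<close>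
  have "\<exists>J. finite J \<and> J \<subseteq> \<P> \<and> card J \<le> dlen F \<and> carrier G \<inter> (\<Inter>i\<in>J. centralizer_mod T (fst i)) \<subseteq> F"
  proof (rule normal_family_cut_abelian[OF F D'F, of \<P> "\<lambda>i. centralizer_mod T (fst i)"])
    fix i assume "i \<in> \<P>"
    then obtain N M where i: "i = (N, M)" "(N, M) \<in> \<P>" by (cases i) auto
    have c: "chief_factor T N" and NF: "N \<subseteq> F" using P[OF i(2)] by blast+
    show "centralizer_mod T (fst i) \<lhd> G"
      using centralizer_mod_normal'[OF T(1) chief_factorD(2)[OF c]] by (simp add: i)
    show "F \<subseteq> centralizer_mod T (fst i)"
      using Fab centralizer_mod_antimono[OF NF] by (auto simp: i)
  next
    show "carrier G \<inter> (\<Inter>i\<in>\<P>. centralizer_mod T (fst i)) \<subseteq> F"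
    proof
      fix x assume x: "x \<in> carrier G \<inter> (\<Inter>i\<in>\<P>. centralizer_mod T (fst i))"
      then have "x \<in> centralizer_mod T F" by (intro cenF) force+
      then show "x \<in> F" using CF by blast
    qed
  qed blast
  then obtain J where J: "finite J" "J \<subseteq> \<P>" "card J \<le> dlen F"
      "carrier G \<inter> (\<Inter>i\<in>J. centralizer_mod T (fst i)) \<subseteq> F" by blast
  have "\<forall>i\<in>J. \<exists>v. v \<in> fst i \<and> v \<notin> T"
  proof
    fix i assume "i \<in> J"
    then obtain N M where i: "i = (N, M)" "(N, M) \<in> \<P>" using J(2) by (cases i) auto
    then show "\<exists>v. v \<in> fst i \<and> v \<notin> T" using chief_factorD(3)[of T N] P[OF i(2)] by auto
  qed
  then obtain v where v: "\<And>i. i \<in> J \<Longrightarrow> v i \<in> fst i \<and> v i \<notin> T" by metis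
  \<comment> \<open>The complements confine the intersection to \<open>D\<close>, the conjugates to
    the centralisers chosen by \<open>J\<close>, hence to \<open>F\<close>; and
    \<open>D \<inter> F = T\<close>.\<close>
  define \<N> where "\<N> = snd ` \<P> \<union> (\<lambda>i. conjugate (v i) (snd i)) ` J"
  have "card \<N> \<le> card (snd ` \<P>) + card ((\<lambda>i. conjugate (v i) (snd i)) ` J)"
    unfolding \<N>_def by (rule card_Un_le)
  also have "\<dots> \<le> card \<P> + card J" using fin J(1) by (intro add_mono card_image_le)
  also have "\<dots> \<le> dlen T" using J(3) card by simp
  finally have "card \<N> \<le> dlen T" .
  moreover have "finite \<N>" using fin J(1) by (simp add: \<N>_def)
  moreover have "maximal_subgroup G M" if MN: "M \<in> \<N>" for M
  proof -
    consider i where "i \<in> \<P>" "M = snd i" | i where "i \<in> J" "M = conjugate (v i) (snd i)"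
      using MN unfolding \<N>_def by blast
    then show ?thesis
    proof cases
      case (1 i)
      then show ?thesis using P[of "fst i" "snd i"] by simp
    next
      case (2 i)
      have i: "(fst i, snd i) \<in> \<P>" using 2(1) J(2) by auto
      have "v i \<in> carrier G" using v[OF 2(1)] P[OF i] Fc by blast
      then show ?thesis using P[OF i] maximal_conjugate 2(2) by blast
    qed
  qed
  moreover have "carrier G \<inter> \<Inter> \<N> \<subseteq> T"
  proof
    fix x assume x: "x \<in> carrier G \<inter> \<Inter> \<N>"
    have xD: "x \<in> D" using x by (auto simp: D_def \<N>_def)
    have "x \<in> centralizer_mod T (fst i)" if i: "i \<in> J" for i
    proof -
      have iP: "(fst i, snd i) \<in> \<P>" using i J(2) by auto
      have "x \<in> snd i" using x i J(2) by (auto simp: \<N>_def)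
      moreover have "x \<in> conjugate (v i) (snd i)" using x i by (auto simp: \<N>_def)
      ultimately show ?thesis
        using P[OF iP] v[OF i] cen[of T "fst i"] conjugate_mem_centralizes[of T "fst i" "snd i" "v i" x] by blast
    qed
    then have "x \<in> F" using J(4) x by blast
    then show "x \<in> T" using xD DF by blast
  qed
  ultimately show ?thesis by blast
qed

lemma chief_length_series:
  assumes "chief_series G N k"
  shows "clen {\<one>} = k" "dlen {\<one>} \<le> non_frattini_count G N k"
proof -
  show "clen {\<one>} = k"
    using chief_length_eq[OF diamond_unit_weight chief_series_weight[OF assms]] by (simp add: unit_weight_def)
  have "dlen {\<one>} = (\<Sum>i<k. non_frattini_weight (N i) (N (Suc i)))"
    using chief_length_eq[OF diamond_non_frattini_weight[OF solvable_G] chief_series_weight[OF assms]] .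
  also have "\<dots> = (\<Sum>i<k. if N (Suc i) \<subseteq> frattini_over (N i) then 0 else 1)"
    by (simp add: non_frattini_weight_def)
  also have "\<dots> = card {i. i < k \<and> \<not> N (Suc i) \<subseteq> frattini_over (N i)}"
    by (simp add: sum.If_cases Int_def Compl_eq lessThan_def)
  also have "\<dots> \<le> non_frattini_count G N k"
    unfolding non_frattini_count_def
  proof (rule card_mono)
    show "{i. i < k \<and> \<not> N (Suc i) \<subseteq> frattini_over (N i)} \<subseteq> {i. i < k \<and> \<not> frattini_chief_factor G (N (Suc i)) (N i)}"
    proof
      fix i assume i: "i \<in> {i. i < k \<and> \<not> N (Suc i) \<subseteq> frattini_over (N i)}"
      then have "N i \<lhd> G" "N (Suc i) \<subseteq> carrier G"
        using assms normal_subset[of "N (Suc i)"] by (auto simp: chief_series_def)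
      then show "i \<in> {i. i < k \<and> \<not> frattini_chief_factor G (N (Suc i)) (N i)}"
        using i frattini_chief_factor_subset[of "N i" "N (Suc i)"] by blast
    qed
  qed simp
  finally show "dlen {\<one>} \<le> non_frattini_count G N k" .
qed

end

theorem theorem3:
  fixes G :: "('a, 'b) monoid_scheme"
  assumes "group G" and "finite (carrier G)" and "solvable G"
  shows "(\<forall>N k. chief_series G N k \<longrightarrow> intersection_number G \<le> k) \<and>
         (nilpotent (G\<lparr>carrier := derived G (carrier G)\<rparr>) \<longrightarrow>
           (\<forall>N k. chief_series G N k \<longrightarrow> intersection_number G \<le> non_frattini_count G N k))"
proof -
  interpret group G by fact
  interpret finite_solvable_group G
    using assms by unfold_locales
  define T where "T = frattini G"
  have one: "{\<one>\<^bsub>G\<^esub>} \<lhd> G" by (rule one_is_normal)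
  have T: "T \<lhd> G" "{\<one>\<^bsub>G\<^esub>} \<subseteq> T" "frattini_over {\<one>\<^bsub>G\<^esub>} = T" "frattini_over T = T"
    using frattini_over_normal[OF one] subset_frattini_over[of "{\<one>\<^bsub>G\<^esub>}"] frattini_over_eq[of "{\<one>\<^bsub>G\<^esub>}" T]
    by (simp_all add: frattini_over_one T_def)
  show ?thesis
  proof (intro conjI impI allI)
    fix N k assume N: "chief_series G N k"
    \<comment> \<open>The family is bounded by the length above the Frattini subgroup
      \<open>T\<close>, which is at most that of the whole series.\<close>
    obtain \<M> where "finite \<M>" "\<forall>M\<in>\<M>. maximal_subgroup G M" "card \<M> \<le> clen T" "carrier G \<inter> \<Inter> \<M> \<subseteq> frattini G"
      using maximal_family_unit_length[OF one] T(3) by (auto simp: T_def)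
    then show "intersection_number G \<le> k"
      using intersection_number_le[of \<M>] unit_length_mono[OF one T(1,2)] chief_length_series(1)[OF N] by simp
  next
    fix N k assume nil: "nilpotent (G\<lparr>carrier := derived G (carrier G)\<rparr>)" and N: "chief_series G N k"
    obtain \<M> where "finite \<M>" "\<forall>M\<in>\<M>. maximal_subgroup G M" "card \<M> \<le> dlen T" "carrier G \<inter> \<Inter> \<M> \<subseteq> frattini G"
      using maximal_family_non_frattini_length[OF nil T(1,4)] by (auto simp: T_def)
    \<comment> \<open>Chief factors below the Frattini subgroup have weight 0.\<close>
    moreover have "dlen {\<one>\<^bsub>G\<^esub>} = dlen T" using non_frattini_length_eq[OF one T(1,2)] T(3) by simp
    ultimately show "intersection_number G \<le> non_frattini_count G N k"
      using intersection_number_le[of \<M>] chief_length_series(2)[OF N] by simp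
  qed
qed

end
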